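(* (a) Let $q\in[1,+\infty]$ and let lattices $\Lambda,\Lambda'\subset\mathbb{R}^2$ have obtuse superbases $B$ and $B'$ whose vectors have a maximum length $l$. If $\mathrm{SIM}_\infty(B,B')=\delta\geq 0$, then $\mathrm{RM}_q(\Lambda,\Lambda')\leq 3^{1/q}\sqrt{2l\delta}$. Hence the bijection $\mathrm{OSI}(\mathbb{R}^2)\to\mathrm{LIS}(\mathbb{R}^2)$ is continuous in the metrics $\mathrm{SIM}_\infty$ and $\mathrm{RM}_q$. (b) In the conditions above, the projected metric satisfies $\mathrm{PM}_q(\Lambda,\Lambda')\leq 2^{1/q}\,3\sqrt{2\delta/l}$, so the bijection $\mathrm{OSS}(\mathbb{R}^2)\to\mathrm{LSS}(\mathbb{R}^2)$ is continuous in the metrics $\mathrm{SIM}_\infty,\mathrm{PM}_q$. (c) In the oriented case, if $\delta\to 0$ then $\mathrm{RM}_q^o(\Lambda,\Lambda')\to 0$ and $\mathrm{PM}_q^o(\Lambda,\Lambda')\to 0$, so both $\mathrm{OSI}^o(\mathbb{R}^2)\to\mathrm{LIS}^o(\mathbb{R}^2)$ and $\mathrm{OSS}^o(\mathbb{R}^2)\to\mathrm{LSS}^o(\mathbb{R}^2)$ are continuous. For $q=+\infty$, both $2^{1/q}$ and $3^{1/q}$ are interpreted as their limit $1$.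
   Context: A lattice $\Lambda\subset\mathbb{R}^2$ is the set of all integer linear combinations of a linear basis. A superbase of $\Lambda$ is $B=\{v_0,v_1,v_2\}$, where $v_1,v_2$ is a basis generating $\Lambda$ and $v_0=-v_1-v_2$. It is obtuse if all $p_{ij}=-v_i\cdot v_j\geq 0$ for $i\ne j$. Every lattice in $\mathbb{R}^2$ has an obtuse superbase, unique up to isometry. A rigid motion is an orientation-preserving isometry; a similarity is a composition of an isometry and a uniform scaling by a positive factor. Lattice spaces: $\mathrm{LIS}(\mathbb{R}^2)$, $\mathrm{LIS}^o(\mathbb{R}^2)$, $\mathrm{LSS}(\mathbb{R}^2)$, $\mathrm{LSS}^o(\mathbb{R}^2)$ consist of all lattices in $\mathbb{R}^2$ up to isometry, rigid motion, similarity, and orientation-preserving similarity, respectively. Superbase spaces: for obtuse superbases $B=\{v_i\}_{i=0}^2$ and $B'=\{u_i\}_{i=0}^2$, put $\mathrm{SIM}_\infty(B,B')=\min_{f\in\mathrm{O}(\mathbb{R}^2)}\max_{i=0,1,2}|f(u_i)-v_i|$ and $\mathrm{SIM}^o_\infty(B,B')=\min_{f\in\mathrm{SO}(\mathbb{R}^2)}\max_{i=0,1,2}|f(u_i)-v_i|$. $\mathrm{OSI}(\mathbb{R}^2)$ is the space of obtuse superbases up to isometry with the metric $\mathrm{SIM}_\infty$; $\mathrm{OSI}^o(\mathbb{R}^2)$ is the space of obtuse superbases up to rigid motion with the metric $\mathrm{SIM}^o_\infty$. $\mathrm{OSS}(\mathbb{R}^2)$ and $\mathrm{OSS}^o(\mathbb{R}^2)$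 are the spaces of obtuse superbases up to similarity and orientation-preserving similarity, with the metrics $\mathrm{SSM}_\infty$ and $\mathrm{SSM}^o_\infty$ defined by minimising the same differences over $\mathrm{O}(\mathbb{R}^2)\times\mathbb{R}_+$ and $\mathrm{SO}(\mathbb{R}^2)\times\mathbb{R}_+$, respectively. The maps in the claim send (the class of) an obtuse superbase to (the class of) the lattice it generates. Invariants: $\mathrm{RI}(\Lambda)=(r_{12},r_{01},r_{02})$, $r_{12}\le r_{01}\le r_{02}$, is the increasingly ordered triple of root products $\sqrt{p_{ij}}$ of an obtuse superbase of $\Lambda$ (independent of its choice). With $\bar r_{ij}=r_{ij}/(r_{12}+r_{01}+r_{02})$, put $\mathrm{PI}(\Lambda)=(\bar r_{02}-\bar r_{01},\,3\bar r_{12})$. $\mathrm{sign}(\Lambda)=0$ if $\Lambda$ is mapped to itself by a reflection in a line; otherwise the vectors of an obtuse superbase have distinct lengths and $\mathrm{sign}(\Lambda)=\pm1$ is the sign of $\det(v_1,v_2)$ for the two shortest ones, $|v_1|<|v_2|$. Lattice metrics: $\mathrm{RM}_q(\Lambda,\Lambda')=\|\mathrm{RI}(\Lambda)-\mathrm{RI}(\Lambda')\|_q$ and $\mathrm{PM}_q(\Lambda,\Lambda')=\|\mathrm{PI}(\Lambda)-\mathrm{PI}(\Lambda')\|_q$, where $\|\cdot\|_q$ is the Minkowski $\ell_q$ norm. If $\mathrm{sign}(\Lambda)\,\mathrm{sign}(\Lambda')\geq0$, then $\mathrm{RM}_q^o(\Lambda,\Lambda')=\mathrm{RM}_q(\Lambda,\Lambda')$;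 otherwise $\mathrm{RM}_q^o(\Lambda,\Lambda')=\inf_{\mathrm{sign}(\Lambda_3)=0}\big(\mathrm{RM}_q(\Lambda,\Lambda_3)+\mathrm{RM}_q(\Lambda',\Lambda_3)\big)$. $\mathrm{PM}_q^o$ is defined in the same way from $\mathrm{PM}_q$. The oriented lattice spaces are considered with the metrics $\mathrm{RM}_q^o$ and $\mathrm{PM}_q^o$, respectively. *)

theory Defs
  imports "HOL-Analysis.Analysis"
begin

type_synonym plane = "real^2"

section \<open>Isometries and similarities of the plane\<close>

definition isometry :: "(plane \<Rightarrow> plane) \<Rightarrow> bool" where
  "isometry f \<longleftrightarrow> (\<forall>x y. dist (f x) (f y) = dist x y)"

definition similarity :: "(plane \<Rightarrow> plane) \<Rightarrow> bool" where
  "similarity f \<longleftrightarrow> (\<exists>g s. isometry g \<and> s > 0 \<and> f = (\<lambda>x. s *\<^sub>R g x))"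

definition orientation_preserving :: "(plane \<Rightarrow> plane) \<Rightarrow> bool" where
  "orientation_preserving f \<longleftrightarrow> (\<exists>A t. det A > 0 \<and> f = (\<lambda>x. A *v x + t))"

definition rigid_motion :: "(plane \<Rightarrow> plane) \<Rightarrow> bool" where
  "rigid_motion f \<longleftrightarrow> isometry f \<and> orientation_preserving f"

definition oriented_similarity :: "(plane \<Rightarrow> plane) \<Rightarrow> bool" where
  "oriented_similarity f \<longleftrightarrow> similarity f \<and> orientation_preserving f"

text \<open>The reflection in the line of all \<open>x\<close> with \<open>n \<bullet> x = c\<close>, where \<open>n\<close> has length 1.\<close>
definition line_reflection :: "plane \<Rightarrow> real \<Rightarrow> plane \<Rightarrow> plane" where
  "line_reflection n c x = x - (2 * (n \<bullet> x - c)) *\<^sub>R n"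


section \<open>Lattices and obtuse superbases\<close>

definition int_span :: "plane set \<Rightarrow> plane set" where
  "int_span S = {(\<Sum>v\<in>S. of_int (c v) *\<^sub>R v) |c :: plane \<Rightarrow> int. True}"

definition lattices :: "plane set set" where
  "lattices = {int_span S |S. independent S \<and> span S = UNIV}"

text \<open>
  A labelled superbase is a function on the three-element index type, whose elements are
  \<open>0\<close>, \<open>1\<close>, \<open>2\<close>. A superbase proper is the unordered set \<open>range v\<close>.
\<close>
definition superbase :: "(3 \<Rightarrow> plane) \<Rightarrow> plane set \<Rightarrow> bool" where
  "superbase v \<Lambda> \<longleftrightarrow>
     v 1 \<noteq> v 2 \<and> independent {v 1, v 2} \<and> int_span {v 1, v 2} = \<Lambda> \<and> v 0 = - v 1 - v 2"

definition conorm :: "(3 \<Rightarrow> plane) \<Rightarrow> 3 \<Rightarrow> 3 \<Rightarrow> real" where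
  "conorm v i j = - (v i \<bullet> v j)"

definition labelled_obtuse_superbase :: "(3 \<Rightarrow> plane) \<Rightarrow> plane set \<Rightarrow> bool" where
  "labelled_obtuse_superbase v \<Lambda> \<longleftrightarrow> superbase v \<Lambda> \<and> (\<forall>i j. i \<noteq> j \<longrightarrow> conorm v i j \<ge> 0)"

definition obtuse_superbase :: "plane set \<Rightarrow> plane set \<Rightarrow> bool" where
  "obtuse_superbase B \<Lambda> \<longleftrightarrow> (\<exists>v. range v = B \<and> labelled_obtuse_superbase v \<Lambda>)"

definition obtuse_superbases :: "plane set set" where
  "obtuse_superbases = {B. \<exists>\<Lambda>. obtuse_superbase B \<Lambda>}"


section \<open>Spaces of lattices and of obtuse superbases\<close>

definition equiv_by :: "(plane \<Rightarrow> plane) set \<Rightarrow> plane set set \<Rightarrow> (plane set \<times> plane set) set" where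
  "equiv_by G S = {(X, Y). X \<in> S \<and> Y \<in> S \<and> (\<exists>f\<in>G. f ` X = Y)}"

definition lattice_space :: "(plane \<Rightarrow> plane) set \<Rightarrow> plane set set set" where
  "lattice_space G = lattices // equiv_by G lattices"

text \<open>
  Superbases may be compared by the same affine maps as lattices: the vectors of a superbase have
  sum zero, so an affine map taking one superbase to another has no translation part.
\<close>
definition superbase_space :: "(plane \<Rightarrow> plane) set \<Rightarrow> plane set set set" where
  "superbase_space G = obtuse_superbases // equiv_by G obtuse_superbases"

abbreviation "LIS \<equiv> lattice_space {f. isometry f}"
abbreviation "LISo \<equiv> lattice_space {f. rigid_motion f}"
abbreviation "LSS \<equiv> lattice_space {f. similarity f}"
abbreviation "LSSo \<equiv> lattice_space {f. oriented_similarity f}"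

abbreviation "OSI \<equiv> superbase_space {f. isometry f}"
abbreviation "OSIo \<equiv> superbase_space {f. rigid_motion f}"
abbreviation "OSS \<equiv> superbase_space {f. similarity f}"
abbreviation "OSSo \<equiv> superbase_space {f. oriented_similarity f}"

text \<open>The map sending the class of an obtuse superbase to the class of the lattice it generates.\<close>
definition generated_class :: "(plane \<Rightarrow> plane) set \<Rightarrow> plane set set \<Rightarrow> plane set set" where
  "generated_class G X = (\<Union>B\<in>X. equiv_by G lattices `` {int_span B})"


section \<open>Distances between obtuse superbases\<close>

text \<open>
  Superbases are unordered, so besides the maps \<open>f\<close> the minimum runs over all labellings
  \<open>v\<close> of \<open>B\<close> and \<open>u\<close> of \<open>B'\<close>.
\<close>
definition min_deviation :: "(plane \<Rightarrow> plane) set \<Rightarrow> plane set \<Rightarrow> plane set \<Rightarrow> real" where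
  "min_deviation F B B' =
     Inf {Max (range (\<lambda>i::3. norm (f (u i) - v i))) |f u v. f \<in> F \<and> range v = B \<and> range u = B'}"

definition O2 :: "(plane \<Rightarrow> plane) set" where
  "O2 = {f. orthogonal_transformation f}"

definition SO2 :: "(plane \<Rightarrow> plane) set" where
  "SO2 = {f. orthogonal_transformation f \<and> det (matrix f) = 1}"

definition scaled :: "(plane \<Rightarrow> plane) set \<Rightarrow> (plane \<Rightarrow> plane) set" where
  "scaled F = {(\<lambda>x. s *\<^sub>R f x) |s f. s > 0 \<and> f \<in> F}"

definition SIM :: "plane set \<Rightarrow> plane set \<Rightarrow> real" where
  "SIM = min_deviation O2"

definition SIMo :: "plane set \<Rightarrow> plane set \<Rightarrow> real" where
  "SIMo = min_deviation SO2"

text \<open>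
  The scaled distances do not depend on the scale of the second superbase, but they are
  proportional to the scale of the first one.
\<close>
definition SSM :: "plane set \<Rightarrow> plane set \<Rightarrow> real" where
  "SSM = min_deviation (scaled O2)"

definition SSMo :: "plane set \<Rightarrow> plane set \<Rightarrow> real" where
  "SSMo = min_deviation (scaled SO2)"


section \<open>Invariants of lattices\<close>

definition root_product :: "(3 \<Rightarrow> plane) \<Rightarrow> 3 \<Rightarrow> 3 \<Rightarrow> real" where
  "root_product v i j = sqrt (conorm v i j)"

text \<open>The components of \<open>RI \<Lambda>\<close> are, in this order, \<open>r\<^sub>1\<^sub>2 \<le> r\<^sub>0\<^sub>1 \<le> r\<^sub>0\<^sub>2\<close>.\<close>
definition RI :: "plane set \<Rightarrow> real^3" where
  "RI \<Lambda> = (THE r. \<exists>v. labelled_obtuse_superbase v \<Lambda> \<and>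
     root_product v 1 2 \<le> root_product v 0 1 \<and> root_product v 0 1 \<le> root_product v 0 2 \<and>
     r = vector [root_product v 1 2, root_product v 0 1, root_product v 0 2])"

definition PI :: "plane set \<Rightarrow> real^2" where
  "PI \<Lambda> = (let r12 = RI \<Lambda> $ 1; r01 = RI \<Lambda> $ 2; r02 = RI \<Lambda> $ 3; s = r12 + r01 + r02
            in vector [r02 / s - r01 / s, 3 * (r12 / s)])"

definition lattice_sign :: "plane set \<Rightarrow> real" where
  "lattice_sign \<Lambda> =
     (if \<exists>n c. norm n = 1 \<and> line_reflection n c ` \<Lambda> = \<Lambda> then 0
      else THE s. \<exists>v. labelled_obtuse_superbase v \<Lambda> \<and>
             norm (v 1) < norm (v 2) \<and> norm (v 2) < norm (v 0) \<and>
             s = sgn (det (vector [v 1, v 2] :: real^2^2)))"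


section \<open>Metrics on lattices\<close>

definition minkowski_norm :: "ereal \<Rightarrow> real^'n \<Rightarrow> real" where
  "minkowski_norm q x =
     (if q = \<infinity> then Max (range (\<lambda>i. \<bar>x $ i\<bar>))
      else (\<Sum>i\<in>UNIV. \<bar>x $ i\<bar> powr real_of_ereal q) powr (1 / real_of_ereal q))"

definition RM :: "ereal \<Rightarrow> plane set \<Rightarrow> plane set \<Rightarrow> real" where
  "RM q \<Lambda> \<Lambda>' = minkowski_norm q (RI \<Lambda> - RI \<Lambda>')"

definition PM :: "ereal \<Rightarrow> plane set \<Rightarrow> plane set \<Rightarrow> real" where
  "PM q \<Lambda> \<Lambda>' = minkowski_norm q (PI \<Lambda> - PI \<Lambda>')"

definition oriented_metric ::
    "(plane set \<Rightarrow> plane set \<Rightarrow> real) \<Rightarrow> plane set \<Rightarrow> plane set \<Rightarrow> real" where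
  "oriented_metric d \<Lambda> \<Lambda>' =
     (if lattice_sign \<Lambda> * lattice_sign \<Lambda>' \<ge> 0 then d \<Lambda> \<Lambda>'
      else INF \<Lambda>\<^sub>3 \<in> {\<Lambda>\<^sub>3 \<in> lattices. lattice_sign \<Lambda>\<^sub>3 = 0}. d \<Lambda> \<Lambda>\<^sub>3 + d \<Lambda>' \<Lambda>\<^sub>3)"

definition RMo :: "ereal \<Rightarrow> plane set \<Rightarrow> plane set \<Rightarrow> real" where
  "RMo q = oriented_metric (RM q)"

definition PMo :: "ereal \<Rightarrow> plane set \<Rightarrow> plane set \<Rightarrow> real" where
  "PMo q = oriented_metric (PM q)"


section \<open>Continuity of maps between spaces of classes\<close>

text \<open>
  \<open>\<Phi>\<close> is a map from the set of classes \<open>S\<close> to the set of classes \<open>T\<close>; the distances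
  \<open>d\<close> and \<open>e\<close> of classes are evaluated on arbitrary representatives. Since \<open>\<eta>\<close> is
  chosen after the representative \<open>B\<close>, the definition also makes sense for \<open>SSM\<close> and \<open>SSMo\<close>:
  rescaling \<open>B\<close> only rescales \<open>\<eta>\<close>.
\<close>
definition continuous_class_map ::
    "'a set set \<Rightarrow> ('a \<Rightarrow> 'a \<Rightarrow> real) \<Rightarrow> 'b set set \<Rightarrow> ('b \<Rightarrow> 'b \<Rightarrow> real) \<Rightarrow> ('a set \<Rightarrow> 'b set) \<Rightarrow> bool"
  where
  "continuous_class_map S d T e \<Phi> \<longleftrightarrow> \<Phi> ` S \<subseteq> T \<and>
     (\<forall>X\<in>S. \<forall>B\<in>X. \<forall>\<epsilon>>0. \<exists>\<eta>>0. \<forall>Y\<in>S. \<forall>B'\<in>Y. d B B' < \<eta> \<longrightarrow>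
        (\<forall>\<Lambda>\<in>\<Phi> X. \<forall>\<Lambda>'\<in>\<Phi> Y. e \<Lambda> \<Lambda>' < \<epsilon>))"

end

theory Submission
  imports Defs
begin

text \<open>
  Close superbases have close conorms, because \<open>|a \<bullet> b - c \<bullet> d| \<le> 2 l \<delta>\<close> for vectors of length at
  most \<open>l\<close> at distances at most \<open>\<delta>\<close>; sorting does not increase the maximal difference, and
  \<open>|sqrt a - sqrt b| \<le> sqrt |a - b|\<close>. For the projected invariants one writes
  \<open>\<sigma> (r / \<sigma> - r' / \<sigma>') = (r - r') - (r' / \<sigma>') (\<sigma> - \<sigma>')\<close>, where \<open>\<sigma>\<close>, the sum of the root products
  of the superbase that contains a vector of length \<open>l\<close>, is at least \<open>l\<close>. In the oriented case the
  sign of a lattice is the sign of a polynomial in the vectors of the superbase; if it changes between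
  two close superbases, then one of its factors is small, and there is an achiral lattice nearby.
\<close>

text \<open>\<open>RI\<close> and \<open>lattice_sign\<close> are definite descriptions, so every
  estimate presupposes that obtuse superbases exist (Selling's reduction) and are unique up to
  isometry (matching by classes of the lattice modulo 2). Indexing a conorm by the label that it
  omits makes conorms and squared lengths linear functions of each other and keeps the formulas
  symmetric in the labels. The constant 3 for the second coordinate of \<open>PI\<close> is the
  delicate one: the difference of the ratios is a combination of root differences of total weight
  \<open>1 + a\<close>, where \<open>a\<close> is the smallest ratio of one lattice. This weight
  exceeds 1 only if the smallest root is positive, and then a root whose square changes by at most
  \<open>e\<^sup>2\<close> grows by less than \<open>e\<close>; the two effects compensate.
  \<open>min_deviation\<close> is an infimum, so bounds are proved for every number above it and
  then passed on. All six continuity claims come from one lemma with two parameters: the linear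
  group that defines the classes and the set of maps that defines the distance.\<close>

lemma UNIV3: "(UNIV :: 3 set) = {0, 1, 2}"
proof -
  have "(3::3) = 0" by simp
  then show ?thesis using UNIV_3 by blast
qed

lemma ne3: "(0::3) \<noteq> 1" "(0::3) \<noteq> 2" "(1::3) \<noteq> 2" "(1::3) \<noteq> 0" "(2::3) \<noteq> 0" "(2::3) \<noteq> 1" by simp_all

lemma sum3: "(\<Sum>k\<in>(UNIV::3 set). f k) = f 0 + f 1 + (f 2 :: 'a::comm_monoid_add)"
  unfolding UNIV3 by (simp add: ne3 add.assoc)

lemma arith3: "(0::3) + 1 = 1" "(0::3) + 2 = 2" "(1::3) + 2 = 0" "(2::3) + 1 = 0" "(2::3) + 2 = 1" "(1::3) + 1 = 2"
  "(3::3) = 0" "(4::3) = 1"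
  by simp_all

lemma cases3: obtains "i = (0::3)" | "i = 1" | "i = 2"
  using UNIV3 by blast

lemma bij3_cases:
  fixes \<pi> :: "3 \<Rightarrow> 3"
  assumes "bij \<pi>"
  obtains "\<pi> 0 = 0" "\<pi> 1 = 1" "\<pi> 2 = 2" | "\<pi> 0 = 0" "\<pi> 1 = 2" "\<pi> 2 = 1"
    | "\<pi> 0 = 1" "\<pi> 1 = 0" "\<pi> 2 = 2" | "\<pi> 0 = 1" "\<pi> 1 = 2" "\<pi> 2 = 0"
    | "\<pi> 0 = 2" "\<pi> 1 = 0" "\<pi> 2 = 1" | "\<pi> 0 = 2" "\<pi> 1 = 1" "\<pi> 2 = 0"
proof -
  have "\<pi> 0 \<noteq> \<pi> 1" "\<pi> 0 \<noteq> \<pi> 2" "\<pi> 1 \<noteq> \<pi> 2"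
    using bij_is_inj[OF assms] ne3 by (simp_all add: inj_eq)
  then have "(\<pi> 0 = 0 \<and> \<pi> 1 = 1 \<and> \<pi> 2 = 2) \<or> (\<pi> 0 = 0 \<and> \<pi> 1 = 2 \<and> \<pi> 2 = 1)
    \<or> (\<pi> 0 = 1 \<and> \<pi> 1 = 0 \<and> \<pi> 2 = 2) \<or> (\<pi> 0 = 1 \<and> \<pi> 1 = 2 \<and> \<pi> 2 = 0)
    \<or> (\<pi> 0 = 2 \<and> \<pi> 1 = 0 \<and> \<pi> 2 = 1) \<or> (\<pi> 0 = 2 \<and> \<pi> 1 = 1 \<and> \<pi> 2 = 0)"
    by (cases "\<pi> 0" rule: cases3; cases "\<pi> 1" rule: cases3; cases "\<pi> 2" rule: cases3) simp_all
  then show ?thesis using that by blast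
qed

section \<open>Superbases and their conorms\<close>

definition det2 :: "plane \<Rightarrow> plane \<Rightarrow> real" where
  "det2 x y = x $ 1 * y $ 2 - x $ 2 * y $ 1"

text \<open>Summing over all three labels keeps the definition symmetric, so that relabelling is a
  reindexing of the sum. The price is that coefficients are determined only up to a common
  summand.\<close>

definition lat :: "(3 \<Rightarrow> plane) \<Rightarrow> plane set" where
  "lat v = {\<Sum>k\<in>UNIV. of_int (c k) *\<^sub>R v k |c :: 3 \<Rightarrow> int. True}"

text \<open>The given notion of labelled obtuse superbase with its lattice stripped off;
  \<open>labelled_iff\<close> is the link.\<close>

definition obtuse :: "(3 \<Rightarrow> plane) \<Rightarrow> bool" where
  "obtuse v \<longleftrightarrow> v 0 + v 1 + v 2 = 0 \<and> det2 (v 1) (v 2) \<noteq> 0 \<and> (\<forall>i j. i \<noteq> j \<longrightarrow> v i \<bullet> v j \<le> 0)"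

text \<open>\<open>opp v k\<close> is the conorm of the two vectors other than \<open>v k\<close>; the labels live in the
  integers modulo 3.\<close>
definition opp :: "(3 \<Rightarrow> plane) \<Rightarrow> 3 \<Rightarrow> real" where
  "opp v k = - (v (k + 1) \<bullet> v (k + 2))"

section \<open>Planar determinants: Lagrange's identity and Cramer's rule\<close>

lemma det2_eq_det: "det2 x y = det (vector [x, y] :: real^2^2)"
  by (simp add: det2_def det_2)

lemma inner2: "(x::plane) \<bullet> y = x $ 1 * y $ 1 + x $ 2 * y $ 2"
  by (simp add: inner_vec_def sum_2)

lemma det2_bilinear:
  "det2 (x + y) z = det2 x z + det2 y z" "det2 (x - y) z = det2 x z - det2 y z"
  "det2 z (x + y) = det2 z x + det2 z y" "det2 z (x - y) = det2 z x - det2 z y"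
  "det2 (a *\<^sub>R x) y = a * det2 x y" "det2 x (a *\<^sub>R y) = a * det2 x y"
  "det2 (- x) y = - det2 x y" "det2 x (- y) = - det2 x y" "det2 x x = 0"
  by (simp_all add: det2_def algebra_simps)

lemma det2_swap: "det2 y x = - det2 x y"
  by (simp add: det2_def)

lemma det2_zero [simp]: "det2 0 x = 0" "det2 x 0 = 0"
  by (simp_all add: det2_def)

lemma det2_square: "(det2 x y)\<^sup>2 = (x \<bullet> x) * (y \<bullet> y) - (x \<bullet> y)\<^sup>2"
  unfolding det2_def inner2 by (simp add: power2_eq_square algebra_simps)

lemma abs_det2_le: "\<bar>det2 x y\<bar> \<le> norm x * norm y"
proof (rule power2_le_imp_le)
  show "\<bar>det2 x y\<bar>\<^sup>2 \<le> (norm x * norm y)\<^sup>2"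
    using det2_square[of x y] by (simp add: power_mult_distrib dot_square_norm)
qed simp

lemma det2_eq_0_iff: "det2 x y = 0 \<longleftrightarrow> y = 0 \<or> (\<exists>k. x = k *\<^sub>R y)"
proof
  assume d: "det2 x y = 0"
  show "y = 0 \<or> (\<exists>k. x = k *\<^sub>R y)"
  proof (cases "y $ 1 = 0")
    case True
    show ?thesis
    proof (cases "y $ 2 = 0")
      case True
      with \<open>y $ 1 = 0\<close> show ?thesis by (simp add: vec_eq_iff forall_2)
    next
      case False
      with \<open>y $ 1 = 0\<close> d have "x = (x $ 2 / y $ 2) *\<^sub>R y"
        by (simp add: vec_eq_iff forall_2 det2_def)
      then show ?thesis by blast
    qed
  next
    case False
    with d have "x = (x $ 1 / y $ 1) *\<^sub>R y"
      by (simp add: vec_eq_iff forall_2 det2_def field_simps)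
    then show ?thesis by blast
  qed
qed (auto simp: det2_bilinear)

lemma independent_pair_iff: "x \<noteq> y \<and> independent {x, y} \<longleftrightarrow> det2 x y \<noteq> 0"
proof -
  have "independent {y} \<longleftrightarrow> y \<noteq> 0" by (simp add: dependent_single)
  moreover have "x = y \<Longrightarrow> det2 x y = 0" by (simp add: det2_bilinear)
  ultimately show ?thesis
    by (auto simp: independent_insert det2_eq_0_iff span_singleton)
qed

text \<open>Cramer's rule with the denominator cleared.\<close>

lemma det2_solve: "det2 x y *\<^sub>R z = det2 z y *\<^sub>R x + det2 x z *\<^sub>R y"
  by (simp add: vec_eq_iff forall_2 det2_def algebra_simps)

lemma det2_expand:
  assumes "det2 x y \<noteq> 0"
  shows "z = (det2 z y / det2 x y) *\<^sub>R x + (det2 x z / det2 x y) *\<^sub>R y"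
proof -
  have "z = (1 / det2 x y) *\<^sub>R (det2 x y *\<^sub>R z)" using assms by simp
  also have "\<dots> = (det2 z y / det2 x y) *\<^sub>R x + (det2 x z / det2 x y) *\<^sub>R y"
    unfolding det2_solve[of x y z] by (simp add: scaleR_right_distrib)
  finally show ?thesis .
qed

lemma span_pair:
  assumes "det2 x y \<noteq> 0"
  shows "span {x, y} = UNIV"
proof -
  have "z \<in> span {x, y}" for z
    by (subst det2_expand[OF assms, of z]) (simp add: span_add span_mul span_base)
  then show ?thesis by blast
qed

section \<open>The given notions of lattice and superbase in terms of labelled vectors\<close>

lemma int_span_pair:
  assumes "x \<noteq> y"
  shows "int_span {x, y} = {of_int a *\<^sub>R x + of_int b *\<^sub>R y |a b. True}"
proof -
  have "\<exists>c :: plane \<Rightarrow> int. of_int a *\<^sub>R x + of_int b *\<^sub>R y = (\<Sum>v\<in>{x, y}. of_int (c v) *\<^sub>R v)" for a b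
    using assms by (intro exI[of _ "\<lambda>w. if w = x then a else b"]) auto
  moreover have "\<exists>a b. (\<Sum>v\<in>{x, y}. of_int (c v) *\<^sub>R v) = of_int a *\<^sub>R x + of_int b *\<^sub>R y"
    for c :: "plane \<Rightarrow> int"
    using assms by (intro exI[of _ "c x"] exI[of _ "c y"]) auto
  ultimately show ?thesis
    unfolding int_span_def by (auto 0 3)
qed

lemma superbase_v0: "v 0 + v 1 + v 2 = 0 \<Longrightarrow> v 0 = - v 1 - v 2" for v :: "3 \<Rightarrow> plane"
  by (simp add: algebra_simps eq_neg_iff_add_eq_0)

lemma lat_eq:
  assumes "v 0 + v 1 + v 2 = 0"
  shows "lat v = {of_int a *\<^sub>R v 1 + of_int b *\<^sub>R v 2 |a b. True}"
proof -
  have v0: "v 0 = - v 1 - v 2" by (rule superbase_v0[OF assms])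
  have "\<exists>c :: 3 \<Rightarrow> int. of_int a *\<^sub>R v 1 + of_int b *\<^sub>R v 2 = (\<Sum>k\<in>UNIV. of_int (c k) *\<^sub>R v k)" for a b
    by (intro exI[of _ "\<lambda>k. if k = 1 then a else if k = 2 then b else 0"]) (simp add: sum3 ne3)
  moreover have "\<exists>a b. (\<Sum>k\<in>UNIV. of_int (c k) *\<^sub>R v k) = of_int a *\<^sub>R v 1 + of_int b *\<^sub>R v 2"
    for c :: "3 \<Rightarrow> int"
    by (intro exI[of _ "c 1 - c 0"] exI[of _ "c 2 - c 0"]) (simp add: sum3 v0 algebra_simps)
  ultimately show ?thesis
    unfolding lat_def by (auto 0 3)
qed

lemma superbase_iff:
  "superbase v \<Lambda> \<longleftrightarrow> v 0 + v 1 + v 2 = 0 \<and> det2 (v 1) (v 2) \<noteq> 0 \<and> \<Lambda> = lat v"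
proof -
  have "v 0 = - v 1 - v 2 \<longleftrightarrow> v 0 + v 1 + v 2 = 0"
    by (simp add: algebra_simps eq_neg_iff_add_eq_0)
  moreover have "lat v = int_span {v 1, v 2}" if "v 0 + v 1 + v 2 = 0" "v 1 \<noteq> v 2"
    using that by (simp add: lat_eq int_span_pair)
  ultimately show ?thesis
    unfolding superbase_def using independent_pair_iff[of "v 1" "v 2"] by metis
qed

lemma labelled_iff: "labelled_obtuse_superbase v \<Lambda> \<longleftrightarrow> obtuse v \<and> \<Lambda> = lat v"
  unfolding labelled_obtuse_superbase_def superbase_iff obtuse_def conorm_def by auto

lemma lat_in_lattices:
  assumes "v 0 + v 1 + v 2 = 0" "det2 (v 1) (v 2) \<noteq> 0"
  shows "lat v \<in> lattices"
proof -
  have "v 1 \<noteq> v 2 \<and> independent {v 1, v 2}" using assms independent_pair_iff by blast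
  then show ?thesis
    unfolding lattices_def mem_Collect_eq using assms
    by (intro exI[of _ "{v 1, v 2}"]) (simp add: lat_eq span_pair int_span_pair)
qed

lemma obtuseD:
  assumes "obtuse v"
  shows "v 0 + v 1 + v 2 = 0" "det2 (v 1) (v 2) \<noteq> 0" "i \<noteq> j \<Longrightarrow> v i \<bullet> v j \<le> 0"
  using assms by (auto simp: obtuse_def)

lemma obtuse_v0: "obtuse v \<Longrightarrow> v 0 = - v 1 - v 2"
  by (rule superbase_v0) (rule obtuseD(1))

lemma obtuse_lat: "obtuse v \<Longrightarrow> lat v \<in> lattices"
  by (simp add: lat_in_lattices obtuseD)

section \<open>Conorms, lengths and the determinant\<close>

lemma opp_simps: "opp v 0 = - (v 1 \<bullet> v 2)" "opp v 1 = - (v 2 \<bullet> v 0)" "opp v 2 = - (v 0 \<bullet> v 1)"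
  by (simp_all add: opp_def arith3)

lemma opp_nonneg: "obtuse v \<Longrightarrow> 0 \<le> opp v k"
  unfolding opp_def by (simp add: obtuseD)

lemma norm_sq_eq_opp:
  assumes "v 0 + v 1 + v 2 = 0"
  shows "(norm (v k))\<^sup>2 = opp v (k + 1) + opp v (k + 2)"
proof -
  have e: "v 0 = - v 1 - v 2" by (rule superbase_v0[OF assms])
  show ?thesis
    by (cases k rule: cases3)
      (simp_all add: power2_norm_eq_inner opp_simps arith3 e inner_diff inner_commute)
qed

text \<open>Solves the three equations of \<open>norm_sq_eq_opp\<close>. Hence lengths determine
  conorms, and a longer vector has a smaller conorm; orderings by length are translated this
  way.\<close>

lemma opp_eq_norms:
  assumes "v 0 + v 1 + v 2 = 0"
  shows "opp v k = (\<Sum>i\<in>UNIV. (norm (v i))\<^sup>2) / 2 - (norm (v k))\<^sup>2"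
  by (cases k rule: cases3)
    (simp_all add: sum3 norm_sq_eq_opp[OF assms] arith3 field_simps)

text \<open>Selling's formula, which shows the minimality of superbase vectors because its weights
  are nonnegative for obtuse superbases. The free label \<open>i\<close> lets
  \<open>class_min\<close> single out one vector.\<close>

lemma norm_sq_comb:
  assumes "v 0 + v 1 + v 2 = 0"
  shows "(norm (\<Sum>k\<in>UNIV. c k *\<^sub>R v k))\<^sup>2
    = opp v (i + 2) * (c i - c (i + 1))\<^sup>2 + opp v (i + 1) * (c i - c (i + 2))\<^sup>2
      + opp v i * (c (i + 1) - c (i + 2))\<^sup>2"
proof -
  have e: "v 0 = - v 1 - v 2" by (rule superbase_v0[OF assms])
  have "(\<Sum>k\<in>UNIV. c k *\<^sub>R v k) = (c 1 - c 0) *\<^sub>R v 1 + (c 2 - c 0) *\<^sub>R v 2"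
    by (simp add: sum3 e algebra_simps)
  then have "(norm (\<Sum>k\<in>UNIV. c k *\<^sub>R v k))\<^sup>2
    = ((c 1 - c 0) *\<^sub>R v 1 + (c 2 - c 0) *\<^sub>R v 2) \<bullet> ((c 1 - c 0) *\<^sub>R v 1 + (c 2 - c 0) *\<^sub>R v 2)"
    by (simp only: power2_norm_eq_inner)
  then show ?thesis
    by (cases i rule: cases3)
      (simp_all add: opp_simps arith3 e inner2 power2_eq_square algebra_simps)
qed

text \<open>The squared area of a cell. For nonnegative conorms a small determinant forces all
  pairwise products to be small, which \<open>near_achiral\<close> exploits.\<close>

lemma det2_sq_opp:
  assumes "v 0 + v 1 + v 2 = 0"
  shows "(det2 (v 1) (v 2))\<^sup>2 = opp v 0 * opp v 1 + opp v 1 * opp v 2 + opp v 2 * opp v 0"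
proof -
  have e: "v 0 = - v 1 - v 2" by (rule superbase_v0[OF assms])
  show ?thesis
    by (simp add: opp_simps e inner2 det2_def power2_eq_square algebra_simps)
qed

section \<open>Relabelling, and the passage between labelled and unordered superbases\<close>

lemma lat_comp_bij:
  assumes "bij \<pi>"
  shows "lat (v \<circ> \<pi>) = lat v"
proof -
  have r: "(\<Sum>k\<in>UNIV. of_int (c (\<pi> k)) *\<^sub>R v (\<pi> k)) = (\<Sum>k\<in>UNIV. of_int (c k) *\<^sub>R v k)" for c :: "3 \<Rightarrow> int"
    using sum.reindex_bij_betw[OF assms, of "\<lambda>k. of_int (c k) *\<^sub>R v k"] by simp
  have "\<exists>d :: 3 \<Rightarrow> int. (\<Sum>k\<in>UNIV. of_int (c k) *\<^sub>R v (\<pi> k)) = (\<Sum>k\<in>UNIV. of_int (d k) *\<^sub>R v k)" for c :: "3 \<Rightarrow> int"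
    using r[of "c \<circ> inv \<pi>"] by (intro exI[of _ "c \<circ> inv \<pi>"]) (simp add: bij_is_inj[OF assms])
  moreover have "\<exists>d :: 3 \<Rightarrow> int. (\<Sum>k\<in>UNIV. of_int (c k) *\<^sub>R v k) = (\<Sum>k\<in>UNIV. of_int (d k) *\<^sub>R v (\<pi> k))" for c :: "3 \<Rightarrow> int"
    by (intro exI[of _ "c \<circ> \<pi>"]) (simp add: r)
  ultimately show ?thesis
    unfolding lat_def comp_def by (auto 0 4)
qed

lemma superbase_comp_bij:
  fixes v :: "3 \<Rightarrow> plane" and \<pi> :: "3 \<Rightarrow> 3"
  assumes "bij \<pi>" "v 0 + v 1 + v 2 = 0" "det2 (v 1) (v 2) \<noteq> 0"
  shows "v (\<pi> 0) + v (\<pi> 1) + v (\<pi> 2) = 0" "det2 (v (\<pi> 1)) (v (\<pi> 2)) \<noteq> 0"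
proof -
  have e: "v 0 = - v 1 - v 2" by (rule superbase_v0[OF assms(2)])
  have "v (\<pi> 0) + v (\<pi> 1) + v (\<pi> 2) = 0 \<and> det2 (v (\<pi> 1)) (v (\<pi> 2)) \<noteq> 0"
    using assms(1) by (rule bij3_cases)
      (use assms(2,3) in \<open>simp_all add: e det2_bilinear det2_swap[of "v 1" "v 2"]\<close>)
  then show "v (\<pi> 0) + v (\<pi> 1) + v (\<pi> 2) = 0" "det2 (v (\<pi> 1)) (v (\<pi> 2)) \<noteq> 0" by auto
qed

lemma obtuse_comp_bij:
  fixes v :: "3 \<Rightarrow> plane" and \<pi> :: "3 \<Rightarrow> 3"
  assumes "bij \<pi>" "obtuse v"
  shows "obtuse (v \<circ> \<pi>)"
proof -
  have "i \<noteq> j \<Longrightarrow> \<pi> i \<noteq> \<pi> j" for i j using bij_is_inj[OF assms(1)] by (auto dest: injD)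
  then show ?thesis
    using assms(2) superbase_comp_bij[OF assms(1) obtuseD(1,2)[OF assms(2)]] unfolding obtuse_def by simp
qed

text \<open>Two equal vectors would have a product that is both a square and at most 0, so both
  would vanish. Injectivity is what allows a labelling to be recovered from \<open>range v\<close>
  up to a permutation.\<close>

lemma obtuse_inj:
  assumes "obtuse v"
  shows "inj v"
proof -
  have "v i \<noteq> v j" if "i \<noteq> j" for i j
  proof
    assume "v i = v j"
    then have "(norm (v i))\<^sup>2 \<le> 0"
      using obtuseD(3)[OF assms that] by (simp add: power2_norm_eq_inner)
    then have z: "v i = 0" "v j = 0" using \<open>v i = v j\<close> by simp_all
    then show False
      using obtuseD(2)[OF assms] obtuse_v0[OF assms] that
      by (cases i rule: cases3; cases j rule: cases3) auto
  qed
  then show ?thesis by (auto simp: inj_on_def)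
qed

lemma int_span_range:
  assumes "inj v"
  shows "int_span (range v) = lat v"
proof -
  have "\<exists>d :: 3 \<Rightarrow> int. (\<Sum>x\<in>range v. of_int (c x) *\<^sub>R x) = (\<Sum>k\<in>UNIV. of_int (d k) *\<^sub>R v k)" for c :: "plane \<Rightarrow> int"
    by (intro exI[of _ "c \<circ> v"]) (simp add: sum.reindex[OF assms])
  moreover have "\<exists>c :: plane \<Rightarrow> int. (\<Sum>k\<in>UNIV. of_int (d k) *\<^sub>R v k) = (\<Sum>x\<in>range v. of_int (c x) *\<^sub>R x)" for d :: "3 \<Rightarrow> int"
    by (intro exI[of _ "d \<circ> inv v"]) (simp add: sum.reindex[OF assms] inv_f_f[OF assms])
  ultimately show ?thesis
    unfolding int_span_def lat_def by (auto 0 4)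
qed

lemma relabel:
  fixes v u :: "3 \<Rightarrow> 'a"
  assumes "inj v" "range u = range v"
  obtains \<pi> where "bij \<pi>" "u = v \<circ> \<pi>"
proof -
  define \<pi> where "\<pi> = inv v \<circ> u"
  have e: "v (\<pi> k) = u k" for k
    using assms(2) unfolding \<pi>_def by (simp add: f_inv_into_f[of "u k" v UNIV] flip: assms(2))
  have "surj \<pi>"
  proof -
    have "\<exists>i. \<pi> i = k" for k
    proof -
      obtain i where "v k = u i" using assms(2) by blast
      then have "\<pi> i = k" unfolding \<pi>_def using assms(1) by (simp flip: \<open>v k = u i\<close>)
      then show ?thesis by blast
    qed
    then show ?thesis by (metis surjI)
  qed
  then have "bij \<pi>" by (simp add: bij_def finite_UNIV_surj_inj)
  moreover have "u = v \<circ> \<pi>" using e by auto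
  ultimately show ?thesis using that by blast
qed

section \<open>Uniqueness and existence of obtuse superbases\<close>

lemma latI: "x = (\<Sum>k\<in>UNIV. of_int (c k) *\<^sub>R v k) \<Longrightarrow> x \<in> lat v"
  unfolding lat_def by auto

lemma lat_add: "x \<in> lat v \<Longrightarrow> y \<in> lat v \<Longrightarrow> x + y \<in> lat v"
proof -
  assume "x \<in> lat v" "y \<in> lat v"
  then obtain c d :: "3 \<Rightarrow> int" where "x = (\<Sum>k\<in>UNIV. of_int (c k) *\<^sub>R v k)" "y = (\<Sum>k\<in>UNIV. of_int (d k) *\<^sub>R v k)"
    unfolding lat_def by blast
  then have "x + y = (\<Sum>k\<in>UNIV. of_int (c k + d k) *\<^sub>R v k)"
    by (simp add: sum.distrib scaleR_left_distrib)
  then show ?thesis by (rule latI)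
qed

lemma lat_scale: "x \<in> lat v \<Longrightarrow> of_int m *\<^sub>R x \<in> lat v"
proof -
  assume "x \<in> lat v"
  then obtain c :: "3 \<Rightarrow> int" where "x = (\<Sum>k\<in>UNIV. of_int (c k) *\<^sub>R v k)"
    unfolding lat_def by blast
  then have "of_int m *\<^sub>R x = (\<Sum>k\<in>UNIV. of_int (m * c k) *\<^sub>R v k)"
    by (simp add: scaleR_right.sum)
  then show ?thesis by (rule latI)
qed

lemma lat_uminus: "x \<in> lat v \<Longrightarrow> - x \<in> lat v"
  using lat_scale[of x v "- 1"] by simp

lemma lat_diff: "x \<in> lat v \<Longrightarrow> y \<in> lat v \<Longrightarrow> x - y \<in> lat v"
  using lat_add[of x v "- y"] lat_uminus[of y v] by simp

lemma lat_0: "0 \<in> lat v"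
  unfolding lat_def mem_Collect_eq by (intro exI[of _ "\<lambda>_. 0"]) simp

lemma gen_eq_comb: "v i = (\<Sum>k\<in>UNIV. (if k = i then 1 else 0) *\<^sub>R v k)" for v :: "3 \<Rightarrow> plane"
  by (cases i rule: cases3) (simp_all add: sum3 ne3)

lemma lat_gen: "v i \<in> lat v"
  by (rule latI[of _ "\<lambda>k. if k = i then 1 else 0"], cases i rule: cases3) (simp_all add: sum3 ne3)

section \<open>Classes of the lattice modulo 2, represented by the vectors of a superbase\<close>

definition even_part :: "plane set \<Rightarrow> plane set" where
  "even_part \<Lambda> = (\<lambda>x. 2 *\<^sub>R x) ` \<Lambda>"

lemma even_part_diff: "x \<in> even_part (lat v) \<Longrightarrow> y \<in> even_part (lat v) \<Longrightarrow> x - y \<in> even_part (lat v)"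
  unfolding even_part_def by (auto simp flip: scaleR_right_diff_distrib intro!: imageI lat_diff)

lemma even_part_comb: "(\<Sum>k\<in>UNIV. of_int (2 * c k) *\<^sub>R v k) \<in> even_part (lat v)"
proof -
  have "(\<Sum>k\<in>UNIV. of_int (2 * c k) *\<^sub>R v k) = 2 *\<^sub>R (\<Sum>k\<in>UNIV. of_int (c k) *\<^sub>R v k)"
    by (simp add: scaleR_right.sum)
  then show ?thesis unfolding even_part_def lat_def by blast
qed

text \<open>All relations are multiples of the defining relation \<open>v 0 + v 1 + v 2 = 0\<close>;
  this replaces the uniqueness of coordinates.\<close>

lemma comb_eq_0:
  fixes v :: "3 \<Rightarrow> plane"
  assumes "v 0 + v 1 + v 2 = 0" "det2 (v 1) (v 2) \<noteq> 0" "(\<Sum>k\<in>UNIV. e k *\<^sub>R v k) = 0"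
  shows "e i = e j"
proof -
  have e: "v 0 = - v 1 - v 2" by (rule superbase_v0[OF assms(1)])
  have "(e 1 - e 0) *\<^sub>R v 1 + (e 2 - e 0) *\<^sub>R v 2 = (\<Sum>k\<in>UNIV. e k *\<^sub>R v k)"
    by (simp add: sum3 e algebra_simps)
  then have z: "(e 1 - e 0) *\<^sub>R v 1 + (e 2 - e 0) *\<^sub>R v 2 = 0" using assms(3) by simp
  from arg_cong[OF z, of "\<lambda>x. det2 x (v 2)"] arg_cong[OF z, of "\<lambda>x. det2 (v 1) x"]
  have "e 1 = e 0" "e 2 = e 0" using assms(2) by (simp_all add: det2_bilinear)
  then show ?thesis by (cases i rule: cases3; cases j rule: cases3) simp_all
qed

lemma even_partE:
  assumes "x \<in> even_part (lat v)"
  obtains c :: "3 \<Rightarrow> int" where "x = (\<Sum>k\<in>UNIV. of_int (2 * c k) *\<^sub>R v k)"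
proof -
  from assms obtain c :: "3 \<Rightarrow> int" where "x = 2 *\<^sub>R (\<Sum>k\<in>UNIV. of_int (c k) *\<^sub>R v k)"
    unfolding even_part_def lat_def by blast
  then have "x = (\<Sum>k\<in>UNIV. of_int (2 * c k) *\<^sub>R v k)" by (simp add: scaleR_right.sum)
  then show ?thesis using that by blast
qed

lemma parity_contr: "real_of_int (2 * m) - 1 \<noteq> real_of_int (2 * n)"
proof
  assume "real_of_int (2 * m) - 1 = real_of_int (2 * n)"
  then have "real_of_int (2 * m - 1) = real_of_int (2 * n)" by simp
  then have "2 * m - 1 = 2 * n" by (simp only: of_int_eq_iff)
  then show False by presburger
qed

text \<open>Otherwise there is a relation with an odd coefficient at \<open>i\<close> and even ones
  elsewhere, against \<open>comb_eq_0\<close>.\<close>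

lemma gen_not_even:
  assumes "v 0 + v 1 + v 2 = 0" "det2 (v 1) (v 2) \<noteq> 0"
  shows "v i \<notin> even_part (lat v)"
proof
  assume "v i \<in> even_part (lat v)"
  then obtain c :: "3 \<Rightarrow> int" where "v i = (\<Sum>k\<in>UNIV. of_int (2 * c k) *\<^sub>R v k)" by (rule even_partE)
  then have z: "(\<Sum>k\<in>UNIV. (of_int (2 * c k) - (if k = i then 1 else 0)) *\<^sub>R v k) = 0"
    using gen_eq_comb[of v i] unfolding scaleR_left_diff_distrib sum_subtractf by simp
  have "i + 1 \<noteq> i" by simp
  with comb_eq_0[OF assms z, of i "i + 1"] parity_contr[of "c i" "c (i + 1)"] show False by simp
qed

lemma gen_diff_not_even:
  assumes "v 0 + v 1 + v 2 = 0" "det2 (v 1) (v 2) \<noteq> 0" "i \<noteq> j"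
  shows "v i - v j \<notin> even_part (lat v)"
proof
  assume "v i - v j \<in> even_part (lat v)"
  then obtain c :: "3 \<Rightarrow> int" where "v i - v j = (\<Sum>k\<in>UNIV. of_int (2 * c k) *\<^sub>R v k)" by (rule even_partE)
  then have z: "(\<Sum>k\<in>UNIV. (of_int (2 * c k) - (if k = i then 1 else 0) + (if k = j then 1 else 0)) *\<^sub>R v k) = 0"
    unfolding scaleR_left_diff_distrib scaleR_left_distrib sum_subtractf sum.distrib
    by (simp add: algebra_simps flip: gen_eq_comb[of v i] gen_eq_comb[of v j])
  obtain k where k: "k \<noteq> i" "k \<noteq> j"
    using ne3 by (cases i rule: cases3; cases j rule: cases3) metis+
  with comb_eq_0[OF assms(1,2) z, of i k] parity_contr[of "c i" "c k"] assms(3) show False by simp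
qed

text \<open>Two of the three coefficients have the same parity. Shifting all of them by one of these
  two leaves at most one odd coefficient, and its label is \<open>i\<close>.\<close>

lemma lat_mod_2:
  assumes "v 0 + v 1 + v 2 = 0" "x \<in> lat v"
  shows "x \<in> even_part (lat v) \<or> (\<exists>i. x - v i \<in> even_part (lat v))"
proof -
  from assms(2) obtain c :: "3 \<Rightarrow> int" where x: "x = (\<Sum>k\<in>UNIV. of_int (c k) *\<^sub>R v k)"
    unfolding lat_def by blast
  \<comment> \<open>The defining relation allows the same integer to be subtracted from all
    coefficients.\<close>
  have sh: "x = (\<Sum>k\<in>UNIV. of_int (c k - m) *\<^sub>R v k)" for m
    using assms(1) by (simp add: x sum3 algebra_simps flip: scaleR_right_distrib)
  have dv: "(\<Sum>k\<in>UNIV. of_int (d k) *\<^sub>R v k) \<in> even_part (lat v)" if "\<And>k. even (d k)" for d :: "3 \<Rightarrow> int"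
    using even_part_comb[of "\<lambda>k. d k div 2" v] that by simp
  show ?thesis
  proof (cases "even (c 0 - c 1) \<and> even (c 0 - c 2)")
    case True
    then have "even (c k - c 0)" for k by (cases k rule: cases3) auto
    then show ?thesis using dv[of "\<lambda>k. c k - c 0"] sh[of "c 0"] by simp
  next
    case False
    then have "\<exists>i m. \<forall>k. even (c k - m - (if k = i then 1 else 0))"
    proof (cases "even (c 1 - c 2)")
      case True
      then have "even (c k - c 1 - (if k = 0 then 1 else 0))" for k
        using False by (cases k rule: cases3) (auto simp: ne3)
      then show ?thesis by blast
    next
      case f: False
      show ?thesis
      proof (cases "even (c 0 - c 1)")
        case True
        then have "even (c k - c 0 - (if k = 2 then 1 else 0))" for k
          using False f by (cases k rule: cases3) (auto simp: ne3)
        then show ?thesis by blast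
      next
        case g: False
        then have "even (c k - c 0 - (if k = 1 then 1 else 0))" for k
          using False f by (cases k rule: cases3) (auto simp: ne3)
        then show ?thesis by blast
      qed
    qed
    then obtain i m where im: "\<And>k. even (c k - m - (if k = i then 1 else 0))" by blast
    have "x - v i = (\<Sum>k\<in>UNIV. of_int (c k - m - (if k = i then 1 else 0)) *\<^sub>R v k)"
      unfolding of_int_diff[of "_ - _"] scaleR_left_diff_distrib sum_subtractf
      using sh[of m] gen_eq_comb[of v i] by (simp add: if_distrib[of of_int] scaleR_left_diff_distrib sum_subtractf cong: if_cong)
    also have "\<dots> \<in> even_part (lat v)" by (rule dv) (rule im)
    finally show ?thesis by blast
  qed
qed

lemma odd_sq_ge_1: "1 \<le> (2 * real_of_int m + 1)\<^sup>2"
proof -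
  have "2 * m + 1 \<noteq> 0" by presburger
  then have "0 < (2 * m + 1)\<^sup>2" by simp
  then have "1 \<le> (2 * m + 1)\<^sup>2" by linarith
  then have "real_of_int 1 \<le> real_of_int ((2 * m + 1)\<^sup>2)" by (simp only: of_int_le_iff)
  then show ?thesis by simp
qed

text \<open>The vectors of an obtuse superbase are shortest representatives of the three nonzero classes
  of the lattice modulo 2. These classes depend on the lattice only, which gives uniqueness.\<close>
lemma class_min:
  assumes "obtuse v" "x - v i \<in> even_part (lat v)"
  shows "norm (v i) \<le> norm x"
    and "norm x = norm (v i) \<Longrightarrow> (\<And>k. 0 < opp v k) \<Longrightarrow> x = v i \<or> x = - v i"
proof -
  note s = obtuseD(1)[OF assms(1)]
  from assms(2) obtain d :: "3 \<Rightarrow> int" where d: "x - v i = (\<Sum>k\<in>UNIV. of_int (2 * d k) *\<^sub>R v k)" by (rule even_partE)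
  define c where "c k = real_of_int (2 * d k) + (if k = i then 1 else 0)" for k
  have x: "x = (\<Sum>k\<in>UNIV. c k *\<^sub>R v k)"
    using d gen_eq_comb[of v i] unfolding c_def scaleR_left_distrib sum.distrib by (simp add: algebra_simps)
  have ne: "i + 1 \<noteq> i" "i + 2 \<noteq> i" by simp_all
  define p q r where "p = (c i - c (i + 1))\<^sup>2" and "q = (c i - c (i + 2))\<^sup>2" and "r = (c (i + 1) - c (i + 2))\<^sup>2"
  have nx: "(norm x)\<^sup>2 = opp v (i + 2) * p + opp v (i + 1) * q + opp v i * r"
    unfolding x p_def q_def r_def by (rule norm_sq_comb[OF s])
  \<comment> \<open>Of the three coefficients only \<open>c i\<close> is odd, so both differences
    involving it are odd and have squares at least 1.\<close>
  have p1: "1 \<le> p"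
    using odd_sq_ge_1[of "d i - d (i + 1)"] ne unfolding p_def c_def by (simp add: algebra_simps)
  have q1: "1 \<le> q"
    using odd_sq_ge_1[of "d i - d (i + 2)"] ne unfolding q_def c_def by (simp add: algebra_simps)
  have r0: "0 \<le> r" unfolding r_def by simp
  note o = opp_nonneg[OF assms(1)]
  have a: "opp v (i + 2) \<le> opp v (i + 2) * p" "opp v (i + 1) \<le> opp v (i + 1) * q" "0 \<le> opp v i * r"
    using mult_left_mono[OF p1 o[of "i + 2"]] mult_left_mono[OF q1 o[of "i + 1"]] o[of i] r0 by simp_all
  have nv: "(norm (v i))\<^sup>2 = opp v (i + 1) + opp v (i + 2)" by (rule norm_sq_eq_opp[OF s])
  have "(norm (v i))\<^sup>2 \<le> (norm x)\<^sup>2" unfolding nx nv using a by linarith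
  then show "norm (v i) \<le> norm x" by (rule power2_le_imp_le) simp
  assume eq: "norm x = norm (v i)" and pos: "\<And>k. 0 < opp v k"
  \<comment> \<open>Equal lengths turn each of the three inequalities into an equality. With
    positive conorms, \<open>r = 0\<close> makes the other two coefficients equal, and shifting them
    away leaves a multiple of \<open>v i\<close>.\<close>
  have "opp v (i + 2) * p = opp v (i + 2)" "opp v i * r = 0"
    using a nx nv unfolding eq by linarith+
  with pos[of "i + 2"] pos[of i] have "p = 1" "r = 0" by simp_all
  then have e: "c (i + 1) = c (i + 2)" "c i - c (i + 1) = 1 \<or> c i - c (i + 1) = - 1"
    unfolding p_def r_def by (simp_all add: power2_eq_1_iff)
  have sh: "x = (\<Sum>k\<in>UNIV. (c k - c (i + 1)) *\<^sub>R v k)"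
    using s by (simp add: x sum3 algebra_simps flip: scaleR_right_distrib)
  have "x = (c i - c (i + 1)) *\<^sub>R v i"
    using e(1) by (subst sh, cases i rule: cases3) (simp_all add: sum3 arith3)
  then show "x = v i \<or> x = - v i" using e(2) by auto
qed

text \<open>\<open>\<sigma>\<close> sends a label to the label of the same class modulo 2. Since
  both vectors are shortest in this class, \<open>class_min\<close> used in both directions gives
  equal lengths. In a rectangular lattice a class can have several pairs of shortest vectors, hence
  the positivity condition for the last conclusion.\<close>

lemma obtuse_matching:
  assumes "obtuse v" "obtuse u" "lat u = lat v"
  obtains \<sigma> where "bij \<sigma>" "\<And>i. norm (u (\<sigma> i)) = norm (v i)"
    "(\<And>k. 0 < opp v k) \<Longrightarrow> \<forall>i. u (\<sigma> i) = v i \<or> u (\<sigma> i) = - v i"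
proof -
  have "\<exists>j. u j - v i \<in> even_part (lat v)" for i
  proof -
    have "v i \<in> lat u" using lat_gen assms(3) by blast
    with lat_mod_2[OF obtuseD(1)[OF assms(2)] this] gen_not_even[OF obtuseD(1,2)[OF assms(1)], of i] assms(3)
    obtain j where j: "v i - u j \<in> even_part (lat v)" by auto
    have "u j - v i = 0 - (v i - u j)" by simp
    moreover have "0 \<in> even_part (lat v)" unfolding even_part_def using lat_0 by force
    ultimately show ?thesis using even_part_diff[OF _ j] by metis
  qed
  then obtain \<sigma> where \<sigma>: "\<And>i. u (\<sigma> i) - v i \<in> even_part (lat v)" by metis
  have \<sigma>': "v i - u (\<sigma> i) \<in> even_part (lat u)" for i
  proof -
    have "0 \<in> even_part (lat v)" unfolding even_part_def using lat_0 by force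
    from even_part_diff[OF this \<sigma>[of i]] show ?thesis using assms(3) by simp
  qed
  have "inj \<sigma>"
  proof (rule injI, rule ccontr)
    fix i j assume "\<sigma> i = \<sigma> j" "i \<noteq> j"
    then have "v i - v j \<in> even_part (lat v)" using even_part_diff[OF \<sigma>[of j] \<sigma>[of i]] by simp
    then show False using gen_diff_not_even[OF obtuseD(1,2)[OF assms(1)] \<open>i \<noteq> j\<close>] by simp
  qed
  then have "bij \<sigma>" by (simp add: bij_def finite_UNIV_inj_surj)
  moreover have n: "norm (u (\<sigma> i)) = norm (v i)" for i
    using class_min(1)[OF assms(1) \<sigma>[of i]] class_min(1)[OF assms(2) \<sigma>'[of i]] by simp
  moreover have "\<forall>i. u (\<sigma> i) = v i \<or> u (\<sigma> i) = - v i" if "\<And>k. 0 < opp v k"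
    using class_min(2)[OF assms(1) \<sigma> n that] by blast
  ultimately show ?thesis by (rule that)
qed

text \<open>The signs of the individual vectors agree because they are the coefficients of a
  relation in \<open>v\<close>, obtained by summing \<open>u\<close> over all labels.\<close>

lemma obtuse_matching_sign:
  assumes "obtuse v" "obtuse u" "lat u = lat v" "\<And>k. 0 < opp v k"
  obtains \<sigma> e where "bij \<sigma>" "e = 1 \<or> e = (- 1 :: real)" "\<And>i. u (\<sigma> i) = e *\<^sub>R v i"
proof -
  obtain \<sigma> where s: "bij \<sigma>" "\<And>i. norm (u (\<sigma> i)) = norm (v i)"
    "(\<And>k. 0 < opp v k) \<Longrightarrow> \<forall>i. u (\<sigma> i) = v i \<or> u (\<sigma> i) = - v i"
    by (rule obtuse_matching[OF assms(1-3)]) blast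
  have "\<forall>i. \<exists>e. (e = 1 \<or> e = (- 1 :: real)) \<and> u (\<sigma> i) = e *\<^sub>R v i"
    using s(3)[OF assms(4)] by (metis scaleR_one scaleR_minus1_left)
  then obtain e where e: "\<And>i. e i = 1 \<or> e i = (- 1 :: real)" "\<And>i. u (\<sigma> i) = e i *\<^sub>R v i"
    by metis
  have "(\<Sum>k\<in>UNIV. u (\<sigma> k)) = (\<Sum>k\<in>UNIV. u k)" by (rule sum.reindex_bij_betw[OF s(1)])
  also have "\<dots> = 0" using obtuseD(1)[OF assms(2)] by (simp add: sum3)
  finally have z: "(\<Sum>k\<in>UNIV. e k *\<^sub>R v k) = 0" using e(2) by simp
  have "e i = e 0" for i by (rule comb_eq_0[OF obtuseD(1,2)[OF assms(1)] z])
  then show ?thesis using that[OF s(1), of "e 0"] e by metis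
qed

section \<open>Sorting of labels, and existence by Selling's reduction\<close>

lemma ex_bij3:
  fixes a b c :: 3
  assumes "a \<noteq> b" "a \<noteq> c" "b \<noteq> c"
  obtains \<pi> :: "3 \<Rightarrow> 3" where "bij \<pi>" "\<pi> 0 = a" "\<pi> 1 = b" "\<pi> 2 = c"
proof -
  define \<pi> :: "3 \<Rightarrow> 3" where "\<pi> x = (if x = 0 then a else if x = 1 then b else c)" for x
  have p: "\<pi> 0 = a" "\<pi> 1 = b" "\<pi> 2 = c" by (simp_all add: \<pi>_def)
  have "x = y" if "\<pi> x = \<pi> y" for x y
    using that p assms by (cases x rule: cases3; cases y rule: cases3) auto
  then have "bij \<pi>" by (simp add: bij_def finite_UNIV_inj_surj injI)
  then show ?thesis using that p by blast
qed

text \<open>The order 1, 2, 0 of the labels is the order of lengths in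
  \<open>lattice_sign\<close>.\<close>

lemma ex_sorting:
  fixes f :: "3 \<Rightarrow> real"
  obtains \<pi> :: "3 \<Rightarrow> 3" where "bij \<pi>" "f (\<pi> 1) \<le> f (\<pi> 2)" "f (\<pi> 2) \<le> f (\<pi> 0)"
proof -
  note result = that
  have *: thesis if o: "f b \<le> f c" "f c \<le> f a" "a \<noteq> b" "a \<noteq> c" "b \<noteq> c" for a b c
  proof -
    obtain \<pi> :: "3 \<Rightarrow> 3" where "bij \<pi>" "\<pi> 0 = a" "\<pi> 1 = b" "\<pi> 2 = c" by (rule ex_bij3[OF o(3-5)])
    then show ?thesis using result[of \<pi>] o by simp
  qed
  consider "f 1 \<le> f 2" "f 2 \<le> f 0" | "f 2 \<le> f 1" "f 1 \<le> f 0" | "f 0 \<le> f 2" "f 2 \<le> f 1"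
    | "f 2 \<le> f 0" "f 0 \<le> f 1" | "f 0 \<le> f 1" "f 1 \<le> f 2" | "f 1 \<le> f 0" "f 0 \<le> f 2"
    by linarith
  then show ?thesis by cases (erule (1) *; simp add: ne3)+
qed

text \<open>By Cramer's rule the two coordinates are determinants of \<open>x\<close> with a
  generator, divided by \<open>det2 (v 1) (v 2)\<close>; \<open>abs_det2_le\<close> confines them to
  a finite box.\<close>

lemma finite_lat_ball:
  assumes "v 0 + v 1 + v 2 = 0" "det2 (v 1) (v 2) \<noteq> 0"
  shows "finite {x \<in> lat v. norm x \<le> R}"
proof -
  define D where "D = \<bar>det2 (v 1) (v 2)\<bar>"
  have D: "0 < D" using assms(2) by (simp add: D_def)
  define K where "K = \<lceil>R * (norm (v 1) + norm (v 2)) / D\<rceil>"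
  have bd: "c \<in> {- K..K}" if "\<bar>of_int c\<bar> * D \<le> R * norm (v i)" "i = 1 \<or> i = 2" "0 \<le> R" for c i
  proof -
    have "\<bar>of_int c\<bar> * D \<le> R * (norm (v 1) + norm (v 2))"
      by (rule order_trans[OF that(1)], rule mult_left_mono) (use that(2,3) in auto)
    then have "\<bar>of_int c\<bar> \<le> R * (norm (v 1) + norm (v 2)) / D"
      using D by (simp add: pos_le_divide_eq)
    also have "\<dots> \<le> of_int K" unfolding K_def by simp
    finally have "of_int \<bar>c\<bar> \<le> (of_int K :: real)" by simp
    then have "\<bar>c\<bar> \<le> K" by (simp only: of_int_le_iff)
    then show ?thesis by auto
  qed
  have "{x \<in> lat v. norm x \<le> R} \<subseteq> (\<lambda>(a, b). of_int a *\<^sub>R v 1 + of_int b *\<^sub>R v 2) ` ({- K..K} \<times> {- K..K})"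
  proof
    fix x assume "x \<in> {x \<in> lat v. norm x \<le> R}"
    then obtain a b where x: "x = of_int a *\<^sub>R v 1 + of_int b *\<^sub>R v 2" and R: "norm x \<le> R"
      using lat_eq[OF assms(1)] by auto
    have R0: "0 \<le> R" using R norm_ge_zero order_trans by blast
    have "\<bar>of_int a\<bar> * D = \<bar>det2 x (v 2)\<bar>" by (simp add: x det2_bilinear D_def abs_mult)
    also have "\<dots> \<le> R * norm (v 2)"
      by (rule order_trans[OF abs_det2_le]) (simp add: R mult_right_mono)
    finally have a: "a \<in> {- K..K}" using bd[of a 2] R0 by blast
    have "\<bar>of_int b\<bar> * D = \<bar>det2 x (v 1)\<bar>"
      by (simp add: x det2_bilinear D_def abs_mult det2_swap[of "v 1" "v 2"])
    also have "\<dots> \<le> R * norm (v 1)"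
      by (rule order_trans[OF abs_det2_le]) (simp add: R mult_right_mono)
    finally have "b \<in> {- K..K}" using bd[of b 1] R0 by blast
    with a show "x \<in> (\<lambda>(a, b). of_int a *\<^sub>R v 1 + of_int b *\<^sub>R v 2) ` ({- K..K} \<times> {- K..K})"
      using x by auto
  qed
  then show ?thesis by (rule finite_subset) simp
qed

lemma lat_mono:
  assumes "\<And>k. u k \<in> lat v"
  shows "lat u \<subseteq> lat v"
proof
  fix x assume "x \<in> lat u"
  then obtain c :: "3 \<Rightarrow> int" where "x = (\<Sum>k\<in>UNIV. of_int (c k) *\<^sub>R u k)" unfolding lat_def by blast
  then show "x \<in> lat v" using assms by (simp add: sum3 lat_add lat_scale)
qed

text \<open>Selling's reduction step: replacing \<open>- v 1 - v 2\<close> by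
  \<open>v 1 - v 2\<close> lowers the sum of squared lengths by four times the positive product
  \<open>v 1 \<bullet> v 2\<close>.\<close>

lemma superbase_flip:
  fixes v :: "3 \<Rightarrow> plane"
  assumes "v 0 + v 1 + v 2 = (0 :: plane)" "det2 (v 1) (v 2) \<noteq> 0" "v 1 \<bullet> v 2 > 0"
  obtains u where "u 0 + u 1 + u 2 = 0" "det2 (u 1) (u 2) \<noteq> 0" "lat u = lat v"
    "(\<Sum>k\<in>UNIV. (norm (u k))\<^sup>2) < (\<Sum>k\<in>UNIV. (norm (v k))\<^sup>2)"
proof
  define u where "u k = (if k = 0 then v 1 - v 2 else if k = 1 then - v 1 else v 2)" for k :: 3
  have u: "u 0 = v 1 - v 2" "u 1 = - v 1" "u 2 = v 2" by (simp_all add: u_def)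
  have e: "v 0 = - v 1 - v 2" by (rule superbase_v0[OF assms(1)])
  show "u 0 + u 1 + u 2 = 0" "det2 (u 1) (u 2) \<noteq> 0"
    using assms by (simp_all add: u det2_bilinear)
  have "u k \<in> lat v" for k
    by (cases k rule: cases3) (simp_all add: u lat_gen lat_uminus lat_diff)
  moreover have "v k \<in> lat u" for k
  proof -
    have "v 0 = u 1 - u 2" "v 1 = - u 1" "v 2 = u 2" by (simp_all add: u e)
    then show ?thesis by (cases k rule: cases3) (metis lat_gen lat_uminus lat_diff)+
  qed
  ultimately show "lat u = lat v" by (intro equalityI lat_mono)
  show "(\<Sum>k\<in>UNIV. (norm (u k))\<^sup>2) < (\<Sum>k\<in>UNIV. (norm (v k))\<^sup>2)"
    using assms(3) by (simp add: sum3 u e power2_norm_eq_inner inner_diff inner_commute)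
qed

text \<open>A superbase with the least sum of squared lengths is obtuse, as a positive product,
  moved to the labels 1 and 2, would admit a reduction step.\<close>

lemma obtuse_superbase_exists:
  assumes "\<Lambda> \<in> lattices"
  obtains v where "obtuse v" "lat v = \<Lambda>"
proof -
  from assms obtain S where S: "\<Lambda> = int_span S" "independent S" "span S = UNIV"
    unfolding lattices_def by blast
  have "card S = 2"
    using dim_eq_card[of S UNIV] S by (simp add: dim_UNIV)
  then obtain a b where ab: "S = {a, b}" "a \<noteq> b" by (meson card_2_iff)
  define N where "N v = (\<Sum>k\<in>UNIV. (norm (v k))\<^sup>2)" for v :: "3 \<Rightarrow> plane"
  define sb where "sb v \<longleftrightarrow> v 0 + v 1 + v 2 = 0 \<and> det2 (v 1) (v 2) \<noteq> 0 \<and> lat v = \<Lambda>" for v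
  define w where "w k = (if k = 0 then - a - b else if k = 1 then a else b)" for k :: 3
  have "sb w"
    using superbase_iff[of w \<Lambda>] ab S unfolding sb_def superbase_def by (simp add: w_def)
  define F where "F = {x \<in> \<Lambda>. norm x \<le> sqrt (N w)}"
  have "finite F" using finite_lat_ball[of w "sqrt (N w)"] \<open>sb w\<close> unfolding F_def sb_def by metis
  \<comment> \<open>The minimum exists because only finitely many superbases do not exceed
    \<open>w\<close>: their vectors lie in the finite set \<open>F\<close>.\<close>
  define Q where "Q = {v. sb v \<and> N v \<le> N w}"
  have "Q \<subseteq> (\<Pi>\<^sub>E k\<in>UNIV. F)"
  proof
    fix v assume v: "v \<in> Q"
    have "v k \<in> F" for k
    proof -
      have "(norm (v k))\<^sup>2 \<le> N v" unfolding N_def by (rule member_le_sum) auto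
      also have "\<dots> \<le> N w" using v by (simp add: Q_def)
      finally have "norm (v k) \<le> sqrt (N w)" by (rule real_le_rsqrt)
      moreover have "v k \<in> \<Lambda>" using v lat_gen[of v k] by (simp add: Q_def sb_def)
      ultimately show ?thesis by (simp add: F_def)
    qed
    then show "v \<in> (\<Pi>\<^sub>E k\<in>UNIV. F)" by auto
  qed
  then have "finite Q" by (rule finite_subset) (simp add: finite_PiE \<open>finite F\<close>)
  moreover have "w \<in> Q" using \<open>sb w\<close> by (simp add: Q_def)
  ultimately obtain v where v: "v \<in> Q" "\<And>u. u \<in> Q \<Longrightarrow> N v \<le> N u"
    using arg_min_least[of Q _ N] arg_min_if_finite(1)[of Q N] by (metis empty_iff)
  then have sv: "sb v" by (simp add: Q_def)
  have "v i \<bullet> v j \<le> 0" if ij: "i \<noteq> j" for i j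
  proof (rule ccontr)
    assume "\<not> v i \<bullet> v j \<le> 0"
    obtain k where k: "k \<noteq> i" "k \<noteq> j"
      using ne3 by (cases i rule: cases3; cases j rule: cases3) metis+
    obtain \<pi> :: "3 \<Rightarrow> 3" where p: "bij \<pi>" "\<pi> 1 = i" "\<pi> 2 = j" using ex_bij3[of k i j] k ij by metis
    have v': "(v \<circ> \<pi>) 0 + (v \<circ> \<pi>) 1 + (v \<circ> \<pi>) 2 = 0" "det2 ((v \<circ> \<pi>) 1) ((v \<circ> \<pi>) 2) \<noteq> 0" "(v \<circ> \<pi>) 1 \<bullet> (v \<circ> \<pi>) 2 > 0"
      using superbase_comp_bij[OF p(1), of v] sv \<open>\<not> v i \<bullet> v j \<le> 0\<close> p by (simp_all add: sb_def)
    obtain u where u: "u 0 + u 1 + u 2 = 0" "det2 (u 1) (u 2) \<noteq> 0" "lat u = lat (v \<circ> \<pi>)" "N u < N (v \<circ> \<pi>)"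
      using superbase_flip[OF v'] unfolding N_def by blast
    have "N (v \<circ> \<pi>) = N v"
      unfolding N_def comp_def by (rule sum.reindex_bij_betw[OF p(1)])
    moreover have "sb u" using u sv lat_comp_bij[OF p(1)] by (simp add: sb_def)
    ultimately have "u \<in> Q" "N u < N v" using u v(1) by (simp_all add: Q_def)
    then show False using v(2) by fastforce
  qed
  then have "obtuse v" using sv by (simp add: obtuse_def sb_def)
  then show ?thesis using that sv by (simp add: sb_def)
qed

section \<open>Closeness of the invariants\<close>

text \<open>Sorting written with minima and maxima, so that symmetry and the comparison of two
  triples are finite case distinctions.\<close>

definition sorted3 :: "(3 \<Rightarrow> real) \<Rightarrow> real^3" where
  "sorted3 f = vector [min (f 0) (min (f 1) (f 2)), max (min (f 0) (f 1)) (min (max (f 0) (f 1)) (f 2)),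
    max (f 0) (max (f 1) (f 2))]"

lemma sorted3_comps:
  "sorted3 f $ 1 = min (f 0) (min (f 1) (f 2))"
  "sorted3 f $ 2 = max (min (f 0) (f 1)) (min (max (f 0) (f 1)) (f 2))"
  "sorted3 f $ 3 = max (f 0) (max (f 1) (f 2))"
  by (simp_all add: sorted3_def vector_3)

lemma sorted3_perm:
  fixes \<pi> :: "3 \<Rightarrow> 3"
  assumes "bij \<pi>"
  shows "sorted3 (\<lambda>k. f (\<pi> k)) = sorted3 f"
  using assms by (rule bij3_cases) (auto simp: sorted3_def vec_eq_iff forall_3 vector_3 min_def max_def)

lemma sorted3_sorted: "sorted3 f $ 1 \<le> sorted3 f $ 2" "sorted3 f $ 2 \<le> sorted3 f $ 3"
  by (auto simp: sorted3_comps min_def max_def)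

lemma sorted3_nonneg: "(\<And>k. 0 \<le> f k) \<Longrightarrow> 0 \<le> sorted3 f $ k"
  using exhaust_3[of k] by (auto simp: sorted3_comps min_def max_def)

lemma sorted3_sqrt: "sorted3 (\<lambda>k. sqrt (f k)) $ j = sqrt (sorted3 f $ j)"
  using exhaust_3[of j] by (auto simp: sorted3_comps min_def max_def)

lemma sorted3_scale: "0 \<le> c \<Longrightarrow> sorted3 (\<lambda>k. c * f k) = c *\<^sub>R sorted3 f"
  by (simp add: sorted3_comps vec_eq_iff forall_3 max_mult_distrib_left min_mult_distrib_left)

lemma sorted3_close:
  assumes "\<And>k. \<bar>f k - g k\<bar> \<le> e"
  shows "\<bar>sorted3 f $ j - sorted3 g $ j\<bar> \<le> e"
proof -
  have "\<bar>f 0 - g 0\<bar> \<le> e" "\<bar>f 1 - g 1\<bar> \<le> e" "\<bar>f 2 - g 2\<bar> \<le> e" using assms by blast+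
  then show ?thesis using exhaust_3[of j]
    by (elim disjE) (simp_all only: sorted3_comps, (auto simp: min_def max_def abs_le_iff)+)
qed

lemma sorted3_sum: "sorted3 f $ 1 + sorted3 f $ 2 + sorted3 f $ 3 = f 0 + f 1 + f 2"
  by (auto simp: sorted3_comps min_def max_def)

text \<open>The order 0, 2, 1 is that of \<open>RI\<close>: its components
  \<open>r\<^sub>1\<^sub>2\<close>, \<open>r\<^sub>0\<^sub>1\<close>,
  \<open>r\<^sub>0\<^sub>2\<close> omit the labels 0, 2 and 1.\<close>

lemma sorted3_id: "f 0 \<le> f 2 \<Longrightarrow> f 2 \<le> f 1 \<Longrightarrow> sorted3 f = vector [f 0, f 2, f 1]"
  by (auto simp: sorted3_def min_def max_def)

section \<open>The root invariant computed from any labelling\<close>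

lemma opp_eq_if_norm_eq:
  fixes \<sigma> :: "3 \<Rightarrow> 3"
  assumes "v 0 + v 1 + v 2 = 0" "u 0 + u 1 + u 2 = 0" "bij \<sigma>" "\<And>i. norm (u (\<sigma> i)) = norm (v i)"
  shows "opp u (\<sigma> k) = opp v k"
proof -
  have "(\<Sum>i\<in>UNIV. (norm (u i))\<^sup>2) = (\<Sum>i\<in>UNIV. (norm (u (\<sigma> i)))\<^sup>2)"
    by (rule sum.reindex_bij_betw[OF assms(3), symmetric])
  then show ?thesis
    using assms(4) by (simp add: opp_eq_norms[OF assms(1)] opp_eq_norms[OF assms(2)])
qed

lemma opp_comp_bij:
  fixes \<sigma> :: "3 \<Rightarrow> 3"
  assumes "obtuse v" "bij \<sigma>"
  shows "opp (v \<circ> \<sigma>) k = opp v (\<sigma> k)"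
  by (rule opp_eq_if_norm_eq[OF obtuseD(1)[OF obtuse_comp_bij[OF assms(2,1)]] obtuseD(1)[OF assms(1)] assms(2), symmetric]) simp

text \<open>The description is unique because matched superbases have equal lengths and thus equal
  conorms. A labelling that satisfies it is found by sorting the lengths, which sorts the conorms in
  reverse.\<close>

lemma RI_eq:
  assumes "obtuse v"
  shows "RI (lat v) = sorted3 (\<lambda>k. sqrt (opp v k))"
proof -
  have rp: "root_product u 1 2 = sqrt (opp u 0)" "root_product u 0 1 = sqrt (opp u 2)"
    "root_product u 0 2 = sqrt (opp u 1)" for u
    by (simp_all add: root_product_def conorm_def opp_simps inner_commute)
  have uniq: "sorted3 (\<lambda>k. sqrt (opp u k)) = sorted3 (\<lambda>k. sqrt (opp v k))" if u: "obtuse u" "lat u = lat v" for u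
  proof -
    obtain \<sigma> where s: "bij \<sigma>" "\<And>i. norm (u (\<sigma> i)) = norm (v i)"
      using obtuse_matching[OF assms u] by metis
    have "opp u (\<sigma> k) = opp v k" for k
      by (rule opp_eq_if_norm_eq[OF obtuseD(1)[OF assms] obtuseD(1)[OF u(1)] s])
    then show ?thesis using sorted3_perm[OF s(1), of "\<lambda>k. sqrt (opp u k)"] by simp
  qed
  have id: "vector [sqrt (opp u 0), sqrt (opp u 2), sqrt (opp u 1)] = sorted3 (\<lambda>k. sqrt (opp u k))"
    if "opp u 0 \<le> opp u 2" "opp u 2 \<le> opp u 1" for u
    using sorted3_id[of "\<lambda>k. sqrt (opp u k)"] that by simp
  obtain \<pi> :: "3 \<Rightarrow> 3" where p: "bij \<pi>" "norm (v (\<pi> 1)) \<le> norm (v (\<pi> 2))" "norm (v (\<pi> 2)) \<le> norm (v (\<pi> 0))"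
    by (rule ex_sorting)
  define w where "w = v \<circ> \<pi>"
  have w: "obtuse w" "lat w = lat v" unfolding w_def using obtuse_comp_bij[OF p(1) assms] lat_comp_bij[OF p(1)] by auto
  have "opp w 0 \<le> opp w 2" "opp w 2 \<le> opp w 1"
    using p(2,3) by (simp_all add: opp_eq_norms[OF obtuseD(1)[OF w(1)]]) (simp_all add: w_def)
  then show ?thesis
    unfolding RI_def
    by (intro the_equality exI[of _ w])
      (use w in \<open>auto simp: labelled_iff rp id uniq\<close>)
qed

lemma RI_sq:
  assumes "obtuse v"
  shows "(RI (lat v) $ k)\<^sup>2 = sorted3 (opp v) $ k"
  by (simp add: RI_eq[OF assms] sorted3_sqrt sorted3_nonneg opp_nonneg[OF assms])

lemma sum_squares_le_square_sum:
  fixes x y z :: real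
  assumes "0 \<le> x" "0 \<le> y" "0 \<le> z"
  shows "x\<^sup>2 + y\<^sup>2 + z\<^sup>2 \<le> (x + y + z)\<^sup>2"
  using mult_nonneg_nonneg[OF assms(1,2)] mult_nonneg_nonneg[OF assms(1,3)] mult_nonneg_nonneg[OF assms(2,3)]
  by (simp add: power2_eq_square algebra_simps)

text \<open>The squares of the three entries add up to all conorms, two of which make up
  \<open>(norm (v i))\<^sup>2\<close>. The quadratic bound feeds the sharp estimate for
  \<open>PI\<close>, the linear ones serve as bounds for its denominator.\<close>

lemma RI_props:
  assumes "obtuse v"
  shows "0 \<le> RI (lat v) $ k" "RI (lat v) $ 1 \<le> RI (lat v) $ 2" "RI (lat v) $ 2 \<le> RI (lat v) $ 3"
    "(norm (v i))\<^sup>2 \<le> (RI (lat v) $ 1)\<^sup>2 + (RI (lat v) $ 2)\<^sup>2 + (RI (lat v) $ 3)\<^sup>2"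
    "norm (v i) \<le> RI (lat v) $ 1 + RI (lat v) $ 2 + RI (lat v) $ 3"
    "0 < RI (lat v) $ 1 + RI (lat v) $ 2 + RI (lat v) $ 3"
proof -
  let ?R = "RI (lat v)"
  show n: "0 \<le> ?R $ k" for k by (simp add: RI_eq[OF assms] sorted3_nonneg opp_nonneg[OF assms])
  show "?R $ 1 \<le> ?R $ 2" "?R $ 2 \<le> ?R $ 3" by (simp_all add: RI_eq[OF assms] sorted3_sorted)
  show sq: "(norm (v i))\<^sup>2 \<le> (?R $ 1)\<^sup>2 + (?R $ 2)\<^sup>2 + (?R $ 3)\<^sup>2" for i
    unfolding RI_sq[OF assms] sorted3_sum norm_sq_eq_opp[OF obtuseD(1)[OF assms]]
    by (cases i rule: cases3) (simp_all add: arith3 opp_nonneg[OF assms])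
  have "(?R $ 1)\<^sup>2 + (?R $ 2)\<^sup>2 + (?R $ 3)\<^sup>2 \<le> (?R $ 1 + ?R $ 2 + ?R $ 3)\<^sup>2"
    by (rule sum_squares_le_square_sum) (rule n)+
  then have "(norm (v i))\<^sup>2 \<le> (?R $ 1 + ?R $ 2 + ?R $ 3)\<^sup>2" for i using sq[of i] by linarith
  then show le: "norm (v i) \<le> ?R $ 1 + ?R $ 2 + ?R $ 3" for i
    by (rule power2_le_imp_le) (simp add: n)
  have "v 1 \<noteq> 0" using obtuseD(2)[OF assms] by auto
  then show "0 < ?R $ 1 + ?R $ 2 + ?R $ 3" using le[of 1] by (meson less_le_trans zero_less_norm_iff)
qed

section \<open>From close vectors to close root invariants\<close>

lemma inner_close:
  fixes a b c d :: "'a::real_inner"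
  assumes "norm (a - c) \<le> \<delta>" "norm (b - d) \<le> \<delta>" "norm b \<le> L" "norm c \<le> L" "0 \<le> L"
  shows "\<bar>a \<bullet> b - c \<bullet> d\<bar> \<le> 2 * L * \<delta>"
proof -
  have "a \<bullet> b - c \<bullet> d = (a - c) \<bullet> b + c \<bullet> (b - d)" by (simp add: inner_diff)
  moreover have "\<bar>(a - c) \<bullet> b\<bar> \<le> \<delta> * L"
    by (rule order_trans[OF Cauchy_Schwarz_ineq2]) (intro mult_mono assms; use assms norm_ge_zero order_trans in blast)
  moreover have "\<bar>c \<bullet> (b - d)\<bar> \<le> L * \<delta>"
    by (rule order_trans[OF Cauchy_Schwarz_ineq2]) (intro mult_mono assms; use assms norm_ge_zero order_trans in blast)
  ultimately show ?thesis by (simp add: algebra_simps)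
qed

lemma opp_close:
  assumes "\<And>i. norm (u i - v i) \<le> \<delta>" "\<And>i. norm (v i) \<le> L" "\<And>i. norm (u i) \<le> L"
  shows "\<bar>opp u k - opp v k\<bar> \<le> 2 * L * \<delta>"
proof -
  have "0 \<le> L" using assms(2)[of 0] norm_ge_zero order_trans by blast
  then have "\<bar>u (k + 1) \<bullet> u (k + 2) - v (k + 1) \<bullet> v (k + 2)\<bar> \<le> 2 * L * \<delta>"
    by (intro inner_close assms)
  then show ?thesis by (simp add: opp_def abs_minus_commute)
qed

lemma RI_sq_close:
  assumes "obtuse v" "obtuse u" "\<And>i. norm (u i - v i) \<le> \<delta>" "\<And>i. norm (v i) \<le> L" "\<And>i. norm (u i) \<le> L"
  shows "\<bar>(RI (lat v) $ k)\<^sup>2 - (RI (lat u) $ k)\<^sup>2\<bar> \<le> 2 * L * \<delta>"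
  unfolding RI_sq[OF assms(1)] RI_sq[OF assms(2)]
  by (rule sorted3_close) (use opp_close[OF assms(3-5)] in \<open>simp add: abs_minus_commute\<close>)

lemma diff_le_sqrt:
  fixes a b :: real
  assumes "0 \<le> a" "0 \<le> b" "\<bar>a\<^sup>2 - b\<^sup>2\<bar> \<le> E"
  shows "\<bar>a - b\<bar> \<le> sqrt E"
proof (rule real_le_rsqrt)
  have "\<bar>a - b\<bar>\<^sup>2 \<le> \<bar>a - b\<bar> * (a + b)"
    unfolding power2_eq_square by (rule mult_left_mono) (use assms in auto)
  also have "\<dots> = \<bar>a\<^sup>2 - b\<^sup>2\<bar>"
    using assms by (simp add: power2_eq_square square_diff_square_factored abs_mult mult.commute)
  finally show "\<bar>a - b\<bar>\<^sup>2 \<le> E" using assms(3) by linarith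
qed

text \<open>For infinite \<open>q\<close> the exponent \<open>1 / q\<close> is 0, so the factor is
  1, in accordance with the maximum norm.\<close>

lemma minkowski_norm_le:
  fixes x :: "real^'n"
  assumes "1 \<le> q" "\<And>i. \<bar>x $ i\<bar> \<le> M"
  shows "minkowski_norm q x \<le> real CARD('n) powr real_of_ereal (1 / q) * M"
proof (cases "q = \<infinity>")
  case True
  then show ?thesis using assms(2) by (simp add: minkowski_norm_def)
next
  case False
  with assms(1) obtain p where p: "q = ereal p" "1 \<le> p" by (cases q) auto
  have "0 \<le> M" using assms(2) abs_ge_zero order_trans by blast
  have "(\<Sum>i\<in>UNIV. \<bar>x $ i\<bar> powr p) \<le> (\<Sum>i\<in>(UNIV :: 'n set). M powr p)"
    by (intro sum_mono powr_mono2) (use assms(2) p in auto)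
  then have "(\<Sum>i\<in>UNIV. \<bar>x $ i\<bar> powr p) powr (1 / p) \<le> (real CARD('n) * M powr p) powr (1 / p)"
    using p by (intro powr_mono2) (auto intro: sum_nonneg)
  also have "\<dots> = real CARD('n) powr (1 / p) * M"
    using p \<open>0 \<le> M\<close> by (simp add: powr_mult powr_powr)
  finally show ?thesis using p by (simp add: minkowski_norm_def divide_ereal_def inverse_eq_divide)
qed

lemma minkowski_norm_nonneg: "0 \<le> minkowski_norm q x"
proof -
  have "0 \<le> Max (range (\<lambda>i. \<bar>x $ i\<bar>))"
    by (subst Max_ge_iff) auto
  then show ?thesis by (simp add: minkowski_norm_def)
qed

text \<open>A factor free of \<open>q\<close>, for the places where only convergence
  matters.\<close>

lemma minkowski_norm_le_coarse:
  fixes x :: "real^'n"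
  assumes "1 \<le> q" "\<And>i. \<bar>x $ i\<bar> \<le> M"
  shows "minkowski_norm q x \<le> real CARD('n) * M"
proof -
  have "0 \<le> M" using assms(2) abs_ge_zero order_trans by blast
  have "real_of_ereal (1 / q) \<le> 1"
    using assms(1) by (cases q) (auto simp: divide_ereal_def one_ereal_def inverse_le_1_iff)
  then have "real CARD('n) powr real_of_ereal (1 / q) \<le> real CARD('n) powr 1"
    by (intro powr_mono) (simp_all add: Suc_leI)
  then have "real CARD('n) powr real_of_ereal (1 / q) * M \<le> real CARD('n) * M"
    using \<open>0 \<le> M\<close> by (intro mult_right_mono) simp_all
  then show ?thesis using minkowski_norm_le[OF assms] by linarith
qed

section \<open>Estimates for the projected invariant\<close>

lemma PI_comps:
  "PI \<Lambda> $ 1 = (RI \<Lambda> $ 3 - RI \<Lambda> $ 2) / (RI \<Lambda> $ 1 + RI \<Lambda> $ 2 + RI \<Lambda> $ 3)"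
  "PI \<Lambda> $ 2 = 3 * (RI \<Lambda> $ 1 / (RI \<Lambda> $ 1 + RI \<Lambda> $ 2 + RI \<Lambda> $ 3))"
  by (simp_all add: PI_def Let_def vector_2 diff_divide_distrib)

lemma gap_diff:
  fixes r r' \<sigma> \<sigma>' :: real
  assumes "\<sigma> \<noteq> 0" "\<sigma>' \<noteq> 0"
  shows "\<sigma> * (r / \<sigma> - r' / \<sigma>') = (r - r') - (r' / \<sigma>') * (\<sigma> - \<sigma>')"
  using assms by (simp add: field_simps)

text \<open>Multiplied by \<sigma>, the difference is a combination of the three root differences
  with coefficients \<open>1 - g'\<close>, \<open>- (1 + g')\<close> and \<open>- g'\<close>. As
  \<open>g'\<close> lies between 0 and 1, their total weight \<open>2 + g'\<close> is at most
  3.\<close>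

lemma PI1_close:
  fixes r1 r2 r3 r1' r2' r3' :: real
  assumes "0 \<le> r1'" "0 \<le> r2'" "r2' \<le> r3'" "0 < r1 + r2 + r3" "0 < r1' + r2' + r3'"
    and d: "\<bar>r1 - r1'\<bar> \<le> e" "\<bar>r2 - r2'\<bar> \<le> e" "\<bar>r3 - r3'\<bar> \<le> e"
  shows "\<bar>(r3 - r2) / (r1 + r2 + r3) - (r3' - r2') / (r1' + r2' + r3')\<bar> \<le> 3 * e / (r1 + r2 + r3)"
proof -
  define \<sigma> \<sigma>' g g' where "\<sigma> = r1 + r2 + r3" and "\<sigma>' = r1' + r2' + r3'"
    and "g = (r3 - r2) / \<sigma>" and "g' = (r3' - r2') / \<sigma>'"
  have p: "0 < \<sigma>" "0 < \<sigma>'" using assms by (simp_all add: \<sigma>_def \<sigma>'_def)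
  have g: "0 \<le> g'" "g' \<le> 1" using assms p by (simp_all add: g'_def \<sigma>'_def)
  have "\<sigma> * (g - g') = (r3 - r2 - (r3' - r2')) - g' * (\<sigma> - \<sigma>')"
    unfolding g_def g'_def by (rule gap_diff) (use p in auto)
  also have "\<dots> = (1 - g') * (r3 - r3') - (1 + g') * (r2 - r2') - g' * (r1 - r1')"
    by (simp add: \<sigma>_def \<sigma>'_def algebra_simps)
  also have "\<bar>\<dots>\<bar> \<le> (1 - g') * e + (1 + g') * e + g' * e"
  proof -
    have "\<bar>(1 - g') * (r3 - r3')\<bar> \<le> (1 - g') * e" "\<bar>(1 + g') * (r2 - r2')\<bar> \<le> (1 + g') * e"
      "\<bar>g' * (r1 - r1')\<bar> \<le> g' * e"
      unfolding abs_mult using g d by (simp_all add: mult_left_mono)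
    then show ?thesis by linarith
  qed
  also have "\<dots> = 2 * e + g' * e" by (simp add: algebra_simps)
  also have "\<dots> \<le> 3 * e" using g mult_right_mono[of g' 1 e] d(1) by linarith
  finally have "\<sigma> * \<bar>g - g'\<bar> \<le> 3 * e" using p by (simp add: abs_mult)
  then show ?thesis using p unfolding g_def g'_def \<sigma>_def \<sigma>'_def by (simp add: pos_le_divide_eq mult.commute)
qed

lemma ratio_le_third:
  fixes r1 r2 r3 :: real
  assumes "0 \<le> r1" "r1 \<le> r2" "r2 \<le> r3" "0 < r1 + r2 + r3"
  shows "0 \<le> r1 / (r1 + r2 + r3)" "r1 / (r1 + r2 + r3) \<le> 1 / 3"
  using assms by (simp_all add: field_simps)

lemma ratio_diff:
  fixes r1 r2 r3 r1' r2' r3' :: real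
  assumes "0 < r1 + r2 + r3" "0 < r1' + r2' + r3'" "a = r1' / (r1' + r2' + r3')"
  shows "(r1 + r2 + r3) * (r1 / (r1 + r2 + r3) - a)
    = (1 - a) * (r1 - r1') - a * (r2 - r2') - a * (r3 - r3')"
proof -
  have "(r1 + r2 + r3) * (r1 / (r1 + r2 + r3) - a) = (r1 - r1') - a * ((r1 + r2 + r3) - (r1' + r2' + r3'))"
    unfolding assms(3) by (rule gap_diff) (use assms in auto)
  then show ?thesis by (simp add: algebra_simps)
qed

text \<open>Here the weights \<open>1 - a\<close>, \<open>a\<close>, \<open>a\<close> add up to
  \<open>1 + a\<close>, and \<open>a\<close> is at most 1/3 as the share of the smallest root. The
  factor 3 in \<open>PI\<close> turns 4/3 into 4.\<close>

lemma PI2_close: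
  fixes r1 r2 r3 r1' r2' r3' :: real
  assumes "0 \<le> r1'" "r1' \<le> r2'" "r2' \<le> r3'" "0 < r1 + r2 + r3" "0 < r1' + r2' + r3'"
    and d: "\<bar>r1 - r1'\<bar> \<le> e" "\<bar>r2 - r2'\<bar> \<le> e" "\<bar>r3 - r3'\<bar> \<le> e"
  shows "\<bar>3 * (r1 / (r1 + r2 + r3)) - 3 * (r1' / (r1' + r2' + r3'))\<bar> \<le> 4 * e / (r1 + r2 + r3)"
proof -
  define \<sigma> A a where "\<sigma> = r1 + r2 + r3" and "A = r1 / (r1 + r2 + r3)" and "a = r1' / (r1' + r2' + r3')"
  have p: "0 < \<sigma>" using assms by (simp add: \<sigma>_def)
  have a: "0 \<le> a" "a \<le> 1 / 3" unfolding a_def by (intro ratio_le_third assms)+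
  have "\<sigma> * (A - a) = (1 - a) * (r1 - r1') - a * (r2 - r2') - a * (r3 - r3')"
    unfolding \<sigma>_def A_def by (rule ratio_diff) (use assms a_def in auto)
  also have "\<bar>\<dots>\<bar> \<le> (1 - a) * e + a * e + a * e"
  proof -
    have "\<bar>(1 - a) * (r1 - r1')\<bar> \<le> (1 - a) * e" "\<bar>a * (r2 - r2')\<bar> \<le> a * e" "\<bar>a * (r3 - r3')\<bar> \<le> a * e"
      unfolding abs_mult using a d by (simp_all add: mult_left_mono)
    then show ?thesis by linarith
  qed
  also have "\<dots> = e + a * e" by (simp add: algebra_simps)
  also have "\<dots> \<le> 4 / 3 * e" using a mult_right_mono[of a "1 / 3" e] d(1) by linarith
  finally have "\<sigma> * (3 * \<bar>A - a\<bar>) \<le> 4 * e" using p by (simp add: abs_mult)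
  then have "3 * \<bar>A - a\<bar> \<le> 4 * e / \<sigma>" using p by (simp add: pos_le_divide_eq mult.commute)
  then have "\<bar>3 * A - 3 * a\<bar> \<le> 4 * e / \<sigma>"
    unfolding right_diff_distrib[symmetric] abs_mult by simp
  then show ?thesis unfolding A_def a_def \<sigma>_def .
qed

text \<open>The constant 3 is only reached by using the bounds on the squares: differences of the roots
  alone give the constant 4 of the previous lemma.\<close>
lemma PI2_close_sharp:
  fixes r1 r2 r3 r1' r2' r3' :: real
  assumes r: "0 \<le> r1" "r1 \<le> r2" "r2 \<le> r3" and r': "0 \<le> r1'" "r1' \<le> r2'" "r2' \<le> r3'"
    and pos: "0 < r1 + r2 + r3" "0 < r1' + r2' + r3'"
    and E: "\<bar>r1\<^sup>2 - r1'\<^sup>2\<bar> \<le> e\<^sup>2" "\<bar>r2\<^sup>2 - r2'\<^sup>2\<bar> \<le> e\<^sup>2" "\<bar>r3\<^sup>2 - r3'\<^sup>2\<bar> \<le> e\<^sup>2" "0 < e"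
    and l: "0 < l" "l\<^sup>2 \<le> r1\<^sup>2 + r2\<^sup>2 + r3\<^sup>2"
  shows "\<bar>3 * (r1 / (r1 + r2 + r3)) - 3 * (r1' / (r1' + r2' + r3'))\<bar> \<le> 3 * e / l"
proof -
  define \<sigma> \<sigma>' A a where "\<sigma> = r1 + r2 + r3" and "\<sigma>' = r1' + r2' + r3'"
    and "A = r1 / (r1 + r2 + r3)" and "a = r1' / (r1' + r2' + r3')"
  have p: "0 < \<sigma>" "0 < \<sigma>'" using pos by (simp_all add: \<sigma>_def \<sigma>'_def)
  have a: "0 \<le> a" "a \<le> 1 / 3" unfolding a_def by (intro ratio_le_third r' pos)+
  have A: "0 \<le> A" "A \<le> 1 / 3" unfolding A_def by (intro ratio_le_third r pos)+
  have "l\<^sup>2 \<le> \<sigma>\<^sup>2" using sum_squares_le_square_sum[of r1 r2 r3] l(2) r unfolding \<sigma>_def by linarith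
  then have l\<sigma>: "l \<le> \<sigma>" by (rule power2_le_imp_le) (use p in simp)
  define d1 d2 d3 where "d1 = r1 - r1'" and "d2 = r2 - r2'" and "d3 = r3 - r3'"
  have d: "\<bar>d1\<bar> \<le> e" "\<bar>d2\<bar> \<le> e" "\<bar>d3\<bar> \<le> e"
    using diff_le_sqrt[OF _ _ E(1)] diff_le_sqrt[OF _ _ E(2)] diff_le_sqrt[OF _ _ E(3)] r r' E(4)
    unfolding d1_def d2_def d3_def by simp_all
  have \<sigma>A: "\<sigma> * (A - a) = (1 - a) * d1 - a * d2 - a * d3"
    unfolding \<sigma>_def A_def d1_def d2_def d3_def by (rule ratio_diff) (use pos a_def in auto)
  \<comment> \<open>\<open>m\<close> is the largest solution \<open>y\<close> of
    \<open>y * (2 * x + y) \<le> e\<^sup>2\<close>: the most that a root of size \<open>x\<close>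
    can grow while its square grows by at most \<open>e\<^sup>2\<close>.\<close>
  define x m where "x = r1'" and "m = sqrt (x\<^sup>2 + e\<^sup>2) - x"
  have x0: "0 \<le> x" using r' by (simp add: x_def)
  have m2: "(m + x)\<^sup>2 = x\<^sup>2 + e\<^sup>2" by (simp add: m_def)
  have m_max: "y \<le> m" if "y * (2 * x + y) \<le> e\<^sup>2" for y
  proof -
    have "(y + x)\<^sup>2 \<le> x\<^sup>2 + e\<^sup>2" using that by (simp add: power2_eq_square algebra_simps)
    then have "y + x \<le> sqrt (x\<^sup>2 + e\<^sup>2)" by (rule real_le_rsqrt)
    then show ?thesis by (simp add: m_def)
  qed
  have m0: "0 \<le> m" by (rule m_max) simp
  \<comment> \<open>A root \<open>t\<close> larger than \<open>x\<close> can grow by even less,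
    since its square grows faster.\<close>
  have step: "y \<le> m" if "s = t + y" "x \<le> t" "\<bar>s\<^sup>2 - t\<^sup>2\<bar> \<le> e\<^sup>2" for s t y
  proof (cases "0 \<le> y")
    case True
    have "y * (2 * x + y) \<le> y * (2 * t + y)" using True that(2) by (intro mult_left_mono) auto
    also have "\<dots> = s\<^sup>2 - t\<^sup>2" using that(1) by (simp add: power2_eq_square algebra_simps)
    finally show ?thesis using that(3) by (intro m_max) linarith
  qed (use m0 in simp)
  have am: "a * y \<le> a * m" if "y \<le> m" for y using a(1) that by (rule mult_left_mono[rotated])
  have "\<bar>A - a\<bar> \<le> e / l"
  \<comment> \<open>The sign of \<open>d1\<close> decides which side is critical: the upper bound if
    \<open>d1\<close> is nonnegative, when \<open>x\<close> is a lower bound of all six roots, and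
    the lower bound otherwise. The other side already follows from
    \<open>a \<le> 1 / 3\<close>.\<close>
  proof (cases "0 \<le> d1")
    case True
    have lo: "- e \<le> \<sigma> * (A - a)"
    proof -
      have "0 \<le> (1 - a) * d1" using True a by simp
      moreover have "a * d2 \<le> 1 / 3 * e" "a * d3 \<le> 1 / 3 * e"
        using mult_left_mono[of d2 e a] mult_left_mono[of d3 e a] mult_right_mono[of a "1 / 3" e] d a E(4)
        by linarith+
      ultimately show ?thesis using \<sigma>A E(4) by linarith
    qed
    show ?thesis
    \<comment> \<open>For \<open>l < 3 * e\<close> the claim is trivial because both ratios lie
      between 0 and 1/3. Otherwise the second triple is also long enough to have sum at least
      \<open>e\<close>, whence \<open>a * e \<le> x\<close>.\<close>
    proof (cases "3 * e \<le> l")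
      case False
      then have "1 / 3 \<le> e / l" using l(1) by (simp add: field_simps)
      then show ?thesis using A a by linarith
    next
      case le: True
      have "(3 * e)\<^sup>2 \<le> l\<^sup>2" using le E(4) by (intro power_mono) auto
      then have "e\<^sup>2 \<le> r1'\<^sup>2 + r2'\<^sup>2 + r3'\<^sup>2"
        using l(2) E(1-3) zero_le_power2[of e] unfolding power_mult_distrib abs_le_iff by simp
      also have "\<dots> \<le> \<sigma>'\<^sup>2" unfolding \<sigma>'_def by (rule sum_squares_le_square_sum) (use r' in auto)
      finally have "e \<le> \<sigma>'" by (rule power2_le_imp_le) (use p in simp)
      then have "a * e \<le> a * \<sigma>'" using a(1) by (rule mult_left_mono)
      also have "\<dots> = x" using p by (simp add: a_def x_def \<sigma>'_def)
      finally have ae: "a * e \<le> x" .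
      have "d1 \<le> m" by (rule step[of r1 r1']) (use E d1_def x_def in auto)
      moreover have "- d2 \<le> m" "- d3 \<le> m"
        by (rule step[of r2' r2], use E d2_def x_def d1_def r True in \<open>auto simp: abs_minus_commute\<close>)
          (rule step[of r3' r3], use E d3_def x_def d1_def r True in \<open>auto simp: abs_minus_commute\<close>)
      ultimately have "\<sigma> * (A - a) \<le> m * (1 + a)"
        using am[of "- d2"] am[of "- d3"] mult_left_mono[of d1 m "1 - a"] a unfolding \<sigma>A
        by (simp add: algebra_simps)
      \<comment> \<open>By its definition \<open>m\<close> satisfies
        \<open>m * (m + 2 * x) = e\<^sup>2\<close>. Now \<open>e \<le> m + x\<close> and
        \<open>a * e \<le> x\<close> give \<open>e + a * e \<le> m + 2 * x\<close>, so
        \<open>m * (1 + a) * e\<close> is at most \<open>e\<^sup>2\<close>.\<close>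
      also have "\<dots> \<le> e"
      proof -
        have "e\<^sup>2 \<le> (m + x)\<^sup>2" using m2 by simp
        then have "e \<le> m + x" by (rule power2_le_imp_le) (use m0 x0 in simp)
        then have "m * (e + a * e) \<le> m * (m + 2 * x)" using ae m0 by (intro mult_left_mono) auto
        also have "\<dots> = e\<^sup>2" using m2 by (simp add: power2_eq_square algebra_simps)
        finally have "(m * (1 + a)) * e \<le> e * e" by (simp add: power2_eq_square algebra_simps)
        then show ?thesis using E(4) by (rule mult_right_le_imp_le)
      qed
      finally have "\<bar>\<sigma> * (A - a)\<bar> \<le> e" using lo by linarith
      then have "\<sigma> * \<bar>A - a\<bar> \<le> e" using p by (simp add: abs_mult)
      then have "\<bar>A - a\<bar> \<le> e / \<sigma>" using p by (simp add: pos_le_divide_eq mult.commute)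
      also have "\<dots> \<le> e / l" using l\<sigma> l(1) E(4) by (intro divide_left_mono) auto
      finally show ?thesis .
    qed
  next
    case False
    \<comment> \<open>The smallest root of the first triple is nonnegative, so the drop
      \<open>f\<close> from \<open>x\<close> is at most \<open>x\<close>.\<close>
    define f where "f = - d1"
    have f: "0 \<le> f" "f \<le> x" "f \<le> e" using False d r by (auto simp: f_def d1_def x_def)
    have "d2 \<le> m" "d3 \<le> m"
      by (rule step[of r2 r2'], use E d2_def x_def r' in auto) (rule step[of r3 r3'], use E d3_def x_def r' in auto)
    then have "- (\<sigma> * (A - a)) \<le> (1 - a) * f + 2 * (a * m)"
      using am[of d2] am[of d3] unfolding \<sigma>A f_def by simp
    also have "\<dots> = f + a * (2 * m - f)" by (simp add: algebra_simps)
    also have "\<dots> \<le> e"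
    proof (cases "2 * m \<le> f")
      case True
      then have "a * (2 * m - f) \<le> 0" using a(1) by (simp add: mult_nonneg_nonpos)
      then show ?thesis using f by linarith
    next
      case F: False
      \<comment> \<open>In this case the bound grows with \<open>a\<close>, so
        \<open>a = 1 / 3\<close> is the worst value and \<open>m + f \<le> 3 / 2 * e\<close> is what
        is needed. From \<open>f \<le> x\<close> and \<open>f \<le> e\<close> the square of
        \<open>m + f\<close> is at most \<open>m\<^sup>2 + 2 * m * x + e\<^sup>2\<close>, which is
        \<open>2 * e\<^sup>2\<close>.\<close>
      have "m * f \<le> m * x" using m0 f by (intro mult_left_mono)
      moreover have "f\<^sup>2 \<le> e\<^sup>2" using f by (intro power_mono)
      ultimately have "(m + f)\<^sup>2 \<le> 2 * e\<^sup>2" using m2 by (simp add: power2_eq_square algebra_simps)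
      also have "\<dots> \<le> (3 / 2 * e)\<^sup>2" by (simp add: power_mult_distrib power_divide)
      finally have "m + f \<le> 3 / 2 * e" by (rule power2_le_imp_le) (use E in simp)
      moreover define z where "z = a * (2 * m - f)"
      moreover have "z \<le> 1 / 3 * (2 * m - f)" unfolding z_def using F a by (intro mult_right_mono) auto
      then have "z \<le> 2 / 3 * m - 1 / 3 * f" by (simp add: algebra_simps)
      ultimately have "f + z \<le> e" by (simp add: field_simps)
      then show ?thesis unfolding z_def .
    qed
    finally have lo: "- e \<le> \<sigma> * (A - a)" by linarith
    have "(1 - a) * d1 \<le> 0" using False a by (simp add: mult_nonneg_nonpos)
    moreover have "- (a * d2) \<le> 1 / 3 * e" "- (a * d3) \<le> 1 / 3 * e"
      using mult_left_mono[of "- d2" e a] mult_left_mono[of "- d3" e a] mult_right_mono[of a "1 / 3" e] d a E(4)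
      by linarith+
    ultimately have "\<sigma> * (A - a) \<le> e" using \<sigma>A E(4) by linarith
    with lo have "\<bar>\<sigma> * (A - a)\<bar> \<le> e" by linarith
    then have "\<sigma> * \<bar>A - a\<bar> \<le> e" using p by (simp add: abs_mult)
    then have "\<bar>A - a\<bar> \<le> e / \<sigma>" using p by (simp add: pos_le_divide_eq mult.commute)
    also have "\<dots> \<le> e / l" using l\<sigma> l(1) E(4) by (intro divide_left_mono) auto
    finally show ?thesis .
  qed
  then show ?thesis unfolding A_def a_def by linarith
qed

text \<open>Only the first lattice is tied to \<open>l\<close>; \<open>PM_le_SIM\<close> exchanges
  the lattices if the longest vector belongs to the second.\<close>

lemma PI_close_sharp:
  assumes "obtuse v" "obtuse u" "0 < l" "l\<^sup>2 \<le> (RI (lat v) $ 1)\<^sup>2 + (RI (lat v) $ 2)\<^sup>2 + (RI (lat v) $ 3)\<^sup>2"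
    and E: "\<And>k. \<bar>(RI (lat v) $ k)\<^sup>2 - (RI (lat u) $ k)\<^sup>2\<bar> \<le> e\<^sup>2" "0 < e"
  shows "\<bar>PI (lat v) $ k - PI (lat u) $ k\<bar> \<le> 3 * e / l"
proof -
  note rv = RI_props[OF assms(1)] and ru = RI_props[OF assms(2)]
  let ?s = "RI (lat v) $ 1 + RI (lat v) $ 2 + RI (lat v) $ 3"
  have d: "\<bar>RI (lat v) $ k - RI (lat u) $ k\<bar> \<le> e" for k
    using diff_le_sqrt[OF rv(1) ru(1) E(1)] E(2) by simp
  have "l\<^sup>2 \<le> ?s\<^sup>2"
    using assms(4) sum_squares_le_square_sum[OF rv(1) rv(1) rv(1)] by (rule order_trans)
  then have "l \<le> ?s" by (rule power2_le_imp_le) (use rv(6) in simp)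
  then have "3 * e / ?s \<le> 3 * e / l" using assms(3) E(2) by (intro divide_left_mono) auto
  moreover have "\<bar>PI (lat v) $ 1 - PI (lat u) $ 1\<bar> \<le> 3 * e / ?s"
    unfolding PI_comps by (rule PI1_close) (use rv ru d in auto)
  moreover have "\<bar>PI (lat v) $ 2 - PI (lat u) $ 2\<bar> \<le> 3 * e / l"
    unfolding PI_comps by (rule PI2_close_sharp) (use rv ru E assms in auto)
  ultimately show ?thesis using exhaust_2[of k] by auto
qed

lemma PI_close:
  assumes "obtuse v" "obtuse u" "\<And>k. \<bar>RI (lat v) $ k - RI (lat u) $ k\<bar> \<le> e"
  shows "\<bar>PI (lat v) $ k - PI (lat u) $ k\<bar> \<le> 4 * e / (RI (lat v) $ 1 + RI (lat v) $ 2 + RI (lat v) $ 3)"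
proof -
  note rv = RI_props[OF assms(1)] and ru = RI_props[OF assms(2)]
  let ?s = "RI (lat v) $ 1 + RI (lat v) $ 2 + RI (lat v) $ 3"
  have "3 * e / ?s \<le> 4 * e / ?s" using rv(6) assms(3)[of 1] by (intro divide_right_mono) auto
  moreover have "\<bar>PI (lat v) $ 1 - PI (lat u) $ 1\<bar> \<le> 3 * e / ?s"
    unfolding PI_comps by (rule PI1_close) (use rv ru assms in auto)
  moreover have "\<bar>PI (lat v) $ 2 - PI (lat u) $ 2\<bar> \<le> 4 * e / ?s"
    unfolding PI_comps by (rule PI2_close) (use rv ru assms in auto)
  ultimately show ?thesis using exhaust_2[of k] by auto
qed

section \<open>Groups of isometries and similarities\<close>

lemma lat_linear_image:
  assumes "linear h"
  shows "lat (h \<circ> v) = h ` lat v"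
proof -
  have e: "(\<Sum>k\<in>UNIV. of_int (c k) *\<^sub>R h (v k)) = h (\<Sum>k\<in>UNIV. of_int (c k) *\<^sub>R v k)" for c :: "3 \<Rightarrow> int"
    using assms by (simp add: linear_sum linear_cmul)
  show ?thesis unfolding lat_def by (auto simp: e)
qed

lemma det2_matrix_mult: "det2 (A *v x) (A *v y) = det A * det2 x y"
  by (simp add: det2_def matrix_vector_mult_def sum_2 det_2 algebra_simps)

lemma det2_linear: "linear f \<Longrightarrow> det2 (f x) (f y) = det (matrix f) * det2 x y"
  using det2_matrix_mult[of "matrix f" x y] by (simp add: matrix_works)

lemma scaled_O2E:
  assumes "h \<in> scaled O2"
  obtains s where "s > 0" "linear h" "\<And>x y. h x \<bullet> h y = s\<^sup>2 * (x \<bullet> y)" "\<And>x. norm (h x) = s * norm x"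
proof -
  from assms obtain s f where h: "h = (\<lambda>x. s *\<^sub>R f x)" "s > 0" "orthogonal_transformation f"
    unfolding scaled_def O2_def by blast
  have "linear h" unfolding h(1) using orthogonal_transformation_linear[OF h(3)]
    by (rule linear_compose_scale_right)
  moreover have "h x \<bullet> h y = s\<^sup>2 * (x \<bullet> y)" for x y
    using h(3) by (simp add: h(1) power2_eq_square orthogonal_transformation_def)
  moreover have "norm (h x) = s * norm x" for x
    using h by (simp add: orthogonal_transformation_norm)
  ultimately show ?thesis using that h(2) by blast
qed

lemma opp_scaled: "(\<And>x y. h x \<bullet> h y = s\<^sup>2 * (x \<bullet> y)) \<Longrightarrow> opp (h \<circ> v) k = s\<^sup>2 * opp v k"
  by (simp add: opp_def)

lemma obtuse_scaled:
  assumes "h \<in> scaled O2" "obtuse v"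
  shows "obtuse (h \<circ> v)"
proof -
  obtain s where s: "s > 0" "linear h" "\<And>x y. h x \<bullet> h y = s\<^sup>2 * (x \<bullet> y)"
    using scaled_O2E[OF assms(1)] by metis
  have "h (v 0) + h (v 1) + h (v 2) = 0"
    using obtuseD(1)[OF assms(2)] s(2) by (simp add: linear_0 flip: linear_add[OF s(2)])
  \<comment> \<open>Inner products determine the determinant up to sign by Lagrange's identity,
    which is enough for it not to vanish.\<close>
  moreover have "(det2 (h (v 1)) (h (v 2)))\<^sup>2 = (s\<^sup>2 * det2 (v 1) (v 2))\<^sup>2"
    unfolding det2_square power_mult_distrib s(3) by (simp add: power2_eq_square algebra_simps)
  then have "det2 (h (v 1)) (h (v 2)) \<noteq> 0" using s(1) obtuseD(2)[OF assms(2)] by auto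
  moreover have "i \<noteq> j \<Longrightarrow> h (v i) \<bullet> h (v j) \<le> 0" for i j
    using obtuseD(3)[OF assms(2)] s by (simp add: mult_nonneg_nonpos)
  ultimately show ?thesis unfolding obtuse_def by simp
qed

lemma scaled_linear: "h \<in> scaled O2 \<Longrightarrow> linear h"
  using scaled_O2E by blast

lemma lat_scaled: "h \<in> scaled O2 \<Longrightarrow> lat (h \<circ> v) = h ` lat v"
  by (rule lat_linear_image) (rule scaled_linear)

lemma O2_scaled: "O2 \<subseteq> scaled O2"
  unfolding scaled_def by (auto intro!: exI[of _ "1::real"])

lemma scaled_mono: "F \<subseteq> G \<Longrightarrow> scaled F \<subseteq> scaled G"
  unfolding scaled_def by blast

lemma SO2_O2: "SO2 \<subseteq> O2"
  unfolding SO2_def O2_def by blast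

lemma RI_scaled:
  assumes "s > 0" "\<And>x y. h x \<bullet> h y = s\<^sup>2 * (x \<bullet> y)" "h \<in> scaled O2" "obtuse v"
  shows "RI (h ` lat v) = s *\<^sub>R RI (lat v)"
proof -
  have "RI (h ` lat v) = sorted3 (\<lambda>k. sqrt (opp (h \<circ> v) k))"
    using RI_eq[OF obtuse_scaled[OF assms(3,4)]] lat_scaled[OF assms(3)] by simp
  also have "\<dots> = sorted3 (\<lambda>k. s * sqrt (opp v k))"
    using assms(1) by (simp only: opp_scaled[OF assms(2)]) (simp add: real_sqrt_mult)
  also have "\<dots> = s *\<^sub>R RI (lat v)"
    using assms(1) by (simp add: sorted3_scale RI_eq[OF assms(4)])
  finally show ?thesis .
qed

lemma RI_O2:
  assumes "h \<in> O2" "\<Lambda> \<in> lattices"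
  shows "RI (h ` \<Lambda>) = RI \<Lambda>"
proof -
  obtain v where "obtuse v" "lat v = \<Lambda>" using obtuse_superbase_exists[OF assms(2)] .
  then show ?thesis
    using RI_scaled[of 1 h v] assms(1) O2_scaled by (auto simp: O2_def orthogonal_transformation_def)
qed

lemma PI_scaled_O2:
  assumes "h \<in> scaled O2" "\<Lambda> \<in> lattices"
  shows "PI (h ` \<Lambda>) = PI \<Lambda>"
proof -
  obtain v where v: "obtuse v" "lat v = \<Lambda>" using obtuse_superbase_exists[OF assms(2)] .
  obtain s where s: "s > 0" "\<And>x y. h x \<bullet> h y = s\<^sup>2 * (x \<bullet> y)" using scaled_O2E[OF assms(1)] by metis
  have R: "RI (h ` \<Lambda>) = s *\<^sub>R RI \<Lambda>" using RI_scaled[OF s assms(1) v(1)] v(2) by simp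
  have c: "s * a / (s * b + s * c + s * d) = a / (b + c + d)" for a b c d
    using s(1) by (simp flip: distrib_left)
  show ?thesis
    by (simp add: vec_eq_iff forall_2 PI_comps R c flip: right_diff_distrib)
qed

lemma RM_O2: "\<lbrakk>g \<in> O2; h \<in> O2; \<Lambda> \<in> lattices; \<Lambda>' \<in> lattices\<rbrakk> \<Longrightarrow> RM q (g ` \<Lambda>) (h ` \<Lambda>') = RM q \<Lambda> \<Lambda>'"
  by (simp add: RM_def RI_O2)

lemma PM_scaled_O2:
  "\<lbrakk>g \<in> scaled O2; h \<in> scaled O2; \<Lambda> \<in> lattices; \<Lambda>' \<in> lattices\<rbrakk> \<Longrightarrow> PM q (g ` \<Lambda>) (h ` \<Lambda>') = PM q \<Lambda> \<Lambda>'"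
  by (simp add: PM_def PI_scaled_O2)

text \<open>Equal lengths give equal conorms, hence equal Gram matrices of the vectors 1 and 2, so
  the linear map between these bases is orthogonal.\<close>

lemma ex_O2_if_norm_eq:
  assumes "obtuse v" "obtuse u" "\<And>i. norm (u i) = norm (v i)"
  obtains f where "f \<in> O2" "\<And>i. f (v i) = u i"
proof -
  have ind: "independent {v 1, v 2}" "v 1 \<noteq> v 2" using independent_pair_iff obtuseD(2)[OF assms(1)] by blast+
  obtain f where f: "linear f" "\<And>x. x \<in> {v 1, v 2} \<Longrightarrow> f x = (if x = v 1 then u 1 else u 2)"
    using linear_independent_extend[OF ind(1), of "\<lambda>x. if x = v 1 then u 1 else u 2"] by blast
  have fv: "f (v 1) = u 1" "f (v 2) = u 2" using f(2) ind(2) by auto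
  have "opp u k = opp v k" for k
    using assms(3) by (simp add: opp_eq_norms[OF obtuseD(1)[OF assms(1)]] opp_eq_norms[OF obtuseD(1)[OF assms(2)]])
  from this[of 0] have i: "u 1 \<bullet> u 2 = v 1 \<bullet> v 2" by (simp add: opp_simps)
  have n: "u i \<bullet> u i = v i \<bullet> v i" for i using assms(3)[of i] by (simp add: norm_eq)
  have "f x \<bullet> f y = x \<bullet> y" for x y
  proof -
    obtain a b c d where xy: "x = a *\<^sub>R v 1 + b *\<^sub>R v 2" "y = c *\<^sub>R v 1 + d *\<^sub>R v 2"
      using det2_expand[OF obtuseD(2)[OF assms(1)]] by metis
    then show ?thesis
      using n[of 1] n[of 2] i
      by (simp add: linear_add[OF f(1)] linear_cmul[OF f(1)] fv inner_add_left inner_add_right inner_commute)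
  qed
  then have "f \<in> O2" using f(1) by (simp add: O2_def orthogonal_transformation_def)
  moreover have "f (v k) = u k" for k
    using fv by (cases k rule: cases3)
      (simp_all add: obtuse_v0[OF assms(1)] obtuse_v0[OF assms(2)] linear_diff[OF f(1)] linear_neg[OF f(1)])
  ultimately show ?thesis using that by blast
qed

text \<open>The source of injectivity on classes. The map may reverse orientation, so it is
  available only for groups that contain \<open>O2\<close>.\<close>

lemma obtuse_unique_up_to_O2:
  assumes "obtuse v" "obtuse u" "lat u = lat v"
  obtains f where "f \<in> O2" "f ` range v = range u"
proof -
  obtain \<sigma> where s: "bij \<sigma>" "\<And>i. norm (u (\<sigma> i)) = norm (v i)"
    using obtuse_matching[OF assms] by metis
  obtain f where f: "f \<in> O2" "\<And>i. f (v i) = (u \<circ> \<sigma>) i"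
    using ex_O2_if_norm_eq[OF assms(1) obtuse_comp_bij[OF s(1) assms(2)]] s(2) by (metis comp_apply)
  have "f ` range v = range (u \<circ> \<sigma>)" using f(2) by (simp add: image_image)
  also have "\<dots> = range u" using bij_is_surj[OF s(1)] by (metis fun.set_map)
  finally show ?thesis using that f(1) by blast
qed

section \<open>The four kinds of maps, described by their linear parts\<close>

definition affine_maps :: "(plane \<Rightarrow> plane) set \<Rightarrow> (plane \<Rightarrow> plane) set" where
  "affine_maps M = {(\<lambda>x. h x + t) |h t. h \<in> M}"

lemma affine_mapsI: "h \<in> M \<Longrightarrow> f = (\<lambda>x. h x + t) \<Longrightarrow> f \<in> affine_maps M"
  unfolding affine_maps_def by blast

lemma scaledI: "f \<in> F \<Longrightarrow> s > 0 \<Longrightarrow> h = (\<lambda>x. s *\<^sub>R f x) \<Longrightarrow> h \<in> scaled F"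
  unfolding scaled_def by blast

text \<open>Allows the spaces of classes to be treated once; the instances are \<open>O2\<close>,
  \<open>SO2\<close> and their scaled versions.\<close>

locale linear_group =
  fixes M :: "(plane \<Rightarrow> plane) set"
  assumes sub: "M \<subseteq> scaled O2"
    and id_mem: "id \<in> M"
    and comp_mem: "\<lbrakk>f \<in> M; g \<in> M\<rbrakk> \<Longrightarrow> f \<circ> g \<in> M"
    and inv_mem: "f \<in> M \<Longrightarrow> inv f \<in> M"

lemma scaled_bij: "h \<in> scaled O2 \<Longrightarrow> bij h"
proof -
  assume h: "h \<in> scaled O2"
  obtain s where s: "s > 0" "linear h" "\<And>x. norm (h x) = s * norm x" using scaled_O2E[OF h] by metis
  have "h x = 0 \<Longrightarrow> x = 0" for x using s(1) s(3)[of x] by simp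
  then have "inj h" using s(2) by (simp add: linear_injective_0)
  then show ?thesis using linear_injective_imp_surjective[OF s(2)] by (simp add: bij_def)
qed

lemma linear_group_O2: "linear_group O2"
proof
  show "f \<circ> g \<in> O2" if "f \<in> O2" "g \<in> O2" for f g
    using that orthogonal_transformation_compose by (auto simp: O2_def comp_def)
  show "inv f \<in> O2" if "f \<in> O2" for f
    using that orthogonal_transformation_inv by (auto simp: O2_def)
qed (use O2_scaled in \<open>auto simp: O2_def id_def\<close>)

lemma linear_group_SO2: "linear_group SO2"
proof
  show "SO2 \<subseteq> scaled O2" using SO2_O2 O2_scaled by blast
  have "orthogonal_transformation (id :: plane \<Rightarrow> plane)" unfolding id_def by simp
  then show "id \<in> SO2" by (simp add: SO2_def)
  have comp: "det (matrix (f \<circ> g)) = det (matrix f) * det (matrix g)" if "f \<in> O2" "g \<in> O2" for f g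
    using that by (simp add: O2_def matrix_compose orthogonal_transformation_linear det_mul)
  show "f \<circ> g \<in> SO2" if "f \<in> SO2" "g \<in> SO2" for f g
    using that SO2_O2 comp linear_group.comp_mem[OF linear_group_O2] by (auto simp: SO2_def O2_def)
  show "inv f \<in> SO2" if f: "f \<in> SO2" for f
  proof -
    have O: "f \<in> O2" "inv f \<in> O2" using f SO2_O2 linear_group.inv_mem[OF linear_group_O2] by blast+
    have "f \<circ> inv f = id" using scaled_bij[of f] O O2_scaled by (metis bij_is_surj subsetD surj_iff)
    then have "det (matrix f) * det (matrix (inv f)) = 1"
      using comp[OF O] by (simp add: matrix_id id_def[symmetric])
    then show ?thesis using f O(2) by (simp add: SO2_def O2_def)
  qed
qed

lemma linear_group_scaled:
  assumes "linear_group F" "F \<subseteq> O2"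
  shows "linear_group (scaled F)"
proof -
  interpret linear_group F by fact
  show ?thesis
  proof
    show "scaled F \<subseteq> scaled O2" by (rule scaled_mono[OF assms(2)])
    show "id \<in> scaled F" unfolding scaled_def using id_mem by (auto intro!: exI[of _ "1::real"] exI[of _ id])
    have lin: "f \<in> F \<Longrightarrow> linear f" for f using sub scaled_linear by blast
    show "f \<circ> g \<in> scaled F" if fg: "f \<in> scaled F" "g \<in> scaled F" for f g
    proof -
      obtain s f' t g' where "f = (\<lambda>x. s *\<^sub>R f' x)" "s > 0" "f' \<in> F" "g = (\<lambda>x. t *\<^sub>R g' x)" "t > 0" "g' \<in> F"
        using fg unfolding scaled_def by blast
      then have "f \<circ> g = (\<lambda>x. (s * t) *\<^sub>R (f' \<circ> g') x)" "s * t > 0" "f' \<circ> g' \<in> F"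
        by (auto simp: linear_cmul[OF lin] comp_mem)
      then show ?thesis unfolding scaled_def by blast
    qed
    show "inv f \<in> scaled F" if f: "f \<in> scaled F" for f
    proof -
      obtain s f' where f': "f = (\<lambda>x. s *\<^sub>R f' x)" "s > 0" "f' \<in> F"
        using f unfolding scaled_def by blast
      have b: "bij f'" using f'(3) sub scaled_bij by blast
      have l: "linear (inv f')" using lin inv_mem f'(3) by blast
      have "inv f = (\<lambda>x. (1 / s) *\<^sub>R inv f' x)"
        by (rule inv_equality) (use f' b in \<open>simp_all add: linear_cmul[OF l] linear_cmul[OF lin] bij_is_inj bij_is_surj surj_f_inv_f\<close>)
      then show ?thesis using f'(2) inv_mem[OF f'(3)] by (intro scaledI) auto
    qed
  qed
qed

lemma isometries_eq: "{f. isometry f} = affine_maps O2"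
proof (intro equalityI subsetI)
  fix f assume "f \<in> {f. isometry f}"
  then have "orthogonal_transformation (\<lambda>x. f x - f 0)"
    by (simp add: orthogonal_transformation_isometry isometry_def dist_norm)
  then have "(\<lambda>x. f x - f 0) \<in> O2" by (simp add: O2_def)
  then show "f \<in> affine_maps O2" by (rule affine_mapsI[of _ _ _ "f 0"]) simp
next
  fix f assume "f \<in> affine_maps O2"
  then show "f \<in> {f. isometry f}"
    unfolding affine_maps_def O2_def by (auto simp: isometry_def orthogonal_transformation_isometry)
qed

lemma similarities_eq: "{f. similarity f} = affine_maps (scaled O2)"
proof (intro equalityI subsetI)
  fix f assume "f \<in> {f. similarity f}"
  then obtain g s where g: "isometry g" "s > 0" "f = (\<lambda>x. s *\<^sub>R g x)" unfolding similarity_def by blast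
  then obtain h t where h: "h \<in> O2" "g = (\<lambda>x. h x + t)" using isometries_eq unfolding affine_maps_def by blast
  have "f = (\<lambda>x. s *\<^sub>R h x + s *\<^sub>R t)" using g h by (simp add: scaleR_right_distrib)
  then show "f \<in> affine_maps (scaled O2)" by (rule affine_mapsI[OF scaledI[OF h(1) g(2) refl]])
next
  fix f assume "f \<in> affine_maps (scaled O2)"
  then obtain s h t where h: "s > 0" "h \<in> O2" "f = (\<lambda>x. s *\<^sub>R h x + t)" unfolding affine_maps_def scaled_def by blast
  have "isometry (\<lambda>x. h x + (1 / s) *\<^sub>R t)" using h(2) isometries_eq unfolding affine_maps_def by blast
  moreover have "f = (\<lambda>x. s *\<^sub>R (h x + (1 / s) *\<^sub>R t))" using h by (simp add: scaleR_right_distrib)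
  ultimately show "f \<in> {f. similarity f}" using h(1) unfolding similarity_def by blast
qed

lemma det_O2: "h \<in> O2 \<Longrightarrow> det (matrix h) = 1 \<or> det (matrix h) = - 1"
  using det_orthogonal_matrix orthogonal_transformation_matrix by (auto simp: O2_def)

lemma orientation_preserving_scaled:
  assumes "h \<in> O2" "s > 0"
  shows "orientation_preserving (\<lambda>x. s *\<^sub>R h x + t) \<longleftrightarrow> h \<in> SO2"
proof -
  have lin: "linear (\<lambda>x. s *\<^sub>R h x)" using assms by (simp add: O2_def linear_compose_scale_right orthogonal_transformation_linear)
  have lh: "linear h" using assms by (simp add: O2_def orthogonal_transformation_linear)
  \<comment> \<open>Evaluating \<open>det2_linear\<close> at the standard basis reads off the
    determinant of the matrix.\<close>
  have e: "det2 (axis 1 1) (axis 2 1) = 1" by (simp add: det2_def axis_def)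
  have "det (matrix (\<lambda>x. s *\<^sub>R h x)) = s\<^sup>2 * det (matrix h)"
    using det2_linear[OF lin, of "axis 1 1" "axis 2 1"] det2_linear[OF lh, of "axis 1 1" "axis 2 1"]
    by (simp add: e det2_bilinear power2_eq_square)
  then have "det (matrix (\<lambda>x. s *\<^sub>R h x)) > 0 \<longleftrightarrow> det (matrix h) = 1"
    using det_O2[OF assms(1)] assms(2) by auto
  then have d: "det (matrix (\<lambda>x. s *\<^sub>R h x)) > 0 \<longleftrightarrow> h \<in> SO2"
    using assms(1) by (simp add: SO2_def O2_def)
  show ?thesis
  proof
    assume "orientation_preserving (\<lambda>x. s *\<^sub>R h x + t)"
    then obtain A t' where A: "det A > 0" "(\<lambda>x. s *\<^sub>R h x + t) = (\<lambda>x. A *v x + t')"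
      unfolding orientation_preserving_def by blast
    from fun_cong[OF A(2), of 0] have "t = t'" by (simp add: linear_0[OF lh])
    then have "(\<lambda>x. s *\<^sub>R h x) = (\<lambda>x. A *v x)" using fun_cong[OF A(2)] by auto
    then show "h \<in> SO2" using A(1) d by simp
  next
    assume "h \<in> SO2"
    then show "orientation_preserving (\<lambda>x. s *\<^sub>R h x + t)"
      unfolding orientation_preserving_def using d
      by (intro exI[of _ "matrix (\<lambda>x. s *\<^sub>R h x)"] exI[of _ t]) (simp add: matrix_works lin)
  qed
qed

lemma rigid_motions_eq: "{f. rigid_motion f} = affine_maps SO2"
proof -
  have "f \<in> affine_maps SO2 \<longleftrightarrow> f \<in> affine_maps O2 \<and> orientation_preserving f" for f
    using orientation_preserving_scaled[of _ 1] SO2_O2 unfolding affine_maps_def by fastforce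
  then show ?thesis using isometries_eq unfolding rigid_motion_def by blast
qed

lemma oriented_similarities_eq: "{f. oriented_similarity f} = affine_maps (scaled SO2)"
proof -
  have "f \<in> affine_maps (scaled SO2) \<longleftrightarrow> f \<in> affine_maps (scaled O2) \<and> orientation_preserving f" for f
    using orientation_preserving_scaled SO2_O2 unfolding affine_maps_def scaled_def by fastforce
  then show ?thesis using similarities_eq unfolding oriented_similarity_def by blast
qed

section \<open>Spaces of classes\<close>

lemma obtuse_superbase_iff: "obtuse_superbase B \<Lambda> \<longleftrightarrow> (\<exists>v. obtuse v \<and> range v = B \<and> lat v = \<Lambda>)"
  unfolding obtuse_superbase_def labelled_iff by blast

lemma obtuse_superbases_eq: "obtuse_superbases = {range v |v. obtuse v}"
  unfolding obtuse_superbases_def obtuse_superbase_iff by blast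

lemma int_span_obtuse: "obtuse v \<Longrightarrow> int_span (range v) = lat v"
  by (rule int_span_range) (rule obtuse_inj)

text \<open>Both superbases have sum zero, so adding up the three images leaves
  \<open>3 *\<^sub>R t = 0\<close>.\<close>

lemma obtuse_translate_0:
  assumes "obtuse v" "obtuse u" "linear h" "(\<lambda>x. h x + t) ` range v = range u"
  shows "t = 0"
proof -
  have "range (\<lambda>k. h (v k) + t) = range u" using assms(4) by (simp add: image_image)
  then obtain \<pi> where p: "bij \<pi>" "(\<lambda>k. h (v k) + t) = u \<circ> \<pi>"
    by (rule relabel[OF obtuse_inj[OF assms(2)]])
  have "h (v k) + t = (u \<circ> \<pi>) k" for k using p(2) by metis
  then have "(h (v 0) + t) + (h (v 1) + t) + (h (v 2) + t) = (u \<circ> \<pi>) 0 + (u \<circ> \<pi>) 1 + (u \<circ> \<pi>) 2" by simp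
  also have "\<dots> = 0" by (rule obtuseD(1)[OF obtuse_comp_bij[OF p(1) assms(2)]])
  finally have "h (v 0 + v 1 + v 2) + 3 *\<^sub>R t = 0"
    by (simp add: linear_add[OF assms(3)] algebra_simps scaleR_left_distrib[of 2 1, simplified] scaleR_2)
  then show ?thesis using obtuseD(1)[OF assms(1)] by (simp add: linear_0[OF assms(3)])
qed

lemma lattice_translate:
  assumes "\<Lambda> \<in> lattices" "t \<in> \<Lambda>"
  shows "(\<lambda>x. x - t) ` \<Lambda> = \<Lambda>"
proof -
  obtain v where v: "lat v = \<Lambda>" using obtuse_superbase_exists[OF assms(1)] by metis
  have "x + t \<in> \<Lambda>" "x - t \<in> \<Lambda>" if "x \<in> \<Lambda>" for x using that assms(2) lat_add lat_diff v by blast+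
  then show ?thesis by (auto intro!: image_eqI[of _ _ "_ + t"])
qed

lemma lattice_0: "\<Lambda> \<in> lattices \<Longrightarrow> 0 \<in> \<Lambda>"
  using obtuse_superbase_exists lat_0 by metis

section \<open>Classes as orbits of a linear group\<close>

context linear_group
begin

lemma lin: "h \<in> M \<Longrightarrow> linear h"
  using sub scaled_linear by blast

lemma mem_affine_maps: "h \<in> M \<Longrightarrow> h \<in> affine_maps M"
  by (rule affine_mapsI[of _ _ _ 0]) auto

text \<open>The translation part is the image of 0, hence a vector of the target lattice, and
  translating by it maps this lattice to itself.\<close>

lemma equiv_lattices_iff:
  "(\<Lambda>, \<Lambda>') \<in> equiv_by (affine_maps M) lattices \<longleftrightarrow> \<Lambda> \<in> lattices \<and> \<Lambda>' \<in> lattices \<and> (\<exists>h\<in>M. h ` \<Lambda> = \<Lambda>')"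
proof -
  have "\<exists>h\<in>M. h ` \<Lambda> = \<Lambda>'" if L: "\<Lambda> \<in> lattices" "\<Lambda>' \<in> lattices" "f \<in> affine_maps M" "f ` \<Lambda> = \<Lambda>'" for f
  proof -
    obtain h t where h: "h \<in> M" "f = (\<lambda>x. h x + t)" using L(3) unfolding affine_maps_def by blast
    have "t = f 0" by (simp add: h(2) linear_0[OF lin[OF h(1)]])
    then have "t \<in> \<Lambda>'" using L(4) lattice_0[OF L(1)] by blast
    have "h ` \<Lambda> = (\<lambda>x. x - t) ` f ` \<Lambda>" by (simp add: h(2) image_image)
    also have "\<dots> = \<Lambda>'" using lattice_translate[OF L(2) \<open>t \<in> \<Lambda>'\<close>] L(4) by simp
    finally show ?thesis using h(1) by blast
  qed
  then show ?thesis unfolding equiv_by_def using mem_affine_maps by blast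
qed

lemma equiv_superbases_iff:
  "(B, B') \<in> equiv_by (affine_maps M) obtuse_superbases \<longleftrightarrow>
    B \<in> obtuse_superbases \<and> B' \<in> obtuse_superbases \<and> (\<exists>h\<in>M. h ` B = B')"
proof -
  have "\<exists>h\<in>M. h ` B = B'" if L: "B \<in> obtuse_superbases" "B' \<in> obtuse_superbases" "f \<in> affine_maps M" "f ` B = B'" for f
  proof -
    obtain h t where h: "h \<in> M" "f = (\<lambda>x. h x + t)" using L(3) unfolding affine_maps_def by blast
    obtain v u where vu: "obtuse v" "B = range v" "obtuse u" "B' = range u" using L(1,2) unfolding obtuse_superbases_eq by blast
    have "t = 0" using obtuse_translate_0[OF vu(1,3) lin[OF h(1)]] L(4) h(2) vu by blast
    then show ?thesis using h L(4) by auto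
  qed
  then show ?thesis unfolding equiv_by_def using mem_affine_maps by blast
qed

lemma inv_image_M: "h \<in> M \<Longrightarrow> inv h ` h ` A = A"
  using sub scaled_bij by (metis bij_is_inj image_inv_f_f subsetD)

lemma equiv_if_orbits:
  assumes "\<And>A B. (A, B) \<in> R \<longleftrightarrow> A \<in> S \<and> B \<in> S \<and> (\<exists>h\<in>M. h ` A = B)"
  shows "equiv S R"
proof (rule equivI)
  show "R \<subseteq> S \<times> S" using assms by auto
  show "refl_on S R" using assms id_mem by (auto simp: refl_on_def intro!: bexI[of _ id])
  show "sym R"
  proof (rule symI)
    fix A B assume "(A, B) \<in> R"
    then obtain h where h: "A \<in> S" "B \<in> S" "h \<in> M" "h ` A = B" by (auto simp: assms)
    then have "inv h \<in> M" "inv h ` B = A" using inv_mem inv_image_M by blast+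
    then show "(B, A) \<in> R" unfolding assms using h(1,2) by blast
  qed
  show "trans R"
  proof (rule transI)
    fix A B C assume "(A, B) \<in> R" "(B, C) \<in> R"
    then have "A \<in> S" "C \<in> S" "\<exists>h\<in>M. h ` A = B" "\<exists>g\<in>M. g ` B = C" by (auto simp: assms)
    then obtain h g where h: "h \<in> M" "h ` A = B" "g \<in> M" "g ` B = C" by blast
    then have "g \<circ> h \<in> M" "(g \<circ> h) ` A = C" using comp_mem by auto
    with \<open>A \<in> S\<close> \<open>C \<in> S\<close> show "(A, C) \<in> R" unfolding assms by blast
  qed
qed

lemma equiv_lattices: "equiv lattices (equiv_by (affine_maps M) lattices)"
  by (rule equiv_if_orbits) (rule equiv_lattices_iff)

lemma equiv_superbases: "equiv obtuse_superbases (equiv_by (affine_maps M) obtuse_superbases)"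
  by (rule equiv_if_orbits) (rule equiv_superbases_iff)

lemma int_span_image:
  assumes "h \<in> M" "obtuse v"
  shows "int_span (h ` range v) = h ` int_span (range v)" "h ` range v = range (h \<circ> v)" "obtuse (h \<circ> v)"
proof -
  have h: "h \<in> scaled O2" using assms(1) sub by blast
  show o: "obtuse (h \<circ> v)" by (rule obtuse_scaled[OF h assms(2)])
  show r: "h ` range v = range (h \<circ> v)" by (simp add: image_comp)
  show "int_span (h ` range v) = h ` int_span (range v)"
    unfolding r int_span_obtuse[OF o] int_span_obtuse[OF assms(2)] by (rule lat_scaled[OF h])
qed

text \<open>The union over all representatives collapses to one class, because equivalent superbases
  generate equivalent lattices.\<close>

lemma generated_class_eq:
  assumes "X \<in> superbase_space (affine_maps M)" "B \<in> X"
  shows "generated_class (affine_maps M) X = equiv_by (affine_maps M) lattices `` {int_span B}"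
proof -
  have "equiv_by (affine_maps M) lattices `` {int_span B'} = equiv_by (affine_maps M) lattices `` {int_span B}" if "B' \<in> X" for B'
  proof -
    have "(B, B') \<in> equiv_by (affine_maps M) obtuse_superbases"
      using assms that quotient_eq_iff[OF equiv_superbases] unfolding superbase_space_def by blast
    then obtain h v u where h: "h \<in> M" "h ` B = B'" "obtuse v" "B = range v" "obtuse u" "B' = range u"
      unfolding equiv_superbases_iff unfolding obtuse_superbases_eq by blast
    have "h ` int_span B = int_span B'" using int_span_image(1)[OF h(1,3)] h by simp
    then have "(int_span B, int_span B') \<in> equiv_by (affine_maps M) lattices"
      unfolding equiv_lattices_iff using h obtuse_lat int_span_obtuse by auto
    then show ?thesis using equiv_class_eq[OF equiv_lattices] by blast
  qed
  then show ?thesis unfolding generated_class_def using assms(2) by blast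
qed

lemma superbase_space_memD:
  assumes "X \<in> superbase_space (affine_maps M)" "B \<in> X"
  obtains v where "obtuse v" "range v = B" "X = equiv_by (affine_maps M) obtuse_superbases `` {B}"
proof -
  have "B \<in> obtuse_superbases"
    using assms in_quotient_imp_subset[OF equiv_superbases] unfolding superbase_space_def by blast
  moreover have "X = equiv_by (affine_maps M) obtuse_superbases `` {B}"
  proof -
    obtain C where C: "X = equiv_by (affine_maps M) obtuse_superbases `` {C}"
      using assms(1) unfolding superbase_space_def by (rule quotientE)
    then have "(C, B) \<in> equiv_by (affine_maps M) obtuse_superbases" using assms(2) by simp
    then show ?thesis unfolding C by (rule equiv_class_eq[OF equiv_superbases])
  qed
  ultimately show ?thesis using that unfolding obtuse_superbases_eq by blast
qed

lemma superbase_space_nonempty: "X \<in> superbase_space (affine_maps M) \<Longrightarrow> \<exists>B. B \<in> X"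
  using in_quotient_imp_non_empty[OF equiv_superbases] unfolding superbase_space_def by blast

lemma generated_class_lattice_space:
  "generated_class (affine_maps M) ` superbase_space (affine_maps M) \<subseteq> lattice_space (affine_maps M)"
proof (rule image_subsetI)
  fix X assume X: "X \<in> superbase_space (affine_maps M)"
  then obtain B where B: "B \<in> X" using superbase_space_nonempty by blast
  obtain v where v: "obtuse v" "range v = B" using superbase_space_memD[OF X B] .
  then have "int_span B \<in> lattices" using int_span_obtuse obtuse_lat by metis
  then show "generated_class (affine_maps M) X \<in> lattice_space (affine_maps M)"
    unfolding generated_class_eq[OF X B] lattice_space_def by (rule quotientI)
qed

text \<open>Surjectivity is existence of obtuse superbases. For injectivity, a map between the
  lattices is followed by the orthogonal map that uniqueness provides; the composite stays in
  \<open>M\<close> by the assumption on \<open>O2\<close>.\<close>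

lemma bij_generated_class:
  assumes "O2 \<subseteq> M"
  shows "bij_betw (generated_class (affine_maps M)) (superbase_space (affine_maps M)) (lattice_space (affine_maps M))"
  unfolding bij_betw_def
proof
  show "inj_on (generated_class (affine_maps M)) (superbase_space (affine_maps M))"
  proof (rule inj_onI)
    fix X Y assume X: "X \<in> superbase_space (affine_maps M)" and Y: "Y \<in> superbase_space (affine_maps M)"
      and eq: "generated_class (affine_maps M) X = generated_class (affine_maps M) Y"
    obtain B C where BC: "B \<in> X" "C \<in> Y" using X Y superbase_space_nonempty by metis
    obtain v where v: "obtuse v" "range v = B" "X = equiv_by (affine_maps M) obtuse_superbases `` {B}"
      by (rule superbase_space_memD[OF X BC(1)])
    obtain u where u: "obtuse u" "range u = C" "Y = equiv_by (affine_maps M) obtuse_superbases `` {C}"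
      by (rule superbase_space_memD[OF Y BC(2)])
    have "(lat v, lat u) \<in> equiv_by (affine_maps M) lattices"
      using eq u v int_span_obtuse obtuse_lat unfolding generated_class_eq[OF X BC(1)] generated_class_eq[OF Y BC(2)]
      by (metis eq_equiv_class equiv_lattices)
    then obtain h where h: "h \<in> M" "h ` lat v = lat u" unfolding equiv_lattices_iff by blast
    note hv = int_span_image[OF h(1) v(1)]
    have "lat u = lat (h \<circ> v)" using h lat_scaled sub by (metis subsetD)
    then obtain f where f: "f \<in> O2" "f ` range (h \<circ> v) = range u"
      using obtuse_unique_up_to_O2[OF hv(3) u(1)] by metis
    have "(f \<circ> h) ` B = C" using f(2) hv(2) u(2) v(2) by (metis image_comp)
    moreover have "f \<circ> h \<in> M" using f(1) h(1) assms comp_mem by blast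
    ultimately have "(B, C) \<in> equiv_by (affine_maps M) obtuse_superbases"
      unfolding equiv_superbases_iff unfolding obtuse_superbases_eq using u v by blast
    then show "X = Y" unfolding u(3) v(3) by (rule equiv_class_eq[OF equiv_superbases])
  qed
  show "generated_class (affine_maps M) ` superbase_space (affine_maps M) = lattice_space (affine_maps M)"
  proof (rule equalityI[OF generated_class_lattice_space], rule subsetI)
    fix Z assume "Z \<in> lattice_space (affine_maps M)"
    then obtain \<Lambda> where L: "\<Lambda> \<in> lattices" "Z = equiv_by (affine_maps M) lattices `` {\<Lambda>}"
      unfolding lattice_space_def by (rule quotientE)
    obtain v where v: "obtuse v" "lat v = \<Lambda>" using obtuse_superbase_exists[OF L(1)] .
    have B: "range v \<in> obtuse_superbases" unfolding obtuse_superbases_eq using v by blast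
    define X where "X = equiv_by (affine_maps M) obtuse_superbases `` {range v}"
    have X: "X \<in> superbase_space (affine_maps M)" unfolding X_def superbase_space_def using B by (rule quotientI)
    have "range v \<in> X" unfolding X_def by (rule equiv_class_self[OF equiv_superbases B])
    from generated_class_eq[OF X this] have "generated_class (affine_maps M) X = Z"
      using L v int_span_obtuse by simp
    then show "Z \<in> generated_class (affine_maps M) ` superbase_space (affine_maps M)" using X by blast
  qed
qed

end

text \<open>Takes a near-minimiser strictly below \<open>\<eta>\<close>. Its labelling of the first
  superbase is undone on both sides, so that \<open>v\<close> is kept and all relabelling is
  absorbed by \<open>u\<close>.\<close>

lemma min_deviation_lessE:
  assumes "obtuse v" "obtuse w" "id \<in> F" "min_deviation F (range v) (range w) < \<eta>"
  obtains f u where "f \<in> F" "obtuse u" "lat u = lat w" "range u = range w" "\<And>i. norm (f (u i) - v i) < \<eta>"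
proof -
  let ?S = "{Max (range (\<lambda>i::3. norm (f (u i) - v' i))) |f u v'. f \<in> F \<and> range v' = range v \<and> range u = range w}"
  have "?S \<noteq> {}" using assms(3) by blast
  then obtain d where "d \<in> ?S" "d < \<eta>"
  proof -
    have "Inf ?S < \<eta>" using assms(4) by (simp only: min_deviation_def)
    from cInf_lessD[OF \<open>?S \<noteq> {}\<close> this] show ?thesis using that by blast
  qed
  then obtain f u' v' where f: "f \<in> F" "range v' = range v" "range u' = range w"
    "Max (range (\<lambda>i::3. norm (f (u' i) - v' i))) < \<eta>"
    by blast
  obtain \<pi> where p: "bij \<pi>" "v' = v \<circ> \<pi>" by (rule relabel[OF obtuse_inj[OF assms(1)] f(2)])
  obtain \<rho> where r: "bij \<rho>" "u' = w \<circ> \<rho>" by (rule relabel[OF obtuse_inj[OF assms(2)] f(3)])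
  have ip: "bij (inv \<pi>)" by (rule bij_imp_bij_inv[OF p(1)])
  define u where "u = u' \<circ> inv \<pi>"
  have "obtuse u" "lat u = lat w"
    unfolding u_def r(2) using obtuse_comp_bij[OF ip obtuse_comp_bij[OF r(1) assms(2)]]
    by (simp_all only: lat_comp_bij[OF ip] lat_comp_bij[OF r(1)])
  moreover have "range u = range w"
    unfolding u_def using f(3) bij_is_surj[OF ip] by (metis fun.set_map)
  moreover have "norm (f (u i) - v i) < \<eta>" for i
  proof -
    have "norm (f (u' k) - v' k) < \<eta>" for k
      using f(4) by (simp add: Max_less_iff)
    from this[of "inv \<pi> i"] show ?thesis
      unfolding u_def p(2) by (simp add: surj_f_inv_f[OF bij_is_surj[OF p(1)]])
  qed
  ultimately show ?thesis using that f(1) by blast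
qed

text \<open>\<open>F\<close> measures distances and \<open>M\<close> defines classes. Keeping them
  apart covers similarity classes both with \<open>SIM\<close> and with \<open>SSM\<close>. The maps
  that bring superbases close disappear from \<open>e\<close> by its invariance, which leaves a
  purely local estimate.\<close>

lemma (in linear_group) continuous_generated_class:
  assumes F: "F \<subseteq> M" "id \<in> F"
    and inv: "\<And>g h \<Lambda> \<Lambda>'. \<lbrakk>g \<in> M; h \<in> M; \<Lambda> \<in> lattices; \<Lambda>' \<in> lattices\<rbrakk> \<Longrightarrow> e (g ` \<Lambda>) (h ` \<Lambda>') = e \<Lambda> \<Lambda>'"
    and loc: "\<And>v \<epsilon>. \<lbrakk>obtuse v; 0 < \<epsilon>\<rbrakk> \<Longrightarrow>
      \<exists>\<eta>>0. \<forall>u. obtuse u \<longrightarrow> (\<forall>i. norm (u i - v i) < \<eta>) \<longrightarrow> e (lat v) (lat u) < \<epsilon>"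
  shows "continuous_class_map (superbase_space (affine_maps M)) (min_deviation F) (lattice_space (affine_maps M)) e
    (generated_class (affine_maps M))"
  unfolding continuous_class_map_def
proof (intro conjI generated_class_lattice_space ballI allI impI)
  fix X B and \<epsilon> :: real
  assume X: "X \<in> superbase_space (affine_maps M)" "B \<in> X" and \<epsilon>: "0 < \<epsilon>"
  obtain v where v: "obtuse v" "range v = B" by (rule superbase_space_memD[OF X])
  obtain \<eta> where \<eta>: "\<eta> > 0" "\<And>u. obtuse u \<Longrightarrow> (\<And>i. norm (u i - v i) < \<eta>) \<Longrightarrow> e (lat v) (lat u) < \<epsilon>"
    using loc[OF v(1) \<epsilon>] by metis
  show "\<exists>\<eta>>0. \<forall>Y\<in>superbase_space (affine_maps M). \<forall>B'\<in>Y. min_deviation F B B' < \<eta> \<longrightarrow>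
    (\<forall>\<Lambda>\<in>generated_class (affine_maps M) X. \<forall>\<Lambda>'\<in>generated_class (affine_maps M) Y. e \<Lambda> \<Lambda>' < \<epsilon>)"
  proof (intro exI[of _ \<eta>] conjI \<eta>(1) ballI impI)
    fix Y B' \<Lambda> \<Lambda>'
    assume Y: "Y \<in> superbase_space (affine_maps M)" "B' \<in> Y" and d: "min_deviation F B B' < \<eta>"
      and L: "\<Lambda> \<in> generated_class (affine_maps M) X" "\<Lambda>' \<in> generated_class (affine_maps M) Y"
    obtain w where w: "obtuse w" "range w = B'" by (rule superbase_space_memD[OF Y])
    obtain f u where f: "f \<in> F" "obtuse u" "lat u = lat w" "\<And>i. norm (f (u i) - v i) < \<eta>"
      using min_deviation_lessE[OF v(1) w(1) F(2)] d v(2) w(2) by metis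
    have fM: "f \<in> M" using f(1) F(1) by blast
    obtain g where g: "g \<in> M" "g ` lat v = \<Lambda>"
      using L(1) v int_span_obtuse unfolding generated_class_eq[OF X] Image_singleton_iff equiv_lattices_iff by metis
    obtain h where h: "h \<in> M" "h ` lat w = \<Lambda>'"
      using L(2) w int_span_obtuse unfolding generated_class_eq[OF Y] Image_singleton_iff equiv_lattices_iff by metis
    have fu: "obtuse (f \<circ> u)" "lat (f \<circ> u) = f ` lat w"
      using obtuse_scaled[OF _ f(2)] lat_scaled f(3) fM sub by auto
    have "e \<Lambda> \<Lambda>' = e (lat v) (lat w)"
      using inv[OF g(1) h(1) obtuse_lat[OF v(1)] obtuse_lat[OF w(1)]] g h by simp
    also have "\<dots> = e (lat v) (lat (f \<circ> u))"
      using inv[OF id_mem fM obtuse_lat[OF v(1)] obtuse_lat[OF w(1)]] fu(2) by simp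
    also have "\<dots> < \<epsilon>" by (rule \<eta>(2)[OF fu(1)]) (simp add: f(4))
    finally show "e \<Lambda> \<Lambda>' < \<epsilon>" .
  qed
qed

section \<open>Chirality\<close>

lemma linear_line_reflection: "linear (line_reflection n 0)"
  unfolding line_reflection_def
  by (rule linearI) (simp_all add: inner_add_right algebra_simps)

lemma line_reflection_involution: "norm n = 1 \<Longrightarrow> line_reflection n 0 (line_reflection n 0 x) = x"
  by (simp add: line_reflection_def inner_diff_right dot_square_norm)

text \<open>The generators control the whole image, and the reverse inclusion follows because a
  reflection is an involution.\<close>

lemma lattice_sign_0I:
  assumes "norm n = 1" "\<And>k. line_reflection n 0 (v k) \<in> lat v"
  shows "lattice_sign (lat v) = 0"
proof -
  have "line_reflection n 0 ` lat v = lat (line_reflection n 0 \<circ> v)"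
    by (rule lat_linear_image[OF linear_line_reflection, symmetric])
  also have "\<dots> \<subseteq> lat v" by (rule lat_mono) (simp add: assms(2))
  finally have s: "line_reflection n 0 ` lat v \<subseteq> lat v" .
  moreover have "lat v \<subseteq> line_reflection n 0 ` lat v"
  proof
    fix x assume "x \<in> lat v"
    then have "line_reflection n 0 x \<in> lat v" using s by blast
    then show "x \<in> line_reflection n 0 ` lat v"
      using line_reflection_involution[OF assms(1), of x] by (metis imageI)
  qed
  ultimately have "line_reflection n 0 ` lat v = lat v" by blast
  then show ?thesis unfolding lattice_sign_def using assms(1) by auto
qed

text \<open>The mirror is the perpendicular bisector of \<open>x\<close> and \<open>y\<close>, which
  passes through 0 as their norms agree.\<close>

lemma swapping_reflection:
  fixes x y :: plane
  assumes "norm x = norm y" "x \<noteq> y"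
  obtains n where "norm n = 1" "line_reflection n 0 x = y" "line_reflection n 0 y = x"
    "\<And>z. z \<bullet> x = z \<bullet> y \<Longrightarrow> line_reflection n 0 z = z"
proof
  define n where "n = (1 / norm (x - y)) *\<^sub>R (x - y)"
  have p: "norm (x - y) > 0" using assms(2) by simp
  have r: "line_reflection n 0 z = z - (2 * ((x - y) \<bullet> z) / (norm (x - y))\<^sup>2) *\<^sub>R (x - y)" for z
    by (simp add: line_reflection_def n_def power2_eq_square)
  have e: "x \<bullet> x = y \<bullet> y" using assms(1) by (simp add: norm_eq)
  have d: "(norm (x - y))\<^sup>2 = 2 * ((x - y) \<bullet> x)" "(norm (x - y))\<^sup>2 = - (2 * ((x - y) \<bullet> y))"
    using e by (simp_all add: power2_norm_eq_inner inner_diff inner_commute)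
  show "norm n = 1" using p by (simp add: n_def)
  have "2 * ((x - y) \<bullet> x) / (norm (x - y))\<^sup>2 = 1" using d(1)[symmetric] p by simp
  then show "line_reflection n 0 x = y" by (simp only: r) simp
  have "2 * ((x - y) \<bullet> y) / (norm (x - y))\<^sup>2 = - 1"
  proof -
    have "2 * ((x - y) \<bullet> y) = - (norm (x - y))\<^sup>2" using d(2) by linarith
    then show ?thesis using p by simp
  qed
  then show "line_reflection n 0 y = x" by (simp only: r) simp
  show "line_reflection n 0 z = z" if "z \<bullet> x = z \<bullet> y" for z
    using that by (simp add: r inner_diff_left inner_commute[of z])
qed

lemma obtuse_neq_0: "obtuse v \<Longrightarrow> v k \<noteq> 0"
proof
  assume o: "obtuse v" and "v k = 0"
  then have "v k \<in> even_part (lat v)" unfolding even_part_def using lat_0[of v] by force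
  then show False using gen_not_even[OF obtuseD(1,2)[OF o]] by blast
qed

lemma obtuse_third: "obtuse v \<Longrightarrow> v k = - v (k + 1) - v (k + 2)"
  using obtuse_v0[of v] by (cases k rule: cases3) (simp_all add: arith3)

text \<open>A vanishing conorm means two orthogonal generators; the reflection that negates one of
  them fixes the other.\<close>

lemma lattice_sign_0_if_rectangular:
  assumes "obtuse v" "opp v k = 0"
  shows "lattice_sign (lat v) = 0"
proof -
  let ?a = "v (k + 1)" and ?b = "v (k + 2)"
  have ab: "?b \<bullet> ?a = 0" using assms(2) by (simp add: opp_def inner_commute)
  have "?a \<noteq> - ?a"
  proof
    assume "?a = - ?a"
    then have "2 *\<^sub>R ?a = 0" by (simp add: scaleR_2 eq_neg_iff_add_eq_0)
    then show False using obtuse_neq_0[OF assms(1)] by simp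
  qed
  then obtain n where n: "norm n = 1" "line_reflection n 0 ?a = - ?a"
    "\<And>z. z \<bullet> ?a = z \<bullet> - ?a \<Longrightarrow> line_reflection n 0 z = z"
    using swapping_reflection[of ?a "- ?a"] by (metis norm_minus_cancel)
  have b: "line_reflection n 0 ?b = ?b" by (rule n(3)) (simp add: ab)
  have c: "line_reflection n 0 (v k) = ?a - ?b"
    unfolding obtuse_third[OF assms(1), of k]
    by (simp add: linear_diff[OF linear_line_reflection] linear_neg[OF linear_line_reflection] n b)
  have "line_reflection n 0 (v j) \<in> lat v" for j
  proof -
    have "j = k \<or> j = k + 1 \<or> j = k + 2"
      by (cases j rule: cases3; cases k rule: cases3) (simp_all add: arith3)
    then show ?thesis using b c n(2) lat_gen[of v] lat_uminus lat_diff by metis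
  qed
  with n(1) show ?thesis by (rule lattice_sign_0I)
qed

text \<open>Equal conorms mean equal lengths. The reflection that swaps the two vectors fixes the
  third one, which is minus their sum.\<close>

lemma lattice_sign_0_if_isosceles:
  assumes "obtuse v" "i \<noteq> j" "opp v i = opp v j"
  shows "lattice_sign (lat v) = 0"
proof -
  have "v i \<noteq> v j" using obtuse_inj[OF assms(1)] assms(2) by (auto dest: injD)
  moreover have nn: "norm (v i) = norm (v j)"
    using assms(3) by (simp add: opp_eq_norms[OF obtuseD(1)[OF assms(1)]])
  ultimately obtain n where n: "norm n = 1" "line_reflection n 0 (v i) = v j" "line_reflection n 0 (v j) = v i"
    "\<And>z. z \<bullet> v i = z \<bullet> v j \<Longrightarrow> line_reflection n 0 z = z"
    using swapping_reflection by metis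
  have "line_reflection n 0 (v k) \<in> lat v" for k
  proof (cases "k = i \<or> k = j")
    case True
    then show ?thesis using n lat_gen by metis
  next
    case False
    then have "v k + (v i + v j) = 0"
      using assms(2) obtuseD(1)[OF assms(1)]
      by (cases i rule: cases3; cases j rule: cases3; cases k rule: cases3) (simp_all add: add_ac)
    then have "v k = - (v i + v j)" by (simp only: eq_neg_iff_add_eq_0)
    moreover have "(- (v i + v j)) \<bullet> v i = (- (v i + v j)) \<bullet> v j"
      using nn unfolding inner_minus_left inner_add_left norm_eq by (simp add: inner_commute)
    ultimately show ?thesis using n(4) lat_gen by metis
  qed
  with n(1) show ?thesis by (rule lattice_sign_0I)
qed

text \<open>Both the determinant and the product of differences change sign under transpositions of the
  labels, so their product does not depend on the labelling.\<close>
definition chirality :: "(3 \<Rightarrow> plane) \<Rightarrow> real" where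
  "chirality v = det2 (v 1) (v 2) * ((opp v 1 - opp v 2) * ((opp v 2 - opp v 0) * (opp v 1 - opp v 0)))"

lemma chirality_perm:
  fixes \<pi> :: "3 \<Rightarrow> 3"
  assumes "obtuse v" "bij \<pi>"
  shows "chirality (v \<circ> \<pi>) = chirality v"
  unfolding chirality_def opp_comp_bij[OF assms] comp_apply
  using assms(2) by (rule bij3_cases)
    (simp_all add: obtuse_v0[OF assms(1)] det2_bilinear det2_swap[of "v 1" "v 2"] algebra_simps)

text \<open>Conorms decrease with length, so for the labelling used in \<open>lattice_sign\<close>
  the three differences in \<open>chirality\<close> are positive.\<close>

lemma chirality_sign:
  assumes "obtuse v" "norm (v 1) < norm (v 2)" "norm (v 2) < norm (v 0)"
  shows "sgn (chirality v) = sgn (det2 (v 1) (v 2))"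
proof -
  have sq: "(norm (v 1))\<^sup>2 < (norm (v 2))\<^sup>2" "(norm (v 2))\<^sup>2 < (norm (v 0))\<^sup>2"
    using assms(2,3) by (auto intro: power_strict_mono)
  have "opp v 1 - opp v 2 > 0" "opp v 2 - opp v 0 > 0" "opp v 1 - opp v 0 > 0"
    using sq by (simp_all add: opp_eq_norms[OF obtuseD(1)[OF assms(1)]])
  then show ?thesis unfolding chirality_def by (simp add: sgn_mult)
qed

text \<open>A nonzero sign excludes zero and coinciding conorms. Hence the lengths can be strictly
  sorted, and two superbases differ by a permutation and a common sign, neither of which changes
  \<open>chirality\<close>.\<close>

lemma lattice_sign_eq:
  assumes "obtuse v" "lattice_sign (lat v) \<noteq> 0"
  shows "lattice_sign (lat v) = sgn (chirality v)"
proof -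
  have pos: "0 < opp v k" for k
    using lattice_sign_0_if_rectangular[OF assms(1)] assms(2) opp_nonneg[OF assms(1), of k] by (metis less_eq_real_def)
  have dist: "opp v i \<noteq> opp v j" if "i \<noteq> j" for i j
    using lattice_sign_0_if_isosceles[OF assms(1) that] assms(2) by blast
  have uniq: "sgn (det2 (w 1) (w 2)) = sgn (chirality v)"
    if w: "obtuse w" "lat w = lat v" "norm (w 1) < norm (w 2)" "norm (w 2) < norm (w 0)" for w
  proof -
    obtain \<sigma> e where s: "bij \<sigma>" "e = 1 \<or> e = (- 1 :: real)" "\<And>i. w (\<sigma> i) = e *\<^sub>R v i"
      by (rule obtuse_matching_sign[OF assms(1) w(1,2) pos]) blast
    have "w \<circ> \<sigma> = (\<lambda>i. e *\<^sub>R v i)" using s(3) by auto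
    then have "chirality w = chirality (\<lambda>i. e *\<^sub>R v i)" using chirality_perm[OF w(1) s(1)] by simp
    \<comment> \<open>Each factor is quadratic in the vectors, so a common sign cancels.\<close>
    also have "\<dots> = chirality v" using s(2) by (auto simp: chirality_def opp_def det2_bilinear)
    finally show ?thesis using chirality_sign[OF w(1,3,4)] by simp
  qed
  obtain \<pi> :: "3 \<Rightarrow> 3" where p: "bij \<pi>" "norm (v (\<pi> 1)) \<le> norm (v (\<pi> 2))" "norm (v (\<pi> 2)) \<le> norm (v (\<pi> 0))"
    by (rule ex_sorting)
  have ne: "norm (v (\<pi> i)) \<noteq> norm (v (\<pi> j))" if "i \<noteq> j" for i j
    using dist[of "\<pi> i" "\<pi> j"] that bij_is_inj[OF p(1)]
    by (auto simp: opp_eq_norms[OF obtuseD(1)[OF assms(1)]] dest: injD)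
  define w where "w = v \<circ> \<pi>"
  have w: "obtuse w" "lat w = lat v" "norm (w 1) < norm (w 2)" "norm (w 2) < norm (w 0)"
    using obtuse_comp_bij[OF p(1) assms(1)] lat_comp_bij[OF p(1)] p(2,3) ne[of 1 2] ne[of 2 0]
    unfolding w_def by (auto simp: ne3 less_le)
  have "lattice_sign (lat v) = (THE s. \<exists>w. labelled_obtuse_superbase w (lat v) \<and>
      norm (w 1) < norm (w 2) \<and> norm (w 2) < norm (w 0) \<and> s = sgn (det (vector [w 1, w 2] :: real^2^2)))"
    using assms(2) unfolding lattice_sign_def by presburger
  also have "\<dots> = sgn (chirality v)"
    by (rule the_equality)
      (use w uniq in \<open>auto simp: labelled_iff det2_eq_det[symmetric] intro!: exI[of _ w]\<close>)
  finally show ?thesis .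
qed

text \<open>The conorms prescribe the Gram matrix of \<open>w 1\<close> and \<open>w 2\<close>. With
  \<open>w 1\<close> on the first axis, the second coordinate of \<open>w 2\<close> is forced up to
  sign by the area \<open>sqrt S\<close> of the cell, as in \<open>det2_sq_opp\<close>.\<close>

lemma ex_obtuse_with_opp:
  assumes "\<And>k. 0 \<le> p k" "0 < p 0 * p 1 + p 1 * p 2 + p 2 * (p 0 :: real)"
  obtains w where "obtuse w" "opp w = p"
proof -
  define A S where "A = p 2 + p 0" and "S = p 0 * p 1 + p 1 * p 2 + p 2 * p 0"
  have "A \<noteq> 0"
  proof
    assume "A = 0"
    then have "p 2 = 0" "p 0 = 0" using assms(1)[of 2] assms(1)[of 0] by (simp_all add: A_def)
    then show False using assms(2) by simp
  qed
  then have A: "A > 0" using assms(1)[of 2] assms(1)[of 0] by (simp add: A_def)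
  have S: "S > 0" using assms(2) by (simp add: S_def)
  define a b :: plane where "a = vector [sqrt A, 0]" and "b = vector [- p 0 / sqrt A, sqrt S / sqrt A]"
  have aa: "a \<bullet> a = A" using A by (simp add: inner2 a_def vector_2)
  have ab: "a \<bullet> b = - p 0" using A by (simp add: inner2 a_def b_def vector_2)
  have "b \<bullet> b = ((p 0)\<^sup>2 + S) / A"
    using A S by (simp add: inner2 b_def vector_2 power2_eq_square add_divide_distrib)
  also have "(p 0)\<^sup>2 + S = (p 0 + p 1) * A" by (simp add: S_def A_def power2_eq_square algebra_simps)
  finally have bb: "b \<bullet> b = p 0 + p 1" using A by simp
  have d: "det2 a b \<noteq> 0" using A S by (simp add: det2_def a_def b_def vector_2)
  define w where "w k = (if k = 0 then - a - b else if k = 1 then a else b)" for k :: 3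
  have w: "w 0 = - a - b" "w 1 = a" "w 2 = b" by (simp_all add: w_def)
  have opp: "opp w k = p k" for k
    by (cases k rule: cases3)
      (use aa ab bb in \<open>simp_all add: opp_simps w inner_diff inner_commute A_def\<close>)
  have "w i \<bullet> w j \<le> 0" if "i \<noteq> j" for i j
  proof -
    have "w 1 \<bullet> w 2 \<le> 0" "w 2 \<bullet> w 0 \<le> 0" "w 0 \<bullet> w 1 \<le> 0"
      using opp[of 0] opp[of 1] opp[of 2] assms(1)[of 0] assms(1)[of 1] assms(1)[of 2] unfolding opp_simps by linarith+
    then show ?thesis using that by (cases i rule: cases3; cases j rule: cases3) (simp_all add: inner_commute)
  qed
  then have "obtuse w" unfolding obtuse_def using d by (simp add: w)
  then show ?thesis using that opp by blast
qed

text \<open>If the chiralities have opposite signs, then one of the four factors changes its sign and so is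
  small. A small determinant makes the smallest conorm small, and it is replaced by 0; if two conorms
  are close to each other, they are made equal.\<close>
lemma near_achiral:
  assumes "obtuse v" "obtuse u" "chirality v * chirality u < 0" "0 \<le> E"
    and close: "\<And>k. \<bar>opp u k - opp v k\<bar> \<le> E" "\<bar>det2 (u 1) (u 2) - det2 (v 1) (v 2)\<bar> \<le> E"
  obtains w where "obtuse w" "lattice_sign (lat w) = 0" "\<And>k. \<bar>opp w k - opp v k\<bar> \<le> 2 * E"
proof -
  note result = that
  note o = opp_nonneg[OF assms(1)]
  have "chirality v \<noteq> 0" using assms(3) by auto
  then have ne: "opp v 1 \<noteq> opp v 2" "opp v 2 \<noteq> opp v 0" "opp v 1 \<noteq> opp v 0" by (auto simp: chirality_def)
  have flip: thesis if ij: "i \<noteq> j" "(opp v i - opp v j) * (opp u i - opp u j) < 0" for i j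
  proof -
    have d: "\<bar>opp v i - opp v j\<bar> \<le> 2 * E"
      using close(1)[of i] close(1)[of j] ij(2) unfolding mult_less_0_iff abs_le_iff by linarith
    \<comment> \<open>Raising the smaller conorm to the larger moves it by at most
      \<open>2 * E\<close>. The common value is positive, which keeps the new superbase
      nondegenerate.\<close>
    define m where "m = max (opp v i) (opp v j)"
    define p where "p k = (if k = i \<or> k = j then m else opp v k)" for k
    have m: "m > 0" using o[of i] o[of j] ij(2) unfolding m_def by (cases "opp v i = opp v j") auto
    have p0: "0 \<le> p k" for k using o m by (simp add: p_def)
    have pij: "p i = m" "p j = m" by (simp_all add: p_def)
    have "0 < p i * p j" using m pij by simp
    then have "0 < p 0 * p 1 + p 1 * p 2 + p 2 * p 0"
      using ij(1) mult_nonneg_nonneg[OF p0[of 0] p0[of 1]] mult_nonneg_nonneg[OF p0[of 1] p0[of 2]]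
        mult_nonneg_nonneg[OF p0[of 2] p0[of 0]]
      by (cases i rule: cases3; cases j rule: cases3) (simp_all add: mult.commute)
    then obtain w where w: "obtuse w" "opp w = p" using ex_obtuse_with_opp p0 by metis
    have "lattice_sign (lat w) = 0"
      using lattice_sign_0_if_isosceles[OF w(1) ij(1)] w(2) pij by simp
    moreover have "\<bar>opp w k - opp v k\<bar> \<le> 2 * E" for k
      using d assms(4) unfolding w(2) p_def m_def by auto
    ultimately show thesis by (rule result[OF w(1)])
  qed
  \<comment> \<open>With conorm \<open>i\<close> set to 0, the product of the other two is all that
    keeps the superbase nondegenerate, so both must be positive.\<close>
  have small: thesis if i: "opp v i \<le> E" "\<And>j. j \<noteq> i \<Longrightarrow> opp v j > 0" for i
  proof -
    define p where "p k = (if k = i then 0 else opp v k)" for k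
    have p0: "0 \<le> p k" for k using o by (simp add: p_def)
    have "0 < p 0 * p 1 + p 1 * p 2 + p 2 * p 0"
      using i(2) by (cases i rule: cases3) (simp_all add: p_def ne3)
    then obtain w where w: "obtuse w" "opp w = p" using ex_obtuse_with_opp p0 by metis
    have "lattice_sign (lat w) = 0"
      by (rule lattice_sign_0_if_rectangular[OF w(1), of i]) (simp add: w(2) p_def)
    moreover have "\<bar>opp w k - opp v k\<bar> \<le> 2 * E" for k
      using i(1) o[of i] assms(4) unfolding w(2) p_def by auto
    ultimately show thesis by (rule result[OF w(1)])
  qed
  show thesis
  proof (cases "det2 (v 1) (v 2) * det2 (u 1) (u 2) < 0")
    case True
    then have "\<bar>det2 (v 1) (v 2)\<bar> \<le> E" using close(2) unfolding mult_less_0_iff abs_le_iff by linarith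
    then have "\<bar>det2 (v 1) (v 2)\<bar>\<^sup>2 \<le> E\<^sup>2" by (intro power_mono) auto
    then have d: "opp v 0 * opp v 1 + opp v 1 * opp v 2 + opp v 2 * opp v 0 \<le> E\<^sup>2"
      using det2_sq_opp[OF obtuseD(1)[OF assms(1)]] by simp
    \<comment> \<open>The square of the smallest conorm is at most its product with another one, and
      hence at most \<open>E\<^sup>2\<close>. The other two are positive as they are strictly
      larger.\<close>
    have key: thesis if ord: "opp v i < opp v j" "opp v i < opp v k" "opp v i * opp v j \<le> E\<^sup>2"
      "\<And>m. m = i \<or> m = j \<or> m = k" for i j k
    proof (rule small[of i])
      have "(opp v i)\<^sup>2 \<le> opp v i * opp v j"
        unfolding power2_eq_square using ord(1) o by (intro mult_left_mono) auto
      then have "(opp v i)\<^sup>2 \<le> E\<^sup>2" using ord(3) by linarith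
      then show "opp v i \<le> E" using assms(4) by (rule power2_le_imp_le)
      show "opp v m > 0" if "m \<noteq> i" for m
        using ord(4)[of m] that ord(1,2) o[of i] by auto
    qed
    have pp: "0 \<le> opp v 0 * opp v 1" "0 \<le> opp v 1 * opp v 2" "0 \<le> opp v 2 * opp v 0"
      using o by simp_all
    have all: "m = 0 \<or> m = 1 \<or> m = 2" for m :: 3 by (cases m rule: cases3) simp_all
    consider "opp v 0 < opp v 1" "opp v 0 < opp v 2" | "opp v 1 < opp v 2" "opp v 1 < opp v 0"
      | "opp v 2 < opp v 0" "opp v 2 < opp v 1"
      using ne by linarith
    then show thesis
    proof cases
      case 1
      then show thesis by (rule key) (use d pp all in \<open>linarith | blast\<close>)+
    next
      case 2
      then show thesis by (rule key) (use d pp all in \<open>linarith | blast\<close>)+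
    next
      case 3
      then show thesis by (rule key) (use d pp all in \<open>linarith | blast\<close>)+
    qed
  next
    case False
    \<comment> \<open>If no difference changed its sign, pairing the factors of the two chiralities
      would give a product of nonnegative numbers.\<close>
    have "\<exists>i j. i \<noteq> j \<and> (opp v i - opp v j) * (opp u i - opp u j) < 0"
    proof (rule ccontr)
      assume "\<not> ?thesis"
      then have nn: "0 \<le> (opp v i - opp v j) * (opp u i - opp u j)" if "i \<noteq> j" for i j
        using that by (meson not_le)
      have "chirality v * chirality u = (det2 (v 1) (v 2) * det2 (u 1) (u 2)) *
        (((opp v 1 - opp v 2) * (opp u 1 - opp u 2)) * (((opp v 2 - opp v 0) * (opp u 2 - opp u 0)) *
          ((opp v 1 - opp v 0) * (opp u 1 - opp u 0))))"
        by (simp add: chirality_def mult_ac)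
      also have "\<dots> \<ge> 0"
        by (rule mult_nonneg_nonneg[OF _ mult_nonneg_nonneg[OF nn mult_nonneg_nonneg[OF nn nn]]])
          (use False in \<open>simp_all add: ne3\<close>)
      finally show False using assms(3) by simp
    qed
    then show thesis using flip by blast
  qed
qed

section \<open>Estimates for the oriented metrics\<close>

lemma det2_close:
  assumes "norm (a - c) \<le> \<delta>" "norm (b - d) \<le> \<delta>" "norm b \<le> L" "norm c \<le> L"
  shows "\<bar>det2 a b - det2 c d\<bar> \<le> 2 * L * \<delta>"
proof -
  have "det2 a b - det2 c d = det2 (a - c) b + det2 c (b - d)" by (simp add: det2_bilinear)
  moreover have "\<bar>det2 (a - c) b\<bar> \<le> \<delta> * L"
    by (rule order_trans[OF abs_det2_le]) (intro mult_mono assms; use assms norm_ge_zero order_trans in blast)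
  moreover have "\<bar>det2 c (b - d)\<bar> \<le> L * \<delta>"
    by (rule order_trans[OF abs_det2_le]) (intro mult_mono assms; use assms norm_ge_zero order_trans in blast)
  ultimately show ?thesis by (simp add: algebra_simps)
qed

lemma oriented_metric_le:
  assumes d0: "\<And>x y. 0 \<le> d x y"
    and same: "d \<Lambda> \<Lambda>' \<le> K"
    and opposite: "lattice_sign \<Lambda> * lattice_sign \<Lambda>' < 0 \<Longrightarrow>
      \<exists>\<Lambda>3\<in>lattices. lattice_sign \<Lambda>3 = 0 \<and> d \<Lambda> \<Lambda>3 + d \<Lambda>' \<Lambda>3 \<le> K"
  shows "oriented_metric d \<Lambda> \<Lambda>' \<le> K"
proof (cases "lattice_sign \<Lambda> * lattice_sign \<Lambda>' \<ge> 0")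
  case False
  then obtain \<Lambda>3 where L: "\<Lambda>3 \<in> lattices" "lattice_sign \<Lambda>3 = 0" "d \<Lambda> \<Lambda>3 + d \<Lambda>' \<Lambda>3 \<le> K" using opposite by auto
  have "(INF \<Lambda>3\<in>{\<Lambda>3 \<in> lattices. lattice_sign \<Lambda>3 = 0}. d \<Lambda> \<Lambda>3 + d \<Lambda>' \<Lambda>3) \<le> d \<Lambda> \<Lambda>3 + d \<Lambda>' \<Lambda>3"
    by (rule cINF_lower) (use L d0 in \<open>auto intro!: bdd_belowI[of _ 0] add_nonneg_nonneg\<close>)
  then show ?thesis using False L(3) by (simp add: oriented_metric_def)
qed (use same in \<open>simp add: oriented_metric_def\<close>)

text \<open>The hexagonal lattice, with all conorms equal to 1, shows that the infimum runs over a
  nonempty set.\<close>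

lemma oriented_metric_nonneg:
  assumes d0: "\<And>x y. 0 \<le> d x y"
  shows "0 \<le> oriented_metric d \<Lambda> \<Lambda>'"
proof -
  obtain w where w: "obtuse w" "opp w = (\<lambda>_. 1)" using ex_obtuse_with_opp[of "\<lambda>_. 1"] by auto
  then have "lattice_sign (lat w) = 0" using lattice_sign_0_if_isosceles[OF w(1), of 0 1] by simp
  then have "{\<Lambda>3 \<in> lattices. lattice_sign \<Lambda>3 = 0} \<noteq> {}" using obtuse_lat[OF w(1)] by blast
  then have "0 \<le> (INF \<Lambda>3\<in>{\<Lambda>3 \<in> lattices. lattice_sign \<Lambda>3 = 0}. d \<Lambda> \<Lambda>3 + d \<Lambda>' \<Lambda>3)"
    by (rule cINF_greatest) (simp add: d0)
  then show ?thesis by (simp add: oriented_metric_def d0)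
qed

lemma RM_nonneg: "0 \<le> RM q \<Lambda> \<Lambda>'" and PM_nonneg: "0 \<le> PM q \<Lambda> \<Lambda>'"
  by (simp_all add: RM_def PM_def minkowski_norm_nonneg)

text \<open>Conorms and determinant both change by at most \<open>2 * L * \<delta>\<close>;
  \<open>near_achiral\<close> doubles this to \<open>4 * L * \<delta>\<close>.\<close>

lemma near_achiral_lattice:
  assumes "obtuse v" "obtuse u" "lattice_sign (lat v) * lattice_sign (lat u) < 0"
    and close: "\<And>i. norm (u i - v i) \<le> \<delta>" "\<And>i. norm (v i) \<le> L" "\<And>i. norm (u i) \<le> L"
  obtains w where "obtuse w" "lattice_sign (lat w) = 0"
    "\<And>k. \<bar>RI (lat v) $ k - RI (lat w) $ k\<bar> \<le> sqrt (4 * L * \<delta>)"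
proof -
  have "sgn (chirality v * chirality u) < 0"
    using assms(3) lattice_sign_eq[OF assms(1)] lattice_sign_eq[OF assms(2)] unfolding sgn_mult
    by (metis mult_zero_left mult_zero_right less_irrefl)
  then have c: "chirality v * chirality u < 0" by (simp only: sgn_less)
  have L: "0 \<le> L" using close(2)[of 0] norm_ge_zero order_trans by blast
  have \<delta>: "0 \<le> \<delta>" using close(1)[of 0] norm_ge_zero order_trans by blast
  have "\<bar>det2 (u 1) (u 2) - det2 (v 1) (v 2)\<bar> \<le> 2 * L * \<delta>" by (intro det2_close close)
  then obtain w where w: "obtuse w" "lattice_sign (lat w) = 0" "\<And>k. \<bar>opp w k - opp v k\<bar> \<le> 2 * (2 * L * \<delta>)"
    using near_achiral[OF assms(1,2) c _ opp_close[OF close]] L \<delta> by auto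
  have "\<bar>RI (lat v) $ k - RI (lat w) $ k\<bar> \<le> sqrt (4 * L * \<delta>)" for k
  proof (rule diff_le_sqrt)
    have "\<bar>sorted3 (opp v) $ k - sorted3 (opp w) $ k\<bar> \<le> 2 * (2 * L * \<delta>)"
      by (rule sorted3_close) (use w(3) in \<open>simp add: abs_minus_commute\<close>)
    then show "\<bar>(RI (lat v) $ k)\<^sup>2 - (RI (lat w) $ k)\<^sup>2\<bar> \<le> 4 * L * \<delta>"
      by (simp add: RI_sq[OF assms(1)] RI_sq[OF w(1)])
  qed (use RI_props(1) assms(1) w(1) in auto)
  then show ?thesis using that w by blast
qed

lemma RI_close:
  assumes "obtuse v" "obtuse u" "\<And>i. norm (u i - v i) \<le> \<delta>" "\<And>i. norm (v i) \<le> L" "\<And>i. norm (u i) \<le> L"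
  shows "\<bar>RI (lat v) $ k - RI (lat u) $ k\<bar> \<le> sqrt (2 * L * \<delta>)"
  by (rule diff_le_sqrt[OF _ _ RI_sq_close[OF assms]]) (use RI_props(1) assms(1,2) in auto)

lemma RM_close:
  assumes "1 \<le> q" "\<And>k. \<bar>RI \<Lambda> $ k - RI \<Lambda>' $ k\<bar> \<le> e"
  shows "RM q \<Lambda> \<Lambda>' \<le> 3 * e"
  using minkowski_norm_le_coarse[OF assms(1), of "RI \<Lambda> - RI \<Lambda>'" e] assms(2) by (simp add: RM_def)

lemma PM_close:
  assumes "1 \<le> q" "\<And>k. \<bar>PI \<Lambda> $ k - PI \<Lambda>' $ k\<bar> \<le> e"
  shows "PM q \<Lambda> \<Lambda>' \<le> 2 * e"
  using minkowski_norm_le_coarse[OF assms(1), of "PI \<Lambda> - PI \<Lambda>'" e] assms(2) by (simp add: PM_def)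

text \<open>The achiral lattice is within \<open>e\<close> of the first lattice and so within
  \<open>2 * e\<close> of the second, which gives \<open>3 * e + 6 * e\<close>. For
  \<open>PI\<close> the unit is \<open>c\<close>, four times \<open>e\<close> over the sum of roots,
  and two coordinates give \<open>2 * c + 4 * c\<close>.\<close>

lemma oriented_close:
  assumes q: "1 \<le> q" and o: "obtuse v" "obtuse u"
    and close: "\<And>i. norm (u i - v i) \<le> \<delta>" "\<And>i. norm (v i) \<le> L" "\<And>i. norm (u i) \<le> L"
  shows "RMo q (lat v) (lat u) \<le> 9 * sqrt (4 * L * \<delta>)"
    and "PMo q (lat v) (lat u) \<le> 24 * sqrt (4 * L * \<delta>) / (RI (lat v) $ 1 + RI (lat v) $ 2 + RI (lat v) $ 3)"
proof -
  have L: "0 \<le> L" using close(2)[of 0] norm_ge_zero order_trans by blast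
  have \<delta>: "0 \<le> \<delta>" using close(1)[of 0] norm_ge_zero order_trans by blast
  define e where "e = sqrt (4 * L * \<delta>)"
  have e0: "0 \<le> e" using L \<delta> by (simp add: e_def)
  have "sqrt (2 * L * \<delta>) \<le> e" unfolding e_def using L \<delta> by (simp add: mult_right_mono)
  then have uv: "\<bar>RI (lat v) $ k - RI (lat u) $ k\<bar> \<le> e" for k
    using RI_close[OF o close] by (meson order_trans)
  have ach: "\<exists>w. obtuse w \<and> lattice_sign (lat w) = 0 \<and> (\<forall>k. \<bar>RI (lat v) $ k - RI (lat w) $ k\<bar> \<le> e)"
    if "lattice_sign (lat v) * lattice_sign (lat u) < 0"
    using near_achiral_lattice[OF o that close] unfolding e_def by metis
  have "RMo q (lat v) (lat u) \<le> 9 * e"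
    unfolding RMo_def
  proof (rule oriented_metric_le[OF RM_nonneg])
    show "RM q (lat v) (lat u) \<le> 9 * e" using RM_close[OF q uv] e0 by linarith
    assume "lattice_sign (lat v) * lattice_sign (lat u) < 0"
    then obtain w where w: "obtuse w" "lattice_sign (lat w) = 0" "\<And>k. \<bar>RI (lat v) $ k - RI (lat w) $ k\<bar> \<le> e"
      using ach by blast
    have uw: "\<bar>RI (lat u) $ k - RI (lat w) $ k\<bar> \<le> 2 * e" for k
      using uv[of k] w(3)[of k] by linarith
    then have "RM q (lat v) (lat w) + RM q (lat u) (lat w) \<le> 9 * e"
      using RM_close[OF q w(3)] RM_close[OF q, OF uw] by linarith
    then show "\<exists>\<Lambda>3\<in>lattices. lattice_sign \<Lambda>3 = 0 \<and> RM q (lat v) \<Lambda>3 + RM q (lat u) \<Lambda>3 \<le> 9 * e"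
      using w(2) obtuse_lat[OF w(1)] by blast
  qed
  then show "RMo q (lat v) (lat u) \<le> 9 * sqrt (4 * L * \<delta>)" by (simp only: e_def)
  define c where "c = 4 * e / (RI (lat v) $ 1 + RI (lat v) $ 2 + RI (lat v) $ 3)"
  have c0: "0 \<le> c" unfolding c_def using e0 RI_props(6)[OF o(1)] by simp
  note PI_uv = PI_close[OF o uv, folded c_def]
  have "PMo q (lat v) (lat u) \<le> 6 * c"
    unfolding PMo_def
  proof (rule oriented_metric_le[OF PM_nonneg])
    show "PM q (lat v) (lat u) \<le> 6 * c" using PM_close[OF q PI_uv] c0 by linarith
    assume "lattice_sign (lat v) * lattice_sign (lat u) < 0"
    then obtain w where w: "obtuse w" "lattice_sign (lat w) = 0" "\<And>k. \<bar>RI (lat v) $ k - RI (lat w) $ k\<bar> \<le> e"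
      using ach by blast
    note PI_vw = PI_close[OF o(1) w(1,3), folded c_def]
    have uw: "\<bar>PI (lat u) $ k - PI (lat w) $ k\<bar> \<le> 2 * c" for k using PI_uv[of k] PI_vw[of k] by linarith
    then have "PM q (lat v) (lat w) + PM q (lat u) (lat w) \<le> 6 * c"
      using PM_close[OF q PI_vw] PM_close[OF q, OF uw] by linarith
    then show "\<exists>\<Lambda>3\<in>lattices. lattice_sign \<Lambda>3 = 0 \<and> PM q (lat v) \<Lambda>3 + PM q (lat u) \<Lambda>3 \<le> 6 * c"
      using w(2) obtuse_lat[OF w(1)] by blast
  qed
  then show "PMo q (lat v) (lat u) \<le> 24 * sqrt (4 * L * \<delta>) / (RI (lat v) $ 1 + RI (lat v) $ 2 + RI (lat v) $ 3)"
    by (simp add: e_def c_def)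
qed

section \<open>Invariance of the sign and of the oriented metrics\<close>

lemma scaled_SO2E:
  assumes "h \<in> scaled SO2"
  obtains s f where "s > 0" "h = (\<lambda>x. s *\<^sub>R f x)" "f \<in> SO2" "linear f"
    "\<And>x y. f x \<bullet> f y = x \<bullet> y" "\<And>x. norm (f x) = norm x" "\<And>x y. det2 (f x) (f y) = det2 x y"
proof -
  obtain s f where h: "h = (\<lambda>x. s *\<^sub>R f x)" "s > 0" "f \<in> SO2" using assms unfolding scaled_def by blast
  have o: "orthogonal_transformation f" "det (matrix f) = 1" using h(3) by (simp_all add: SO2_def)
  have l: "linear f" by (rule orthogonal_transformation_linear[OF o(1)])
  show ?thesis
    using that[OF h(2,1,3) l] o det2_linear[OF l]
    by (simp add: orthogonal_transformation_def orthogonal_transformation_norm)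
qed

text \<open>Both ingredients of the definition are carried along by every map of the group; applying
  this to the inverse map yields equivalences.\<close>

lemma lattice_sign_scaled_SO2:
  assumes "h \<in> scaled SO2"
  shows "lattice_sign (h ` \<Lambda>) = lattice_sign \<Lambda>"
proof -
  interpret linear_group "scaled SO2" by (rule linear_group_scaled[OF linear_group_SO2 SO2_O2])
  define symmetric where "symmetric \<Lambda> \<longleftrightarrow> (\<exists>n c. norm n = 1 \<and> line_reflection n c ` \<Lambda> = \<Lambda>)" for \<Lambda> :: "plane set"
  define orient where "orient \<Lambda> s \<longleftrightarrow> (\<exists>v. labelled_obtuse_superbase v \<Lambda> \<and>
             norm (v 1) < norm (v 2) \<and> norm (v 2) < norm (v 0) \<and>
             s = sgn (det (vector [v 1, v 2] :: real^2^2)))" for \<Lambda> s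
  have imp: "(symmetric \<Lambda> \<longrightarrow> symmetric (g ` \<Lambda>)) \<and> (orient \<Lambda> s \<longrightarrow> orient (g ` \<Lambda>) s)" if g: "g \<in> scaled SO2" for g \<Lambda> s
  proof -
    obtain a f where f: "a > 0" "g = (\<lambda>x. a *\<^sub>R f x)" "f \<in> SO2" "linear f"
      "\<And>x y. f x \<bullet> f y = x \<bullet> y" "\<And>x. norm (f x) = norm x" "\<And>x y. det2 (f x) (f y) = det2 x y"
      by (rule scaled_SO2E[OF g]) blast
    have gO: "g \<in> scaled O2" using g sub by blast
    \<comment> \<open>Conjugation of a reflection by a similarity turns the normal and scales the
      offset.\<close>
    have "line_reflection (f n) (a * c) (g x) = g (line_reflection n c x)" for n c x
      by (simp add: line_reflection_def f(2,5) linear_diff[OF f(4)] linear_add[OF f(4)] linear_cmul[OF f(4)] algebra_simps)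
    then have "line_reflection (f n) (a * c) ` g ` \<Lambda> = g ` line_reflection n c ` \<Lambda>" for n c
      by (simp add: image_image)
    then have 1: "symmetric \<Lambda> \<longrightarrow> symmetric (g ` \<Lambda>)" unfolding symmetric_def using f(6) by metis
    have "orient (g ` \<Lambda>) s" if ori: "orient \<Lambda> s"
    proof -
      obtain v where v: "obtuse v" "\<Lambda> = lat v" "norm (v 1) < norm (v 2)" "norm (v 2) < norm (v 0)"
        "s = sgn (det2 (v 1) (v 2))"
        using ori unfolding orient_def labelled_iff det2_eq_det by blast
      have "sgn (det2 (g (v 1)) (g (v 2))) = s"
        using f(1) by (simp add: f(2,7) det2_bilinear sgn_mult v(5))
      moreover have "norm (g x) = a * norm x" for x using f(1) by (simp add: f(2,6))
      ultimately show ?thesis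
        unfolding orient_def labelled_iff det2_eq_det[symmetric]
        using v obtuse_scaled[OF gO v(1)] lat_scaled[OF gO, of v] f(1)
        by (intro exI[of _ "g \<circ> v"]) simp
    qed
    with 1 show ?thesis by blast
  qed
  have hh: "inv h ` h ` \<Lambda> = \<Lambda>" by (rule inv_image_M[OF assms])
  have "symmetric (h ` \<Lambda>) \<longleftrightarrow> symmetric \<Lambda>" "orient (h ` \<Lambda>) = orient \<Lambda>"
    using imp[OF assms, of \<Lambda>] imp[OF inv_mem[OF assms], of "h ` \<Lambda>"] unfolding hh by blast+
  moreover have "lattice_sign \<Lambda> = (if symmetric \<Lambda> then 0 else The (orient \<Lambda>))" for \<Lambda>
    unfolding lattice_sign_def symmetric_def orient_def ..
  ultimately show ?thesis by simp
qed

text \<open>The intermediate lattice is not moved, so the two infima agree term by term.\<close>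

lemma oriented_metric_invariant:
  assumes "g \<in> scaled SO2" "h \<in> scaled SO2" "\<Lambda> \<in> lattices" "\<Lambda>' \<in> lattices"
    and d: "\<And>\<Lambda>3. \<Lambda>3 \<in> lattices \<Longrightarrow> d (g ` \<Lambda>) \<Lambda>3 = d \<Lambda> \<Lambda>3" "\<And>\<Lambda>3. \<Lambda>3 \<in> lattices \<Longrightarrow> d (h ` \<Lambda>') \<Lambda>3 = d \<Lambda>' \<Lambda>3"
      "d (g ` \<Lambda>) (h ` \<Lambda>') = d \<Lambda> \<Lambda>'"
  shows "oriented_metric d (g ` \<Lambda>) (h ` \<Lambda>') = oriented_metric d \<Lambda> \<Lambda>'"
proof -
  have "(INF \<Lambda>3\<in>{\<Lambda>3 \<in> lattices. lattice_sign \<Lambda>3 = 0}. d (g ` \<Lambda>) \<Lambda>3 + d (h ` \<Lambda>') \<Lambda>3)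
    = (INF \<Lambda>3\<in>{\<Lambda>3 \<in> lattices. lattice_sign \<Lambda>3 = 0}. d \<Lambda> \<Lambda>3 + d \<Lambda>' \<Lambda>3)"
    by (rule INF_cong) (simp_all add: d)
  then show ?thesis
    unfolding oriented_metric_def lattice_sign_scaled_SO2[OF assms(1)] lattice_sign_scaled_SO2[OF assms(2)] d(3)
    by simp
qed

lemma SO2_scaled: "SO2 \<subseteq> scaled SO2"
  unfolding scaled_def by (auto intro!: exI[of _ "1::real"])

lemma RMo_invariant:
  assumes "g \<in> SO2" "h \<in> SO2" "\<Lambda> \<in> lattices" "\<Lambda>' \<in> lattices"
  shows "RMo q (g ` \<Lambda>) (h ` \<Lambda>') = RMo q \<Lambda> \<Lambda>'"
  unfolding RMo_def using assms SO2_O2 SO2_scaled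
  by (intro oriented_metric_invariant) (auto simp: RM_def RI_O2 subset_iff)

lemma PMo_invariant:
  assumes "g \<in> scaled SO2" "h \<in> scaled SO2" "\<Lambda> \<in> lattices" "\<Lambda>' \<in> lattices"
  shows "PMo q (g ` \<Lambda>) (h ` \<Lambda>') = PMo q \<Lambda> \<Lambda>'"
  unfolding PMo_def using assms scaled_mono[OF SO2_O2]
  by (intro oriented_metric_invariant) (auto simp: PM_def PI_scaled_O2 subset_iff)

lemma ex_sqrt_small:
  fixes K \<epsilon> c :: real
  assumes "0 < \<epsilon>" "0 < c"
  obtains \<eta> where "0 < \<eta>" "\<eta> \<le> c" "K * sqrt \<eta> < \<epsilon>"
proof
  define a where "a = \<epsilon> / (\<bar>K\<bar> + 1)"
  have a: "a > 0" using assms(1) by (simp add: a_def add_nonneg_pos)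
  define \<eta> where "\<eta> = min c (a\<^sup>2)"
  show \<eta>: "0 < \<eta>" "\<eta> \<le> c" using a assms(2) by (simp_all add: \<eta>_def)
  have "sqrt \<eta> \<le> sqrt (a\<^sup>2)" unfolding \<eta>_def by (intro real_sqrt_le_mono) simp
  then have sq: "sqrt \<eta> \<le> a" using a by simp
  have "K * sqrt \<eta> \<le> \<bar>K\<bar> * a" using sq \<eta>(1) by (intro mult_mono) auto
  also have "\<dots> < (\<bar>K\<bar> + 1) * a" using a by simp
  also have "\<dots> = \<epsilon>" unfolding a_def by simp
  finally show "K * sqrt \<eta> < \<epsilon>" .
qed

section \<open>Continuity\<close>

lemma local_bound:
  assumes bound: "\<And>u \<delta>. \<lbrakk>obtuse u; 0 \<le> \<delta>; \<delta> \<le> 1; \<And>i. norm (u i - v i) \<le> \<delta>\<rbrakk> \<Longrightarrow> e (lat v) (lat u) \<le> K * sqrt \<delta>"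
    and "0 < (\<epsilon> :: real)"
  shows "\<exists>\<eta>>0. \<forall>u. obtuse u \<longrightarrow> (\<forall>i. norm (u i - v i) < \<eta>) \<longrightarrow> e (lat v) (lat u) < \<epsilon>"
proof -
  obtain \<eta> where \<eta>: "0 < \<eta>" "\<eta> \<le> 1" "K * sqrt \<eta> < \<epsilon>"
    using ex_sqrt_small[OF assms(2) zero_less_one] by blast
  have "e (lat v) (lat u) \<le> K * sqrt \<eta>" if "obtuse u" "\<And>i. norm (u i - v i) < \<eta>" for u
    using bound[OF that(1), of \<eta>] \<eta> that(2) by (simp add: less_imp_le)
  then show ?thesis using \<eta>(1,3) by (meson le_less_trans)
qed

text \<open>Restricting to deviations of at most 1 gives one length bound for all superbases near
  \<open>v\<close>, so that the constants below depend on \<open>v\<close> only.\<close>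

lemma uniform_norm_bound:
  fixes v :: "3 \<Rightarrow> plane"
  obtains L where "\<And>i. norm (v i) \<le> L" "\<And>u \<delta> i. \<lbrakk>\<delta> \<le> 1; \<And>i. norm (u i - v i) \<le> \<delta>\<rbrakk> \<Longrightarrow> norm (u i) \<le> L"
proof
  define L where "L = norm (v 0) + norm (v 1) + norm (v 2) + 1"
  have b: "norm (v i) \<le> L - 1" for i by (cases i rule: cases3) (simp_all add: L_def)
  show "norm (v i) \<le> L" for i using b[of i] by simp
  show "norm (u i) \<le> L" if "\<delta> \<le> 1" "\<And>i. norm (u i - v i) \<le> \<delta>" for u :: "3 \<Rightarrow> plane" and \<delta> i
    using b[of i] that(1) that(2)[of i] norm_triangle_ineq2[of "u i" "v i"] by linarith
qed

lemma local_continuity: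
  assumes q: "1 \<le> q" and v: "obtuse v" and "0 < \<epsilon>"
    and e: "e = RM q \<or> e = PM q \<or> e = RMo q \<or> e = PMo q"
  shows "\<exists>\<eta>>0. \<forall>u. obtuse u \<longrightarrow> (\<forall>i. norm (u i - v i) < \<eta>) \<longrightarrow> e (lat v) (lat u) < \<epsilon>"
proof -
  obtain L where L: "\<And>i. norm (v i) \<le> L"
    "\<And>u \<delta> i. \<lbrakk>\<delta> \<le> 1; \<And>i. norm (u i - v i) \<le> \<delta>\<rbrakk> \<Longrightarrow> norm (u i) \<le> L"
    using uniform_norm_bound[of v] by blast
  have L0: "0 \<le> L" using L(1)[of 0] norm_ge_zero order_trans by blast
  define s where "s = RI (lat v) $ 1 + RI (lat v) $ 2 + RI (lat v) $ 3"
  have s: "s > 0" unfolding s_def by (rule RI_props(6)[OF v])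
  \<comment> \<open>Chosen to dominate both \<open>9 * r\<close> and \<open>24 * r / s\<close> for
    \<open>r = sqrt (4 * L * \<delta>)\<close>.\<close>
  define K where "K = (9 + 24 / s) * sqrt (4 * L)"
  show ?thesis
  proof (rule local_bound[OF _ \<open>0 < \<epsilon>\<close>])
    fix u \<delta> assume u: "obtuse u" "0 \<le> \<delta>" "\<delta> \<le> 1" "\<And>i. norm (u i - v i) \<le> \<delta>"
    have nu: "norm (u i) \<le> L" for i by (rule L(2)[OF u(3,4)])
    define r where "r = sqrt (4 * L * \<delta>)"
    have r0: "0 \<le> r" unfolding r_def using L0 u(2) by simp
    have "sqrt (2 * L * \<delta>) \<le> r" unfolding r_def using L0 u(2) by (simp add: mult_right_mono)
    then have R: "\<bar>RI (lat v) $ k - RI (lat u) $ k\<bar> \<le> r" for k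
      using RI_close[OF v u(1) u(4) L(1) nu] by (meson order_trans)
    have "RM q (lat v) (lat u) \<le> 9 * r" using RM_close[OF q R] r0 by linarith
    moreover have "RMo q (lat v) (lat u) \<le> 9 * r"
      unfolding r_def by (rule oriented_close(1)[OF q v u(1) u(4) L(1) nu])
    moreover have "PMo q (lat v) (lat u) \<le> 24 * r / s"
      unfolding r_def s_def by (rule oriented_close(2)[OF q v u(1) u(4) L(1) nu])
    moreover have "PM q (lat v) (lat u) \<le> 24 * r / s"
    proof -
      have "PM q (lat v) (lat u) \<le> 2 * (4 * r / s)"
        unfolding s_def by (rule PM_close[OF q PI_close[OF v u(1) R]])
      also have "\<dots> \<le> 24 * r / s" using r0 s by (simp add: field_simps)
      finally show ?thesis .
    qed
    moreover have "9 * r \<le> K * sqrt \<delta>" "24 * r / s \<le> K * sqrt \<delta>"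
      using r0 s by (simp_all add: K_def r_def real_sqrt_mult field_simps)
    ultimately show "e (lat v) (lat u) \<le> K * sqrt \<delta>" using e by auto
  qed
qed

section \<open>Bounds in terms of \<open>SIM\<close> and \<open>SIMo\<close>\<close>

lemma SIM_RI_sq:
  assumes "obtuse v" "obtuse w" "\<And>i. norm (v i) \<le> l" "\<And>i. norm (w i) \<le> l"
  shows "\<bar>(RI (lat v) $ k)\<^sup>2 - (RI (lat w) $ k)\<^sup>2\<bar> \<le> 2 * l * SIM (range v) (range w)"
proof -
  have l: "0 < l"
    using assms(3)[of 0] obtuse_neq_0[OF assms(1), of 0] by (meson less_le_trans zero_less_norm_iff)
  have b: "\<bar>(RI (lat v) $ k)\<^sup>2 - (RI (lat w) $ k)\<^sup>2\<bar> / (2 * l) \<le> \<eta>" if "SIM (range v) (range w) < \<eta>" for \<eta>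
  proof -
    obtain f u where f: "f \<in> O2" "obtuse u" "lat u = lat w" "range u = range w" "\<And>i. norm (f (u i) - v i) < \<eta>"
      using min_deviation_lessE[OF assms(1,2) linear_group.id_mem[OF linear_group_O2]] \<open>SIM _ _ < \<eta>\<close>
      unfolding SIM_def by metis
    have fs: "f \<in> scaled O2" using f(1) O2_scaled by blast
    have nu: "norm ((f \<circ> u) i) \<le> l" for i
    proof -
      have "u i \<in> range w" using f(4) by blast
      then show ?thesis using assms(4) f(1) by (auto simp: O2_def orthogonal_transformation_norm)
    qed
    have "RI (lat (f \<circ> u)) = RI (lat w)"
      using RI_O2[OF f(1) obtuse_lat[OF assms(2)]] lat_scaled[OF fs] f(3) by simp
    then have "\<bar>(RI (lat v) $ k)\<^sup>2 - (RI (lat w) $ k)\<^sup>2\<bar> \<le> 2 * l * \<eta>"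
      using RI_sq_close[OF assms(1) obtuse_scaled[OF fs f(2)], of \<eta> l k] f(5) assms(3) nu by (simp add: less_imp_le)
    then show ?thesis using l by (simp add: pos_divide_le_eq mult.commute)
  qed
  \<comment> \<open>What holds for every \<open>\<eta>\<close> above the infimum holds for the
    infimum; division by \<open>2 * l\<close> has isolated \<open>\<eta>\<close> for this density
    argument.\<close>
  have "\<bar>(RI (lat v) $ k)\<^sup>2 - (RI (lat w) $ k)\<^sup>2\<bar> / (2 * l) \<le> SIM (range v) (range w)"
    by (rule dense_ge) (rule b)
  then show ?thesis using l by (simp add: pos_divide_le_eq mult.commute)
qed

lemma max_norm_attained:
  fixes v w :: "3 \<Rightarrow> plane"
  assumes "Max (norm ` (range v \<union> range w)) = l"
  shows "norm (v i) \<le> l" "norm (w i) \<le> l" "\<exists>i. norm (v i) = l \<or> norm (w i) = l"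
proof -
  have fin: "finite (norm ` (range v \<union> range w))" by simp
  show "norm (v i) \<le> l" "norm (w i) \<le> l"
    using assms Max_ge[OF fin] by auto
  have "l \<in> norm ` (range v \<union> range w)" using assms Max_in[OF fin] by auto
  then show "\<exists>i. norm (v i) = l \<or> norm (w i) = l" by auto
qed

lemma RM_le_SIM:
  assumes q: "1 \<le> q" and "obtuse_superbase B \<Lambda>" "obtuse_superbase B' \<Lambda>'"
    and l: "Max (norm ` (B \<union> B')) = l"
  shows "RM q \<Lambda> \<Lambda>' \<le> 3 powr real_of_ereal (1 / q) * sqrt (2 * l * SIM B B')"
proof -
  obtain v w where v: "obtuse v" "range v = B" "lat v = \<Lambda>" and w: "obtuse w" "range w = B'" "lat w = \<Lambda>'"
    using assms(2,3) unfolding obtuse_superbase_iff by blast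
  note m = max_norm_attained[OF l[folded v(2) w(2)]]
  have "\<bar>(RI \<Lambda> - RI \<Lambda>') $ k\<bar> \<le> sqrt (2 * l * SIM B B')" for k
    using diff_le_sqrt[OF RI_props(1)[OF v(1)] RI_props(1)[OF w(1)] SIM_RI_sq[OF v(1) w(1) m(1,2)]] v w by simp
  then show ?thesis using minkowski_norm_le[OF q] unfolding RM_def by fastforce
qed

lemma PM_le_SIM:
  assumes q: "1 \<le> q" and "obtuse_superbase B \<Lambda>" "obtuse_superbase B' \<Lambda>'"
    and l: "Max (norm ` (B \<union> B')) = l"
  shows "PM q \<Lambda> \<Lambda>' \<le> 2 powr real_of_ereal (1 / q) * (3 * sqrt (2 * SIM B B' / l))"
proof -
  obtain v w where v: "obtuse v" "range v = B" "lat v = \<Lambda>" and w: "obtuse w" "range w = B'" "lat w = \<Lambda>'"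
    using assms(2,3) unfolding obtuse_superbase_iff by blast
  note m = max_norm_attained[OF l[folded v(2) w(2)]]
  have l0: "0 < l"
    using m(1)[of 0] obtuse_neq_0[OF v(1), of 0] by (meson less_le_trans zero_less_norm_iff)
  define E where "E = 2 * l * SIM B B'"
  have RE: "\<bar>(RI (lat v) $ k)\<^sup>2 - (RI (lat w) $ k)\<^sup>2\<bar> \<le> E" for k
    using SIM_RI_sq[OF v(1) w(1) m(1,2)] v w by (simp add: E_def)
  then have E0: "0 \<le> E" using abs_ge_zero order_trans by blast
  have "\<bar>PI (lat v) $ k - PI (lat w) $ k\<bar> \<le> 3 * sqrt E / l" for k
  \<comment> \<open>The sharp estimate is for positive errors; without error the two invariants
    coincide.\<close>
  proof (cases "E = 0")
    case True
    then have "RI (lat v) $ k = RI (lat w) $ k" for k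
      using diff_le_sqrt[OF RI_props(1)[OF v(1)] RI_props(1)[OF w(1)] RE, of k] by simp
    then have "RI (lat v) = RI (lat w)" by (simp add: vec_eq_iff)
    then show ?thesis using True by (simp add: PI_def)
  next
    case False
    then have e: "0 < sqrt E" using E0 by simp
    have RE': "\<bar>(RI (lat v) $ k)\<^sup>2 - (RI (lat w) $ k)\<^sup>2\<bar> \<le> (sqrt E)\<^sup>2" for k using RE E0 by simp
    then have RE'': "\<bar>(RI (lat w) $ k)\<^sup>2 - (RI (lat v) $ k)\<^sup>2\<bar> \<le> (sqrt E)\<^sup>2" for k by (simp add: abs_minus_commute)
    obtain i where "norm (v i) = l \<or> norm (w i) = l" using m(3) by blast
    then show ?thesis
    proof
      assume "norm (v i) = l"
      then show ?thesis using PI_close_sharp[OF v(1) w(1) l0 _ RE' e] RI_props(4)[OF v(1), of i] by simp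
    next
      assume "norm (w i) = l"
      then show ?thesis
        using PI_close_sharp[OF w(1) v(1) l0 _ RE'' e] RI_props(4)[OF w(1), of i] by (simp add: abs_minus_commute)
    qed
  qed
  moreover have "3 * sqrt E / l = 3 * sqrt (2 * SIM B B' / l)"
  proof -
    have "sqrt E / l = sqrt (E / l\<^sup>2)" using l0 by (simp add: real_sqrt_divide)
    also have "E / l\<^sup>2 = 2 * SIM B B' / l" using l0 by (simp add: E_def power2_eq_square)
    finally have "sqrt E / l = sqrt (2 * SIM B B' / l)" .
    then show ?thesis by (simp only: times_divide_eq_right[symmetric])
  qed
  ultimately have "\<bar>(PI \<Lambda> - PI \<Lambda>') $ k\<bar> \<le> 3 * sqrt (2 * SIM B B' / l)" for k
    unfolding v(3) w(3) by simp
  then show ?thesis using minkowski_norm_le[OF q] unfolding PM_def by fastforce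
qed

text \<open>The longest vector may belong to \<open>B'\<close>. The condition
  \<open>\<eta> \<le> l / 2\<close> still leaves a vector of length at least \<open>l / 2\<close> in
  \<open>B\<close>, so the sum of roots is at least \<open>l / 2\<close> and 24 becomes 48.\<close>

lemma oriented_metrics_le_SIMo:
  assumes q: "1 \<le> q" and "obtuse_superbase B \<Lambda>" "obtuse_superbase B' \<Lambda>'"
    and l: "Max (norm ` (B \<union> B')) = l" and \<eta>: "SIMo B B' < \<eta>" "\<eta> \<le> l / 2"
  shows "RMo q \<Lambda> \<Lambda>' \<le> 9 * sqrt (4 * l * \<eta>)" "PMo q \<Lambda> \<Lambda>' \<le> 48 * sqrt (4 * l * \<eta>) / l"
proof -
  obtain v w where v: "obtuse v" "range v = B" "lat v = \<Lambda>" and w: "obtuse w" "range w = B'" "lat w = \<Lambda>'"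
    using assms(2,3) unfolding obtuse_superbase_iff by blast
  note m = max_norm_attained[OF l[folded v(2) w(2)]]
  have l0: "0 < l"
    using m(1)[of 0] obtuse_neq_0[OF v(1), of 0] by (meson less_le_trans zero_less_norm_iff)
  obtain f u where f: "f \<in> SO2" "obtuse u" "lat u = lat w" "range u = range w" "\<And>i. norm (f (u i) - v i) < \<eta>"
    using min_deviation_lessE[OF v(1) w(1) linear_group.id_mem[OF linear_group_SO2]] \<eta>(1) v(2) w(2)
    unfolding SIMo_def by metis
  have fs: "f \<in> scaled O2" using f(1) SO2_O2 O2_scaled by blast
  have fn: "norm (f x) = norm x" for x
    using f(1) by (simp add: SO2_def orthogonal_transformation_norm)
  have nu: "norm ((f \<circ> u) i) \<le> l" for i
  proof -
    have "u i \<in> range w" using f(4) by blast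
    then obtain j where "u i = w j" by blast
    then show ?thesis using m(2)[of j] by (simp add: fn)
  qed
  have close: "norm ((f \<circ> u) i - v i) \<le> \<eta>" for i using f(5)[of i] by simp
  have \<eta>0: "0 \<le> \<eta>" using close[of 0] norm_ge_zero order_trans by blast
  note oc = oriented_close[OF q v(1) obtuse_scaled[OF fs f(2)], OF close m(1) nu]
  have lu: "lat (f \<circ> u) = f ` \<Lambda>'" using lat_scaled[OF fs] f(3) w(3) by simp
  have L: "\<Lambda> \<in> lattices" "\<Lambda>' \<in> lattices" using v w obtuse_lat by auto
  have idm: "id \<in> SO2" by (rule linear_group.id_mem[OF linear_group_SO2])
  have "RMo q (lat v) (lat (f \<circ> u)) = RMo q \<Lambda> \<Lambda>'"
    using RMo_invariant[OF idm f(1) L] lu v(3) by simp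
  then show "RMo q \<Lambda> \<Lambda>' \<le> 9 * sqrt (4 * l * \<eta>)" using oc(1) by simp
  let ?s = "RI (lat v) $ 1 + RI (lat v) $ 2 + RI (lat v) $ 3"
  have "l / 2 \<le> ?s"
  proof -
    obtain i where "norm (v i) = l \<or> norm (w i) = l" using m(3) by blast
    then have "\<exists>j. l - \<eta> \<le> norm (v j)"
    proof
      assume "norm (v i) = l"
      with \<eta>0 show ?thesis by (intro exI[of _ i]) simp
    next
      assume wi: "norm (w i) = l"
      obtain j where "w i = u j" using f(4) by blast
      then have "l - \<eta> \<le> norm (v j)"
        using wi norm_triangle_ineq2[of "f (u j)" "v j"] f(5)[of j] by (simp add: fn)
      then show ?thesis by blast
    qed
    then obtain j where "l - \<eta> \<le> norm (v j)" by blast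
    then show ?thesis using RI_props(5)[OF v(1), of j] \<eta>(2) by linarith
  qed
  then have "24 * sqrt (4 * l * \<eta>) / ?s \<le> 24 * sqrt (4 * l * \<eta>) / (l / 2)"
    using l0 RI_props(6)[OF v(1)] \<eta>0 by (intro divide_left_mono) auto
  moreover have "PMo q (lat v) (lat (f \<circ> u)) = PMo q \<Lambda> \<Lambda>'"
    using PMo_invariant[OF subsetD[OF SO2_scaled idm] subsetD[OF SO2_scaled f(1)] L] lu v(3) by simp
  ultimately show "PMo q \<Lambda> \<Lambda>' \<le> 48 * sqrt (4 * l * \<eta>) / l" using oc(2) by simp
qed

text \<open>The bound is stated for numbers \<open>\<eta>\<close> above \<open>y n\<close>; any
  fixed small one is eventually admissible.\<close>

lemma tendsto_0_if_sqrt_bound: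
  fixes x y :: "nat \<Rightarrow> real"
  assumes "y \<longlonglongrightarrow> 0" "0 < c" "\<And>n. 0 \<le> x n"
    and bound: "\<And>n \<eta>. \<lbrakk>y n < \<eta>; \<eta> \<le> c\<rbrakk> \<Longrightarrow> x n \<le> K * sqrt \<eta>"
  shows "x \<longlonglongrightarrow> 0"
proof (rule LIMSEQ_I)
  fix r :: real assume r: "0 < r"
  obtain \<eta> where \<eta>: "0 < \<eta>" "\<eta> \<le> c" "K * sqrt \<eta> < r"
    using ex_sqrt_small[OF r assms(2)] by blast
  obtain N where "\<And>n. n \<ge> N \<Longrightarrow> \<bar>y n\<bar> < \<eta>" using LIMSEQ_D[OF assms(1) \<eta>(1)] by auto
  then have "x n < r" if "n \<ge> N" for n using bound[of n \<eta>] \<eta>(2,3) that by fastforce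
  then show "\<exists>N. \<forall>n\<ge>N. norm (x n - 0) < r" using assms(3) by auto
qed

lemma oriented_limits:
  assumes q: "1 \<le> q"
    and B: "\<And>n. obtuse_superbase (B n) (\<Lambda> n)" "\<And>n. obtuse_superbase (B' n) (\<Lambda>' n)"
    and l: "\<And>n. Max (norm ` (B n \<union> B' n)) = l" and lim: "(\<lambda>n. SIMo (B n) (B' n)) \<longlonglongrightarrow> 0"
  shows "(\<lambda>n. RMo q (\<Lambda> n) (\<Lambda>' n)) \<longlonglongrightarrow> 0" "(\<lambda>n. PMo q (\<Lambda> n) (\<Lambda>' n)) \<longlonglongrightarrow> 0"
proof -
  note b = oriented_metrics_le_SIMo[OF q B l]
  have l0: "0 < l / 2"
  proof -
    obtain v w where v: "obtuse v" "range v = B 0" and w: "obtuse w" "range w = B' 0"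
      using B[of 0] unfolding obtuse_superbase_iff by blast
    have "norm (v 0) \<le> l" by (rule max_norm_attained(1)[of v w]) (use l[of 0] v w in simp)
    then show ?thesis using obtuse_neq_0[OF v(1), of 0] by (meson half_gt_zero less_le_trans zero_less_norm_iff)
  qed
  show "(\<lambda>n. RMo q (\<Lambda> n) (\<Lambda>' n)) \<longlonglongrightarrow> 0"
    by (rule tendsto_0_if_sqrt_bound[OF lim l0, of _ "9 * sqrt (4 * l)"])
      (use b(1) in \<open>auto simp: RMo_def oriented_metric_nonneg RM_nonneg real_sqrt_mult mult.assoc\<close>)
  show "(\<lambda>n. PMo q (\<Lambda> n) (\<Lambda>' n)) \<longlonglongrightarrow> 0"
    by (rule tendsto_0_if_sqrt_bound[OF lim l0, of _ "48 * sqrt (4 * l) / l"])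
      (use b(2) in \<open>auto simp: PMo_def oriented_metric_nonneg PM_nonneg real_sqrt_mult mult.assoc\<close>)
qed

theorem theorem7p5:
  fixes q :: ereal
  assumes "1 \<le> q"
  shows
    \<comment> \<open>note that \<open>1 / \<infinity> = 0\<close>, so the constants are 1 for infinite \<open>q\<close>\<close>
    "((\<forall>\<Lambda> \<Lambda>' B B' l \<delta>. \<Lambda> \<in> lattices \<and> \<Lambda>' \<in> lattices \<and>
        obtuse_superbase B \<Lambda> \<and> obtuse_superbase B' \<Lambda>' \<and>
        Max (norm ` (B \<union> B')) = l \<and> SIM B B' = \<delta> \<longrightarrow>
        RM q \<Lambda> \<Lambda>' \<le> 3 powr real_of_ereal (1 / q) * sqrt (2 * l * \<delta>))
     \<and> bij_betw (generated_class {f. isometry f}) OSI LIS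
     \<and> continuous_class_map OSI SIM LIS (RM q) (generated_class {f. isometry f}))
     \<and>
     ((\<forall>\<Lambda> \<Lambda>' B B' l \<delta>. \<Lambda> \<in> lattices \<and> \<Lambda>' \<in> lattices \<and>
        obtuse_superbase B \<Lambda> \<and> obtuse_superbase B' \<Lambda>' \<and>
        Max (norm ` (B \<union> B')) = l \<and> SIM B B' = \<delta> \<longrightarrow>
        PM q \<Lambda> \<Lambda>' \<le> 2 powr real_of_ereal (1 / q) * (3 * sqrt (2 * \<delta> / l)))
     \<and> bij_betw (generated_class {f. similarity f}) OSS LSS
     \<and> continuous_class_map OSS SIM LSS (PM q) (generated_class {f. similarity f})
     \<and> continuous_class_map OSS SSM LSS (PM q) (generated_class {f. similarity f}))
     \<and>
     ((\<forall>\<Lambda> \<Lambda>' B B' l. (\<forall>n::nat. \<Lambda> n \<in> lattices \<and> \<Lambda>' n \<in> lattices \<and>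
        obtuse_superbase (B n) (\<Lambda> n) \<and> obtuse_superbase (B' n) (\<Lambda>' n) \<and>
        Max (norm ` (B n \<union> B' n)) = l) \<and>
        (\<lambda>n. SIMo (B n) (B' n)) \<longlonglongrightarrow> 0 \<longrightarrow>
        (\<lambda>n. RMo q (\<Lambda> n) (\<Lambda>' n)) \<longlonglongrightarrow> 0 \<and> (\<lambda>n. PMo q (\<Lambda> n) (\<Lambda>' n)) \<longlonglongrightarrow> 0)
     \<and> continuous_class_map OSIo SIMo LISo (RMo q) (generated_class {f. rigid_motion f})
     \<and> continuous_class_map OSSo SIMo LSSo (PMo q) (generated_class {f. oriented_similarity f})
     \<and> continuous_class_map OSSo SSMo LSSo (PMo q) (generated_class {f. oriented_similarity f}))"
proof -
  interpret O2: linear_group O2 by (rule linear_group_O2)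
  interpret SO2: linear_group SO2 by (rule linear_group_SO2)
  interpret sO2: linear_group "scaled O2" by (rule linear_group_scaled[OF linear_group_O2 order_refl])
  interpret sSO2: linear_group "scaled SO2" by (rule linear_group_scaled[OF linear_group_SO2 SO2_O2])
  have c1: "continuous_class_map OSI SIM LIS (RM q) (generated_class {f. isometry f})"
    unfolding isometries_eq SIM_def
    by (rule O2.continuous_generated_class[OF order_refl O2.id_mem], (rule RM_O2; assumption), rule local_continuity[OF assms]) auto
  have c2: "continuous_class_map OSS SIM LSS (PM q) (generated_class {f. similarity f})"
    unfolding similarities_eq SIM_def
    by (rule sO2.continuous_generated_class[OF O2_scaled O2.id_mem], (rule PM_scaled_O2; assumption), rule local_continuity[OF assms]) auto
  have c3: "continuous_class_map OSS SSM LSS (PM q) (generated_class {f. similarity f})"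
    unfolding similarities_eq SSM_def
    by (rule sO2.continuous_generated_class[OF order_refl sO2.id_mem], (rule PM_scaled_O2; assumption), rule local_continuity[OF assms]) auto
  have c4: "continuous_class_map OSIo SIMo LISo (RMo q) (generated_class {f. rigid_motion f})"
    unfolding rigid_motions_eq SIMo_def
    by (rule SO2.continuous_generated_class[OF order_refl SO2.id_mem], (rule RMo_invariant; assumption), rule local_continuity[OF assms]) auto
  have c5: "continuous_class_map OSSo SIMo LSSo (PMo q) (generated_class {f. oriented_similarity f})"
    unfolding oriented_similarities_eq SIMo_def
    by (rule sSO2.continuous_generated_class[OF SO2_scaled SO2.id_mem], (rule PMo_invariant; assumption), rule local_continuity[OF assms]) auto
  have c6: "continuous_class_map OSSo SSMo LSSo (PMo q) (generated_class {f. oriented_similarity f})"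
    unfolding oriented_similarities_eq SSMo_def
    by (rule sSO2.continuous_generated_class[OF order_refl sSO2.id_mem], (rule PMo_invariant; assumption), rule local_continuity[OF assms]) auto
  have b1: "bij_betw (generated_class {f. isometry f}) OSI LIS"
    unfolding isometries_eq by (rule O2.bij_generated_class) simp
  have b2: "bij_betw (generated_class {f. similarity f}) OSS LSS"
    unfolding similarities_eq by (rule sO2.bij_generated_class[OF O2_scaled])
  have lim: "(\<lambda>n. RMo q (\<Lambda> n) (\<Lambda>' n)) \<longlonglongrightarrow> 0 \<and> (\<lambda>n. PMo q (\<Lambda> n) (\<Lambda>' n)) \<longlonglongrightarrow> 0"
    if "\<forall>n. \<Lambda> n \<in> lattices \<and> \<Lambda>' n \<in> lattices \<and> obtuse_superbase (B n) (\<Lambda> n) \<and>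
      obtuse_superbase (B' n) (\<Lambda>' n) \<and> Max (norm ` (B n \<union> B' n)) = l"
      "(\<lambda>n. SIMo (B n) (B' n)) \<longlonglongrightarrow> 0" for \<Lambda> \<Lambda>' B B' l
    using oriented_limits[OF assms, of B \<Lambda> B' \<Lambda>' l] that by simp
  show ?thesis
    by (intro conjI c1 c2 c3 c4 c5 c6 b1 b2)
      (use RM_le_SIM[OF assms] PM_le_SIM[OF assms] lim in blast)+
qed

end
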